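(* Let $k$ be a finite field and $\Gamma$ a countable amenable group. Then the following are equivalent: (1) For any countable left $k\Gamma$-module $\mathcal{M}$, treating $\mathcal{M}$ as a left $\mathbb{Z}\Gamma$-module, $\rho(\mathcal{M})/\log|k|$ is either an integer or $\infty$; (2) For any finitely generated left $k\Gamma$-module $\mathcal{M}$, treating $\mathcal{M}$ as a $\mathbb{Z}\Gamma$-module, $\rho(\mathcal{M})/\log|k|$ is an integer; (3) For any nonzero left ideal $\mathcal{J}$ of $k\Gamma$, treating $k\Gamma/\mathcal{J}$ as a $\mathbb{Z}\Gamma$-module, $\rho(k\Gamma/\mathcal{J})=0$; (4) For any nonzero $f$ in $k\Gamma$, treating $k\Gamma/k\Gamma f$ as a $\mathbb{Z}\Gamma$-module, $\rho(k\Gamma/k\Gamma f)=0$; (5) $k\Gamma$ contains no (non-trivial) zero-divisors.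
   Context: $\Gamma$ is regarded as a discrete group. For a countable left $\mathbb{Z}\Gamma$-module $\mathcal{M}$, let $\widehat{\mathcal{M}}=\mathrm{Hom}_{\mathbb{Z}}(\mathcal{M},S^1)$ be the Pontryagin dual of the discrete abelian group $\mathcal{M}$, on which $\Gamma$ acts by continuous automorphisms (dual action). The torsion $\rho(\mathcal{M})\in[0,\infty]$ is the topological entropy of $\Gamma\curvearrowright\widehat{\mathcal{M}}$. *)

theory Defs
  imports
    "HOL-Analysis.Analysis"
    "HOL-Algebra.Module"
    "HOL-Algebra.AbelCoset"
    "HOL-Library.Poly_Mapping"
begin

text \<open>
  The (not necessarily commutative) group \<open>\<Gamma>\<close> is a type of class \<^class>\<open>group_add\<close>, written
  additively, and the group ring \<open>R\<Gamma>\<close> is the type \<open>'g \<Rightarrow>\<^sub>0 'r\<close> with its convolution product: there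
  \<open>Poly_Mapping.single g 1\<close> is the group element \<open>g\<close>.
\<close>

section \<open>Left modules\<close>

text \<open>
  The library locale \<^locale>\<open>module\<close> requires commutative scalars.  Here the scalars form an
  arbitrary ring type, while the module has an explicit carrier.  The multiplicative fields
  \<open>mult\<close> and \<open>one\<close> of the underlying ring record play no role.  Carriers live in a type \<open>'m\<close>; if
  \<open>'m\<close> is infinite, then every countable module is isomorphic to one with carrier in \<open>'m\<close>.
\<close>

locale left_module = abelian_group M for M :: "('r::ring_1, 'm) module" (structure) +
  assumes smult_closed: "x \<in> carrier M \<Longrightarrow> a \<odot> x \<in> carrier M"
    and smult_l_distr: "x \<in> carrier M \<Longrightarrow> (a + b) \<odot> x = a \<odot> x \<oplus> b \<odot> x"
    and smult_r_distr: "x \<in> carrier M \<Longrightarrow> y \<in> carrier M \<Longrightarrow> a \<odot> (x \<oplus> y) = a \<odot> x \<oplus> a \<odot> y"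
    and smult_assoc: "x \<in> carrier M \<Longrightarrow> (a * b) \<odot> x = a \<odot> (b \<odot> x)"
    and smult_one: "x \<in> carrier M \<Longrightarrow> 1 \<odot> x = x"

definition finitely_generated :: "('r::ring_1, 'm) module \<Rightarrow> bool" where
  "finitely_generated M \<longleftrightarrow>
     (\<exists>S. finite S \<and> S \<subseteq> carrier M \<and>
          (\<forall>x\<in>carrier M. \<exists>a. x = (\<Oplus>\<^bsub>M\<^esub>s\<in>S. a s \<odot>\<^bsub>M\<^esub> s)))"

definition regular_module :: "('r::ring_1, 'r) module" where
  "regular_module = \<lparr>carrier = UNIV, mult = (*), one = 1, zero = 0, add = (+), smult = (*)\<rparr>"

definition left_ideal :: "'r::ring_1 set \<Rightarrow> bool" where
  "left_ideal J \<longleftrightarrow> 0 \<in> J \<and> (\<forall>x\<in>J. \<forall>y\<in>J. x + y \<in> J) \<and> (\<forall>a. \<forall>x\<in>J. a * x \<in> J)"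

definition principal_left_ideal :: "'r::ring_1 \<Rightarrow> 'r set" where
  "principal_left_ideal f = range (\<lambda>a. a * f)"

definition quotient_module :: "('r::ring_1, 'm) module \<Rightarrow> 'm set \<Rightarrow> ('r, 'm set) module" where
  "quotient_module M N =
     \<lparr>carrier = a_rcosets\<^bsub>M\<^esub> N, mult = undefined, one = undefined,
      zero = N, add = set_add M,
      smult = (\<lambda>a X. \<Union>x\<in>X. N +>\<^bsub>M\<^esub> (a \<odot>\<^bsub>M\<^esub> x))\<rparr>"

text \<open>Restriction of scalars along the ring homomorphism \<open>\<int>\<Gamma> \<rightarrow> k\<Gamma>\<close> induced by \<open>\<int> \<rightarrow> k\<close>.\<close>

definition int_group_module ::
    "('g::group_add \<Rightarrow>\<^sub>0 'k::ring_1, 'm) module \<Rightarrow> ('g \<Rightarrow>\<^sub>0 int, 'm) module" where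
  "int_group_module M =
     \<lparr>carrier = carrier M, mult = mult M, one = one M, zero = zero M, add = add M,
      smult = (\<lambda>a. smult M (Poly_Mapping.map of_int a))\<rparr>"

section \<open>Amenability\<close>

definition almost_invariant :: "'g::group_add set \<Rightarrow> real \<Rightarrow> 'g set \<Rightarrow> bool" where
  "almost_invariant K \<delta> F \<longleftrightarrow> finite F \<and> F \<noteq> {} \<and>
     (\<forall>s\<in>K. real (card (sym_diff ((+) s ` F) F)) \<le> \<delta> * real (card F))"

definition amenable :: "'g::group_add itself \<Rightarrow> bool" where
  "amenable _ \<longleftrightarrow>
     (\<forall>(K :: 'g set) \<delta>. finite K \<and> \<delta> > 0 \<longrightarrow> (\<exists>F. almost_invariant K \<delta> F))"

text \<open>Convergence along this filter is convergence ``as \<open>F\<close> becomes more and more left invariant''.\<close>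

definition folner_filter :: "'g::group_add set filter" where
  "folner_filter =
     (INF (K, \<delta>) \<in> {(K, \<delta>). finite K \<and> \<delta> > 0}. principal {F. almost_invariant K \<delta> F})"

section \<open>Topological entropy\<close>

definition open_cover :: "'x topology \<Rightarrow> 'x set set \<Rightarrow> bool" where
  "open_cover X \<U> \<longleftrightarrow> (\<forall>U\<in>\<U>. openin X U) \<and> \<Union>\<U> = topspace X"

definition cover_number :: "'x topology \<Rightarrow> 'x set set \<Rightarrow> nat" where
  "cover_number X \<U> =
     (LEAST n. \<exists>\<V>. \<V> \<subseteq> \<U> \<and> finite \<V> \<and> card \<V> = n \<and> \<Union>\<V> = topspace X)"

text \<open>The join over \<open>s \<in> F\<close> of the covers \<open>s\<^sup>-\<^sup>1 \<U>\<close>.\<close>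

definition cover_join ::
    "'x topology \<Rightarrow> ('g \<Rightarrow> 'x \<Rightarrow> 'x) \<Rightarrow> 'g set \<Rightarrow> 'x set set \<Rightarrow> 'x set set" where
  "cover_join X \<alpha> F \<U> = {{x \<in> topspace X. \<forall>s\<in>F. \<alpha> s x \<in> c s} | c. \<forall>s\<in>F. c s \<in> \<U>}"

text \<open>
  For an action of an amenable group on a nonempty compact space the upper limit below is a limit,
  by the Ornstein--Weiss lemma: \<open>F \<mapsto> ln N(\<U>\<^sup>F)\<close> is subadditive and invariant under right
  translation of \<open>F\<close>, which matches the left invariance of the sets \<open>F\<close>.
\<close>

definition cover_entropy ::
    "'x topology \<Rightarrow> ('g::group_add \<Rightarrow> 'x \<Rightarrow> 'x) \<Rightarrow> 'x set set \<Rightarrow> ereal" where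
  "cover_entropy X \<alpha> \<U> =
     Limsup folner_filter
       (\<lambda>F. ereal (ln (real (cover_number X (cover_join X \<alpha> F \<U>))) / real (card F)))"

definition topological_entropy ::
    "'x topology \<Rightarrow> ('g::group_add \<Rightarrow> 'x \<Rightarrow> 'x) \<Rightarrow> ereal" where
  "topological_entropy X \<alpha> = (SUP \<U> \<in> {\<U>. open_cover X \<U>}. cover_entropy X \<alpha> \<U>)"

section \<open>The Pontryagin dual and torsion\<close>

text \<open>
  Characters of the discrete group \<open>M\<close> with the topology of pointwise convergence, which is the
  compact-open topology.
\<close>

definition pontryagin_dual :: "('r, 'm) module \<Rightarrow> ('m \<Rightarrow> complex) topology" where
  "pontryagin_dual M =
     subtopology (product_topology (\<lambda>_. top_of_set (sphere 0 1)) (carrier M))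
       {u. \<forall>x\<in>carrier M. \<forall>y\<in>carrier M. u (x \<oplus>\<^bsub>M\<^esub> y) = u x * u y}"

definition dual_action ::
    "('g::group_add \<Rightarrow>\<^sub>0 int, 'm) module \<Rightarrow> 'g \<Rightarrow> ('m \<Rightarrow> complex) \<Rightarrow> 'm \<Rightarrow> complex" where
  "dual_action M g u = (\<lambda>x\<in>carrier M. u (Poly_Mapping.single (- g) 1 \<odot>\<^bsub>M\<^esub> x))"

definition torsion :: "('g::group_add \<Rightarrow>\<^sub>0 int, 'm) module \<Rightarrow> ereal" where
  "torsion M = topological_entropy (pontryagin_dual M) (dual_action M)"

end

theory Submission
  imports Defs "HOL-Number_Theory.Cong"
begin

text \<open>
  Everything is reduced to counting vectors over \<open>k\<close>. For a finite subset \<open>E\<close> of a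
  \<open>k\<Gamma>\<close>-module and a finite set \<open>F \<subseteq> \<Gamma>\<close>, let \<open>\<phi>(F)\<close> be the logarithm of the number of
  elements of the \<open>k\<close>-space spanned by \<open>F\<^sup>-\<^sup>1 E\<close>. This function of \<open>F\<close> is submodular
  and invariant under right translation, so Shearer's inequality, applied to the right
  translates of a fixed set, shows that \<open>\<phi>(F) / card F\<close> converges along the Foelner filter
  to its infimum over all finite nonempty \<open>F\<close>. The limit is the growth rate of \<open>E\<close>
  (\<open>tendsto_mean\<close>, \<open>submodular_invariant_log_growth\<close>).

  The torsion of the module is the supremum of these growth rates
  (\<open>torsion_eq_SUP_growth_rate\<close>). Indeed, a finite subgroup \<open>V\<close> of the module has exactly
  \<open>card V\<close> characters, and all of them extend to the module because its additive group has
  prime exponent (\<open>card_restrictions\<close>). Hence the clopen partition of the dual by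
  restriction to \<open>V\<close> has \<open>card V\<close> parts, its join over \<open>F\<close> is the partition belonging
  to the span of \<open>F\<^sup>-\<^sup>1 V\<close>, and by compactness every open cover is coarser than one of
  these partitions. For a finitely generated module a generating set attains the supremum.

  Write \<open>q = ln (card k)\<close>. The torsion of a finitely generated module is a growth rate,
  hence finite, so the value \<open>\<infinity>\<close> occurs only for modules that are not finitely generated.
  If \<open>J\<close> contains \<open>a \<noteq> 0\<close>, then \<open>a\<close> annihilates the generator of \<open>k\<Gamma> / J\<close>, so the
  infimum that defines the growth rate lies below \<open>q\<close>; if the torsion is an integral
  multiple of \<open>q\<close>, then it vanishes. Principal left ideals are a special case.

  Let the torsion of all \<open>k\<Gamma> / k\<Gamma> h\<close> with \<open>h \<noteq> 0\<close> vanish, and suppose that \<open>f h = 0\<close>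
  with \<open>f\<close> and \<open>h\<close> nonzero. As before, the growth rate of \<open>h\<close> in \<open>k\<Gamma>\<close> lies below
  \<open>q\<close>. But the growth rates of \<open>h\<close> in \<open>k\<Gamma>\<close> and of the generator of \<open>k\<Gamma> / k\<Gamma> h\<close> add up
  to at least \<open>q\<close> (\<open>growth_rate_quotient_principal_ge\<close>): the elements of \<open>k\<Gamma> h\<close> with
  support in one set \<open>E\<^sup>-\<^sup>1\<close> have translates that span a large subspace of \<open>k\<Gamma> h\<close>, by an
  inequality dual to Shearer's (\<open>sum_ln_card_le_ln_card\<close>). So the torsion of \<open>k\<Gamma> / k\<Gamma> h\<close>
  is positive, a contradiction.

  Finally, let \<open>k\<Gamma>\<close> have no zero-divisors, and adjoin an element \<open>x\<close> to \<open>E\<close>. If no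
  nonzero multiple of \<open>x\<close> lies in the submodule generated by \<open>E\<close>, then the growth rate
  increases by \<open>q\<close>. Otherwise some \<open>f x\<close> with \<open>f \<noteq> 0\<close> lies there; since \<open>f\<close> is not a
  zero-divisor, its multiples fill up almost all of the coefficients available to \<open>x\<close>, and
  the growth rate does not change. So all growth rates are integral multiples of \<open>q\<close>, and
  their supremum is one of them or infinite.
\<close>

section \<open>Submodular functions and averages along the Foelner filter\<close>

text \<open>
  Diminishing returns: adding a point \<open>x\<close> to \<open>F\<close> raises \<open>f F\<close> by at most as much as it
  raises \<open>f (A i \<inter> F)\<close>, for every \<open>A i\<close> that contains \<open>x\<close>. There are at least \<open>m\<close>
  such \<open>i\<close>.
\<close>

lemma shearer_inequality:
  fixes f :: "'a set \<Rightarrow> real"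
  assumes "finite I" "finite F" and empty: "f {} = 0"
    and mono: "\<And>A B. finite B \<Longrightarrow> A \<subseteq> B \<Longrightarrow> f A \<le> f B"
    and submodular: "\<And>A B. finite A \<Longrightarrow> finite B \<Longrightarrow> f (A \<union> B) + f (A \<inter> B) \<le> f A + f B"
    and cover: "\<And>x. x \<in> F \<Longrightarrow> m \<le> card {i\<in>I. x \<in> A i}"
  shows "real m * f F \<le> (\<Sum>i\<in>I. f (A i \<inter> F))"
  using \<open>finite F\<close> cover
proof (induction F rule: finite_induct)
  case empty
  then show ?case by (simp add: assms)
next
  case (insert x F)
  define d where "d = f (insert x F) - f F"
  have d: "d \<ge> 0" using mono[of "insert x F" F] insert.hyps by (auto simp: d_def)
  have step: "f (A i \<inter> F) + (if x \<in> A i then d else 0) \<le> f (A i \<inter> insert x F)" for i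
  proof (cases "x \<in> A i")
    case True
    have "f ((A i \<inter> insert x F) \<union> F) + f ((A i \<inter> insert x F) \<inter> F) \<le> f (A i \<inter> insert x F) + f F"
      by (rule submodular) (use insert.hyps in auto)
    moreover have "(A i \<inter> insert x F) \<union> F = insert x F" "(A i \<inter> insert x F) \<inter> F = A i \<inter> F"
      using True by auto
    ultimately show ?thesis using True by (simp add: d_def)
  qed auto
  have "real m * f (insert x F) = real m * f F + real m * d" by (simp add: d_def algebra_simps)
  also have "\<dots> \<le> (\<Sum>i\<in>I. f (A i \<inter> F)) + real (card {i\<in>I. x \<in> A i}) * d"
    using insert.IH insert.prems d by (intro add_mono mult_right_mono) auto
  also have "\<dots> = (\<Sum>i\<in>I. f (A i \<inter> F) + (if x \<in> A i then d else 0))"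
    using \<open>finite I\<close> by (simp add: sum.distrib sum.If_cases Int_def)
  also have "\<dots> \<le> (\<Sum>i\<in>I. f (A i \<inter> insert x F))" by (intro sum_mono step)
  finally show ?case .
qed

text \<open>
  The product set \<open>S F\<close> of a group, in additive notation.
\<close>

definition dilate :: "'g::group_add set \<Rightarrow> 'g set \<Rightarrow> 'g set" where
  "dilate S F = (\<Union>s\<in>S. (+) s ` F)"

lemma finite_dilate [simp]: "finite S \<Longrightarrow> finite F \<Longrightarrow> finite (dilate S F)"
  by (simp add: dilate_def)

lemma subset_dilate: "0 \<in> S \<Longrightarrow> F \<subseteq> dilate S F"
  by (force simp: dilate_def)

lemma plus_in_dilate: "s \<in> S \<Longrightarrow> x \<in> F \<Longrightarrow> s + x \<in> dilate S F"
  by (auto simp: dilate_def)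

lemma dilate_mono_right: "T \<subseteq> T' \<Longrightarrow> dilate S T \<subseteq> dilate S T'"
  unfolding dilate_def by (intro UN_mono image_mono order_refl)

lemma uminus_dilate: "uminus ` dilate K F = dilate (uminus ` F) (uminus ` K)"
  by (force simp: dilate_def image_iff group_add_class.minus_add)

lemma eventually_almost_invariant:
  "finite K \<Longrightarrow> \<delta> > 0 \<Longrightarrow> eventually (almost_invariant K \<delta>) folner_filter"
  unfolding folner_filter_def
  by (rule eventually_INF1[of "(K, \<delta>)"]) (auto simp: eventually_principal)

text \<open>
  Finitely many constraints \<open>(K, \<delta>)\<close> hold together as soon as the union of the sets \<open>K\<close>
  and the least \<open>\<delta>\<close> are admitted, and amenability provides a set for these.
\<close>

lemma folner_filter_neq_bot:
  assumes "amenable TYPE('g::group_add)"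
  shows "(folner_filter :: 'g set filter) \<noteq> bot"
  unfolding folner_filter_def
proof (rule INF_filter_not_bot)
  fix P :: "('g set \<times> real) set"
  assume P: "P \<subseteq> {(K, \<delta>). finite K \<and> \<delta> > 0}" "finite P"
  define K where "K = (\<Union>(K, \<delta>)\<in>P. K)"
  define \<delta> where "\<delta> = Min (insert 1 (snd ` P))"
  have "finite K" using P by (auto simp: K_def)
  moreover have "\<delta> > 0" using P by (auto simp: \<delta>_def)
  ultimately obtain F where F: "almost_invariant K \<delta> F"
    using assms by (auto simp: amenable_def)
  have "almost_invariant K' \<delta>' F" if "(K', \<delta>') \<in> P" for K' \<delta>'
  proof -
    have "K' \<subseteq> K" using that by (auto simp: K_def)
    moreover have "\<delta> \<le> \<delta>'" unfolding \<delta>_def using that P by (intro Min_le) force+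
    ultimately show ?thesis using F unfolding almost_invariant_def
      by (meson mult_right_mono of_nat_0_le_iff order_trans subsetD)
  qed
  then have "principal {F} \<le> (INF (K, \<delta>)\<in>P. principal {F. almost_invariant K \<delta> F})"
    by (intro INF_greatest) auto
  then show "(INF (K, \<delta>)\<in>P. principal {F. almost_invariant K \<delta> F}) \<noteq> bot"
    using principal_eq_bot_iff[of "{F}"] by (auto simp del: principal_eq_bot_iff dest!: bot.extremum_uniqueI)
qed

lemma card_dilate_le:
  assumes "almost_invariant S \<delta> F" "finite S"
  shows "real (card (dilate S F)) \<le> real (card F) * (1 + \<delta> * real (card S))"
proof -
  have fin: "finite F" using assms by (simp add: almost_invariant_def)
  have "card (dilate S F) \<le> card (F \<union> (\<Union>s\<in>S. sym_diff ((+) s ` F) F))"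
    by (rule card_mono) (use fin assms in \<open>auto simp: dilate_def\<close>)
  also have "\<dots> \<le> card F + (\<Sum>s\<in>S. card (sym_diff ((+) s ` F) F))"
    using card_Un_le[of F] card_UN_le[OF \<open>finite S\<close>, of "\<lambda>s. sym_diff ((+) s ` F) F"]
    by (meson add_left_mono order_trans)
  finally have "real (card (dilate S F)) \<le> real (card F) + (\<Sum>s\<in>S. real (card (sym_diff ((+) s ` F) F)))"
    using of_nat_mono[where 'a = real] by fastforce
  also have "\<dots> \<le> real (card F) + (\<Sum>s\<in>S. \<delta> * real (card F))"
    using assms by (intro add_left_mono sum_mono) (auto simp: almost_invariant_def)
  finally show ?thesis by (simp add: algebra_simps)
qed

lemma eventually_card_dilate_le:
  assumes "finite S" "\<epsilon> > 0"
  shows "eventually (\<lambda>F. finite F \<and> F \<noteq> {} \<and> real (card (dilate S F)) \<le> real (card F) * (1 + \<epsilon>)) folner_filter"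
proof -
  define \<delta> where "\<delta> = \<epsilon> / (1 + real (card S))"
  have "\<delta> > 0" "\<delta> * real (card S) \<le> \<epsilon>" using assms by (auto simp: \<delta>_def field_simps add_pos_nonneg)
  have "real (card F) * (1 + \<delta> * real (card S)) \<le> real (card F) * (1 + \<epsilon>)" for F :: "'a set"
    using \<open>\<delta> * real (card S) \<le> \<epsilon>\<close> by (intro mult_left_mono) auto
  note le = this
  from eventually_almost_invariant[OF assms(1) \<open>\<delta> > 0\<close>] show ?thesis
  proof eventually_elim
    case (elim F)
    then show ?case
      using card_dilate_le[OF elim assms(1)] le[of F] by (auto simp: almost_invariant_def)
  qed
qed

lemma eventually_finite_nonempty: "\<forall>\<^sub>F F in folner_filter. finite F \<and> F \<noteq> {}"
  using eventually_card_dilate_le[OF finite.emptyI zero_less_one] by (rule eventually_mono) auto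

lemma tendsto_card_dilate:
  assumes "finite S" "0 \<in> S"
  shows "((\<lambda>F. real (card (dilate S F)) / real (card F)) \<longlongrightarrow> 1) folner_filter"
proof (rule tendstoI)
  fix e :: real assume "e > 0"
  then have "e/2 > 0" by simp
  from eventually_card_dilate_le[OF assms(1) this]
  show "\<forall>\<^sub>F F in folner_filter. dist (real (card (dilate S F)) / real (card F)) 1 < e"
  proof eventually_elim
    case (elim F)
    then have "card F \<le> card (dilate S F)" "card F > 0"
      using subset_dilate[OF assms(2)] assms by (auto intro!: card_mono simp: card_gt_0_iff)
    then have "real (card (dilate S F)) / real (card F) \<ge> 1" by (simp)
    moreover have "real (card (dilate S F)) / real (card F) \<le> 1 + e/2"
      using elim \<open>card F > 0\<close> by (simp add: field_simps)
    ultimately show ?case using \<open>e > 0\<close> by (simp add: dist_real_def)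
  qed
qed

text \<open>
  The properties of the entropy of finite sets of coordinates that make averages along the
  Foelner filter converge. Invariance under right translation goes with left invariance of
  the Foelner sets.
\<close>

locale submodular_invariant =
  fixes f :: "'g::group_add set \<Rightarrow> real"
  assumes empty: "f {} = 0"
    and mono: "finite B \<Longrightarrow> A \<subseteq> B \<Longrightarrow> f A \<le> f B"
    and submodular: "finite A \<Longrightarrow> finite B \<Longrightarrow> f (A \<union> B) + f (A \<inter> B) \<le> f A + f B"
    and right_invariant: "f ((\<lambda>x. x + g) ` F) = f F"
begin

definition mean :: real where
  "mean = (INF F\<in>{F. finite F \<and> F \<noteq> {}}. f F / real (card F))"

lemma nonneg: "finite F \<Longrightarrow> f F \<ge> 0"
  using mono[of F "{}"] empty by simp

lemma mean_le:
  assumes "finite F" "F \<noteq> {}"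
  shows "mean \<le> f F / real (card F)"
  unfolding mean_def
proof (rule cINF_lower)
  show "bdd_below ((\<lambda>F. f F / real (card F)) ` {F. finite F \<and> F \<noteq> {}})"
    by (rule bdd_belowI[of _ 0]) (auto simp: nonneg)
qed (use assms in auto)

lemma mean_nonneg: "mean \<ge> 0"
  unfolding mean_def by (rule cINF_greatest) (auto simp: nonneg intro: exI[of _ "{undefined}"])

lemma right_translate_multiplicity: "card {g \<in> dilate (uminus ` E) F. x \<in> (\<lambda>y. y + g) ` E} = card E"
  if "x \<in> F" for x
proof -
  have "{g \<in> dilate (uminus ` E) F. x \<in> (\<lambda>y. y + g) ` E} = (\<lambda>e. - e + x) ` E"
  proof (intro equalityI subsetI)
    fix g assume "g \<in> {g \<in> dilate (uminus ` E) F. x \<in> (\<lambda>y. y + g) ` E}"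
    then obtain e where "e \<in> E" "x = e + g" by auto
    then have "g = - e + x" by (simp add: add.assoc[symmetric])
    then show "g \<in> (\<lambda>e. - e + x) ` E" using \<open>e \<in> E\<close> by blast
  next
    fix g assume "g \<in> (\<lambda>e. - e + x) ` E"
    then obtain e where e: "e \<in> E" "g = - e + x" by auto
    then have "x = e + g" by (simp add: add.assoc[symmetric])
    then show "g \<in> {g \<in> dilate (uminus ` E) F. x \<in> (\<lambda>y. y + g) ` E}"
      using e that plus_in_dilate[of "- e" "uminus ` E" x F] image_eqI[of x "\<lambda>y. y + g" e E] by auto
  qed
  then show ?thesis by (simp add: card_image inj_on_def)
qed

text \<open>
  The right translates of \<open>E\<close> that meet \<open>F\<close> are indexed by \<open>E\<^sup>-\<^sup>1 F\<close> and cover every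
  point of \<open>F\<close> exactly \<open>card E\<close> times, so this is Shearer's inequality.
\<close>

lemma card_mult_le_card_dilate_mult:
  assumes "finite E" "finite F"
  shows "real (card E) * f F \<le> real (card (dilate (uminus ` E) F)) * f E"
proof -
  have "real (card E) * f F \<le> (\<Sum>g\<in>dilate (uminus ` E) F. f (((\<lambda>y. y + g) ` E) \<inter> F))"
    by (rule shearer_inequality) (use assms empty mono submodular in \<open>auto simp: right_translate_multiplicity\<close>)
  also have "\<dots> \<le> (\<Sum>g\<in>dilate (uminus ` E) F. f E)"
  proof (intro sum_mono)
    fix g
    have "f (((\<lambda>y. y + g) ` E) \<inter> F) \<le> f ((\<lambda>y. y + g) ` E)"
      by (rule mono) (use assms in auto)
    then show "f (((\<lambda>y. y + g) ` E) \<inter> F) \<le> f E" by (simp add: right_invariant)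
  qed
  finally show ?thesis by simp
qed

text \<open>
  All quotients are at least \<open>mean\<close>. Conversely, let \<open>E\<close> nearly attain the infimum. If
  \<open>F\<close> is sufficiently invariant, then \<open>E\<^sup>-\<^sup>1 F\<close> is hardly larger than \<open>F\<close>, and the
  quotient for \<open>F\<close> is hardly larger than that for \<open>E\<close>.
\<close>

proposition tendsto_mean: "((\<lambda>F. f F / real (card F)) \<longlongrightarrow> mean) folner_filter"
proof (rule order_tendstoI)
  fix a assume "a < mean"
  show "\<forall>\<^sub>F F in folner_filter. a < f F / real (card F)"
    using eventually_finite_nonempty by eventually_elim (use mean_le \<open>a < mean\<close> in force)
next
  fix a assume "mean < a"
  have "bdd_below ((\<lambda>F. f F / real (card F)) ` {F. finite F \<and> F \<noteq> {}})"
    by (rule bdd_belowI[of _ 0]) (auto simp: nonneg)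
  moreover have "{F :: 'g set. finite F \<and> F \<noteq> {}} \<noteq> {}"
    by (auto intro: exI[of _ "{undefined}"])
  ultimately obtain E where E: "finite E" "E \<noteq> {}" "f E / real (card E) < a"
    using \<open>mean < a\<close> unfolding mean_def by (subst (asm) cINF_less_iff) auto
  define b where "b = f E / real (card E)"
  have cE: "card E > 0" using E by (simp add: card_gt_0_iff)
  have b: "0 \<le> b" "b < a" using E nonneg by (auto simp: b_def)
  \<comment> \<open>The factor by which \<open>E\<^sup>-\<^sup>1 F\<close> may exceed \<open>F\<close> without pushing the bound \<open>b\<close> beyond
    \<open>a\<close>.\<close>
  obtain \<epsilon> where \<epsilon>: "\<epsilon> > 0" "(1 + \<epsilon>) * b < a"
  proof
    show "(a - b) / (1 + b) > 0" using b by simp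
    have "(1 + (a - b) / (1 + b)) * b = b + (a - b) * (b / (1 + b))" using b by (simp add: field_simps)
    also have "\<dots> < b + (a - b) * 1" using b by (intro add_strict_left_mono mult_strict_left_mono) auto
    finally show "(1 + (a - b) / (1 + b)) * b < a" by simp
  qed
  have "finite (uminus ` E)" using E by simp
  from eventually_card_dilate_le[OF this \<epsilon>(1)]
  show "\<forall>\<^sub>F F in folner_filter. f F / real (card F) < a"
  proof eventually_elim
    case (elim F)
    then have cF: "real (card F) > 0" by (simp add: card_gt_0_iff)
    have "real (card E) * f F \<le> real (card (dilate (uminus ` E) F)) * f E"
      using elim E by (intro card_mult_le_card_dilate_mult) auto
    also have "\<dots> \<le> real (card F) * (1 + \<epsilon>) * f E"
      using elim E by (intro mult_right_mono nonneg) auto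
    also have "\<dots> = real (card E) * (real (card F) * ((1 + \<epsilon>) * b))" using cE by (simp add: b_def)
    also have "\<dots> < real (card E) * (real (card F) * a)" using cE cF \<epsilon> by (intro mult_strict_left_mono) auto
    finally have "f F < real (card F) * a" using cE by simp
    then show ?case using cF by (simp add: field_simps)
  qed
qed

lemma union_le_card_mult: "finite D \<Longrightarrow> finite F \<Longrightarrow> f (F \<union> D) \<le> f F + real (card D) * f {0}"
proof (induction D rule: finite_induct)
  case (insert x D)
  have "f ((F \<union> D) \<union> {x}) + f ((F \<union> D) \<inter> {x}) \<le> f (F \<union> D) + f {x}"
    by (rule submodular) (use insert in auto)
  moreover have "f {x} = f {0}" using right_invariant[of x "{0}"] by simp
  moreover have "f ((F \<union> D) \<inter> {x}) \<ge> 0" by (rule nonneg) auto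
  moreover have "(F \<union> D) \<union> {x} = F \<union> insert x D" by auto
  ultimately show ?case using insert by (simp add: algebra_simps)
qed auto

text \<open>
  Dilation by a fixed set adds a small proportion of points to a sufficiently invariant
  \<open>F\<close>, and each of them contributes at most \<open>f {0}\<close>.
\<close>

lemma tendsto_mean_dilate:
  assumes "finite S" "0 \<in> S"
  shows "((\<lambda>F. f (dilate S F) / real (card F)) \<longlongrightarrow> mean) folner_filter"
proof (rule real_tendsto_sandwich)
  have ev: "\<forall>\<^sub>F F :: 'g set in folner_filter. finite F \<and> F \<noteq> {}"
    by (rule eventually_finite_nonempty)
  show "\<forall>\<^sub>F F in folner_filter. f F / real (card F) \<le> f (dilate S F) / real (card F)"
    using ev by eventually_elim (use assms in \<open>auto intro!: divide_right_mono mono subset_dilate\<close>)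
  show "\<forall>\<^sub>F F in folner_filter. f (dilate S F) / real (card F) \<le>
          f F / real (card F) + (real (card (dilate S F)) / real (card F) - 1) * f {0}"
    using ev
  proof eventually_elim
    case (elim F)
    have sub: "F \<subseteq> dilate S F" using assms subset_dilate by auto
    have c: "card F > 0" using elim by (simp add: card_gt_0_iff)
    have "f (F \<union> (dilate S F - F)) \<le> f F + real (card (dilate S F - F)) * f {0}"
      by (rule union_le_card_mult) (use elim assms in auto)
    also have "F \<union> (dilate S F - F) = dilate S F" using sub by auto
    also have "real (card (dilate S F - F)) = real (card (dilate S F)) - real (card F)"
      using sub elim assms by (simp add: card_Diff_subset card_mono of_nat_diff)
    finally have "f (dilate S F) / real (card F) \<le> (f F + (real (card (dilate S F)) - real (card F)) * f {0}) / real (card F)"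
      by (simp add: divide_right_mono)
    then show ?case using c by (simp add: field_simps)
  qed
  have "((\<lambda>F. f F / real (card F) + (real (card (dilate S F)) / real (card F) - 1) * f {0})
          \<longlongrightarrow> mean + (1 - 1) * f {0}) folner_filter"
    by (intro tendsto_intros tendsto_mean tendsto_card_dilate assms)
  then show "((\<lambda>F. f F / real (card F) + (real (card (dilate S F)) / real (card F) - 1) * f {0})
          \<longlongrightarrow> mean) folner_filter" by simp
qed (rule tendsto_mean)

end

section \<open>Finite subspaces of modules over a group ring\<close>

lemma card_eq_card_image_mult:
  assumes "finite A" "\<And>a. a \<in> A \<Longrightarrow> card {b\<in>A. f b = f a} = n"
  shows "card A = card (f ` A) * n"
proof -
  have "card A = (\<Sum>y\<in>f ` A. card {x\<in>A. f x = y})"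
    using sum.image_gen[OF assms(1), of "\<lambda>_. 1::nat" f] by simp
  also have "\<dots> = (\<Sum>y\<in>f ` A. n)" using assms(2) by (intro sum.cong) auto
  finally show ?thesis by simp
qed

lemma ln_of_nat_mono: "m \<le> n \<Longrightarrow> ln (real m) \<le> ln (real n)"
  by (cases "m = 0"; cases "n = 0") auto

lemma card_field_gt_1: "1 < CARD('k::{field,finite})"
proof -
  have "card {0, 1 :: 'k} \<le> CARD('k)" by (intro card_mono) auto
  then show ?thesis by simp
qed

lemma (in abelian_group) additive_subgroup_intro:
  assumes "A \<subseteq> carrier G" "\<zero> \<in> A" "\<And>x y. x \<in> A \<Longrightarrow> y \<in> A \<Longrightarrow> x \<oplus> y \<in> A"
    "\<And>x. x \<in> A \<Longrightarrow> \<ominus> x \<in> A"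
  shows "additive_subgroup A G"
  by (rule additive_subgroupI, rule add.subgroupI) (use assms in \<open>auto simp: a_inv_def\<close>)

text \<open>
  The fibre of addition \<open>A \<times> B \<rightarrow> A + B\<close> through \<open>(a, b)\<close> consists of the pairs
  \<open>(a + c, b - c)\<close> with \<open>c \<in> A \<inter> B\<close>.
\<close>

lemma (in abelian_group) card_set_add:
  assumes "additive_subgroup A G" "additive_subgroup B G" "finite A" "finite B"
  shows "card (A <+>\<^bsub>G\<^esub> B) * card (A \<inter> B) = card A * card B"
proof -
  interpret A: additive_subgroup A G by fact
  interpret B: additive_subgroup B G by fact
  define f where "f = (\<lambda>(a, b). a \<oplus> b)"
  note sub = A.a_subset[THEN subsetD] B.a_subset[THEN subsetD]
  have img: "f ` (A \<times> B) = A <+>\<^bsub>G\<^esub> B" by (force simp: f_def set_add_def')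
  have "card {q \<in> A \<times> B. f q = f p} = card (A \<inter> B)" if p: "p \<in> A \<times> B" for p
  proof -
    obtain a b where ab: "p = (a, b)" "a \<in> A" "b \<in> B" using p by auto
    have "bij_betw (\<lambda>c. (a \<oplus> c, b \<ominus> c)) (A \<inter> B) {q \<in> A \<times> B. f q = f p}"
    proof (rule bij_betwI[where g = "\<lambda>(a', b'). a' \<ominus> a"])
      show "(\<lambda>c. (a \<oplus> c, b \<ominus> c)) \<in> A \<inter> B \<rightarrow> {q \<in> A \<times> B. f q = f p}"
      proof
        fix c assume c: "c \<in> A \<inter> B"
        have "a \<oplus> c \<oplus> (b \<ominus> c) = a \<oplus> b"
          using ab c by (simp add: sub a_minus_def a_ac r_neg r_neg2 r_neg1)
        then show "(a \<oplus> c, b \<ominus> c) \<in> {q \<in> A \<times> B. f q = f p}"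
          using ab c by (auto simp: f_def a_minus_def)
      qed
      show "(\<lambda>(a', b'). a' \<ominus> a) \<in> {q \<in> A \<times> B. f q = f p} \<rightarrow> A \<inter> B"
      proof
        fix q assume "q \<in> {q \<in> A \<times> B. f q = f p}"
        then obtain a' b' where q: "q = (a', b')" "a' \<in> A" "b' \<in> B" "a' \<oplus> b' = a \<oplus> b"
          using ab by (auto simp: f_def)
        have "a' \<ominus> a = (a' \<ominus> a) \<oplus> (b' \<oplus> \<ominus> b')"
          using ab q(2,3) by (simp add: sub r_neg a_minus_def)
        also have "\<dots> = (a' \<oplus> b') \<ominus> a \<ominus> b'"
          using ab q(2,3) by (simp add: sub a_minus_def a_ac)
        also have "\<dots> = (b \<ominus> b') \<oplus> (a \<oplus> \<ominus> a)"
          unfolding q(4) using ab q(2,3) by (simp add: sub a_minus_def a_ac)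
        also have "\<dots> = b \<ominus> b'"
          using ab q(2,3) by (simp add: sub r_neg a_minus_def)
        finally show "(case q of (a', b') \<Rightarrow> a' \<ominus> a) \<in> A \<inter> B"
          using q(1,2,3) ab by (simp add: a_minus_def) (metis A.a_closed A.a_inv_closed B.a_closed B.a_inv_closed)
      qed
      show "(case (a \<oplus> c, b \<ominus> c) of (a', b') \<Rightarrow> a' \<ominus> a) = c" if "c \<in> A \<inter> B" for c
      proof -
        have "a \<oplus> c \<ominus> a = c \<oplus> (a \<oplus> \<ominus> a)"
          using ab that by (simp add: sub a_minus_def a_ac)
        also have "\<dots> = c" using ab that by (simp add: sub r_neg)
        finally show ?thesis by simp
      qed
      show "(a \<oplus> (case q of (a', b') \<Rightarrow> a' \<ominus> a), b \<ominus> (case q of (a', b') \<Rightarrow> a' \<ominus> a)) = q"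
        if q_in: "q \<in> {q \<in> A \<times> B. f q = f p}" for q
      proof -
        obtain a' b' where q: "q = (a', b')" "a' \<in> A" "b' \<in> B" "a' \<oplus> b' = a \<oplus> b"
          using ab q_in by (auto simp: f_def)
        have 1: "a \<oplus> (a' \<ominus> a) = a'"
          using ab q(2,3) by (simp add: sub a_minus_def a_ac r_neg r_neg2 r_neg1)
        have "b \<ominus> (a' \<ominus> a) = (a \<oplus> b) \<ominus> a'"
          using ab q(2,3) by (simp add: sub a_minus_def minus_add a_ac)
        also have "\<dots> = b' \<oplus> (a' \<oplus> \<ominus> a')"
          unfolding q(4)[symmetric] using ab q(2,3) by (simp add: sub a_minus_def a_ac)
        also have "\<dots> = b'"
          using q(2,3) by (simp add: sub r_neg)
        finally show ?thesis using 1 q by simp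
      qed
    qed
    then show ?thesis using bij_betw_same_card by fastforce
  qed
  from card_eq_card_image_mult[OF _ this] show ?thesis
    using assms by (simp add: img card_cartesian_product)
qed

definition supported :: "'g set \<Rightarrow> ('g \<Rightarrow>\<^sub>0 'k::zero) set" where
  "supported T = {a. Poly_Mapping.keys a \<subseteq> T}"

lemma supported_eq: "a \<in> supported T \<longleftrightarrow> (\<forall>g. g \<notin> T \<longrightarrow> Poly_Mapping.lookup a g = 0)"
  by (auto simp: supported_def in_keys_iff subset_iff)

lemma bij_betw_supported:
  assumes "finite T"
  shows "bij_betw (\<lambda>a. restrict (Poly_Mapping.lookup a) T) (supported T) (T \<rightarrow>\<^sub>E (UNIV :: 'k::zero set))"
proof (rule bij_betwI[where g = "\<lambda>f. Abs_poly_mapping (\<lambda>g. if g \<in> T then f g else 0)"])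
  have *: "Poly_Mapping.lookup (Abs_poly_mapping (\<lambda>g. if g \<in> T then f g else 0)) = (\<lambda>g. if g \<in> T then f g else 0)"
    for f :: "_ \<Rightarrow> 'k"
    by (subst lookup_Abs_poly_mapping) (auto intro: finite_subset[OF _ assms])
  show "(\<lambda>f. Abs_poly_mapping (\<lambda>g. if g \<in> T then f g else 0)) \<in> (T \<rightarrow>\<^sub>E (UNIV :: 'k set)) \<rightarrow> supported T"
    by (auto simp: supported_eq *)
  show "Abs_poly_mapping (\<lambda>g. if g \<in> T then restrict (Poly_Mapping.lookup a) T g else 0) = a"
    if "a \<in> supported T" for a :: "_ \<Rightarrow>\<^sub>0 'k"
    using that by (intro poly_mapping_eqI) (auto simp: * supported_eq)
  show "restrict (Poly_Mapping.lookup (Abs_poly_mapping (\<lambda>g. if g \<in> T then f g else 0))) T = f"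
    if "f \<in> T \<rightarrow>\<^sub>E (UNIV :: 'k set)" for f
    using that by (auto simp: * fun_eq_iff PiE_def extensional_def)
qed auto

lemma finite_supported [simp]: "finite T \<Longrightarrow> finite (supported T :: ('g \<Rightarrow>\<^sub>0 'k::{zero,finite}) set)"
  using bij_betw_finite[OF bij_betw_supported] by (metis finite finite_PiE)

lemma card_supported:
  assumes "finite T"
  shows "card (supported T :: ('g \<Rightarrow>\<^sub>0 'k::{zero,finite}) set) = CARD('k) ^ card T"
proof -
  have "card (supported T :: ('g \<Rightarrow>\<^sub>0 'k) set) = card (T \<rightarrow>\<^sub>E (UNIV :: 'k set))"
    by (rule bij_betw_same_card[OF bij_betw_supported[OF assms]])
  then show ?thesis using assms by (simp add: card_PiE)
qed

lemma supported_zero [simp]: "0 \<in> supported T" by (simp add: supported_def)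

lemma supported_add: "a \<in> supported T \<Longrightarrow> b \<in> supported T \<Longrightarrow> a + b \<in> supported T"
  for a b :: "'g \<Rightarrow>\<^sub>0 'k::monoid_add"
  by (auto simp: supported_eq lookup_add)

lemma supported_diff: "a \<in> supported T \<Longrightarrow> b \<in> supported T \<Longrightarrow> a - b \<in> supported T"
  for a b :: "'g \<Rightarrow>\<^sub>0 'k::ab_group_add"
  by (auto simp: supported_eq lookup_minus)

lemma supported_single: "t \<in> T \<Longrightarrow> Poly_Mapping.single t c \<in> supported T"
  by (auto simp: supported_def)

lemma supported_induct [consumes 1, case_names zero single]:
  fixes a :: "'g \<Rightarrow>\<^sub>0 'k::ab_group_add"
  assumes "a \<in> supported T" "P 0"
    and "\<And>t c b. t \<in> T \<Longrightarrow> b \<in> supported T \<Longrightarrow> P b \<Longrightarrow> P (Poly_Mapping.single t c + b)"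
  shows "P a"
  using finite_keys[of a] assms(1)
proof (induction "Poly_Mapping.keys a" arbitrary: a rule: finite_induct)
  case empty
  then have "a = 0" by (simp add: poly_mapping_eq_iff fun_eq_iff in_keys_iff set_eq_iff)
  then show ?case using assms by simp
next
  case (insert t K)
  define b where "b = a - Poly_Mapping.single t (Poly_Mapping.lookup a t)"
  have lb: "Poly_Mapping.lookup b g = (if g = t then 0 else Poly_Mapping.lookup a g)" for g
    by (auto simp: b_def lookup_minus lookup_single)
  have "K = Poly_Mapping.keys b"
    using insert.hyps by (auto simp: set_eq_iff in_keys_iff lb)
  moreover have bs: "b \<in> supported T" using insert.prems by (auto simp: supported_eq lb)
  ultimately have "P b" by (rule insert.hyps(3))
  moreover have "t \<in> T" using insert.hyps insert.prems by (auto simp: supported_def)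
  ultimately have "P (Poly_Mapping.single t (Poly_Mapping.lookup a t) + b)"
    using bs assms(3) by blast
  then show ?case by (simp add: b_def)
qed

text \<open>
  The \<open>k\<close>-linear span of the translates of \<open>E\<close> by \<open>T\<close>. The scalars are part of the
  generators, so that closure under addition of one generator at a time suffices.
\<close>

inductive_set orbit_span ::
    "('g::group_add \<Rightarrow>\<^sub>0 'k::ring_1, 'm) module \<Rightarrow> 'g set \<Rightarrow> 'm set \<Rightarrow> 'm set"
  for M T E where
    zero: "\<zero>\<^bsub>M\<^esub> \<in> orbit_span M T E"
  | step: "y \<in> orbit_span M T E \<Longrightarrow> t \<in> T \<Longrightarrow> x \<in> E \<Longrightarrow>
      Poly_Mapping.single t c \<odot>\<^bsub>M\<^esub> x \<oplus>\<^bsub>M\<^esub> y \<in> orbit_span M T E"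

lemma orbit_span_mono: "T \<subseteq> T' \<Longrightarrow> E \<subseteq> E' \<Longrightarrow> orbit_span M T E \<subseteq> orbit_span M T' E'"
proof
  fix y assume "y \<in> orbit_span M T E" "T \<subseteq> T'" "E \<subseteq> E'"
  then show "y \<in> orbit_span M T' E'"
    by induction (auto intro: orbit_span.intros)
qed

definition unit_root :: "nat \<Rightarrow> complex" where
  "unit_root n = cis (2 * pi / real n)"

locale group_ring_module = left_module M
  for M :: "('g::group_add \<Rightarrow>\<^sub>0 'k::{field,finite}, 'm) module" (structure)
begin

lemma smult_zero_left: "x \<in> carrier M \<Longrightarrow> 0 \<odot> x = \<zero>"
  using smult_l_distr[of x 0 0] smult_closed[of x 0] by (simp add: add.l_cancel_one')

lemma smult_zero_right: "a \<odot> \<zero> = \<zero>"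
  using smult_r_distr[of \<zero> \<zero> a] smult_closed[of \<zero> a] by (simp add: add.l_cancel_one')

lemma smult_minus_left: "x \<in> carrier M \<Longrightarrow> (- a) \<odot> x = \<ominus> (a \<odot> x)"
  using smult_l_distr[of x "- a" a] smult_closed[of x] by (simp add: smult_zero_left minus_equality)

lemma smult_diff_left: "x \<in> carrier M \<Longrightarrow> (a - b) \<odot> x = a \<odot> x \<ominus> b \<odot> x"
  using smult_l_distr[of x a "- b"] by (simp add: smult_minus_left a_minus_def)

lemma orbit_span_closed:
  assumes "E \<subseteq> carrier M"
  shows "orbit_span M T E \<subseteq> carrier M"
proof
  fix y assume "y \<in> orbit_span M T E"
  then show "y \<in> carrier M"
    by induction (use assms in \<open>auto intro!: smult_closed\<close>)
qed

lemma orbit_span_add: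
  assumes "E \<subseteq> carrier M" "y \<in> orbit_span M T E" "z \<in> orbit_span M T E"
  shows "y \<oplus> z \<in> orbit_span M T E"
  using assms(2)
proof induction
  case zero
  then show ?case using assms orbit_span_closed[of E T] by auto
next
  case (step y t x c)
  have "x \<in> carrier M" "y \<in> carrier M" "z \<in> carrier M"
    using step assms orbit_span_closed[of E T] by auto
  then have "Poly_Mapping.single t c \<odot> x \<oplus> y \<oplus> z = Poly_Mapping.single t c \<odot> x \<oplus> (y \<oplus> z)"
    by (simp add: a_assoc smult_closed)
  then show ?case using step by (auto intro: orbit_span.step)
qed

lemma orbit_span_minus:
  assumes "E \<subseteq> carrier M" "y \<in> orbit_span M T E"
  shows "\<ominus> y \<in> orbit_span M T E"
  using assms(2)
proof induction
  case zero
  have "\<ominus> \<zero> = \<zero>" by (simp add: a_inv_def)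
  then show ?case by (metis orbit_span.zero)
next
  case (step y t x c)
  have "x \<in> carrier M" "y \<in> carrier M"
    using step assms orbit_span_closed[of E T] by auto
  then have "\<ominus> (Poly_Mapping.single t c \<odot> x \<oplus> y) = Poly_Mapping.single t (- c) \<odot> x \<oplus> \<ominus> y"
    by (simp add: minus_add smult_closed single_uminus smult_minus_left)
  then show ?case using step by (auto intro: orbit_span.step)
qed

lemma additive_subgroup_orbit_span:
  "E \<subseteq> carrier M \<Longrightarrow> additive_subgroup (orbit_span M T E) M"
  by (intro additive_subgroup_intro orbit_span_closed orbit_span.zero orbit_span_add orbit_span_minus)

lemma orbit_span_single:
  assumes "E \<subseteq> carrier M" "t \<in> T" "x \<in> E"
  shows "Poly_Mapping.single t c \<odot> x \<in> orbit_span M T E"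
  using orbit_span.step[OF orbit_span.zero assms(2,3), of M c] assms by (auto simp: smult_closed)

lemma orbit_span_minimal:
  assumes "additive_subgroup A M" and "\<And>t x c. t \<in> T \<Longrightarrow> x \<in> E \<Longrightarrow> Poly_Mapping.single t c \<odot> x \<in> A"
  shows "orbit_span M T E \<subseteq> A"
proof
  interpret additive_subgroup A M by fact
  fix y assume "y \<in> orbit_span M T E"
  then show "y \<in> A" by induction (use assms(2) in auto)
qed

lemma set_add_upper:
  assumes "additive_subgroup A M" "additive_subgroup B M"
  shows "A \<subseteq> A <+>\<^bsub>M\<^esub> B" "B \<subseteq> A <+>\<^bsub>M\<^esub> B"
proof -
  interpret A: additive_subgroup A M by fact
  interpret B: additive_subgroup B M by fact
  show "A \<subseteq> A <+>\<^bsub>M\<^esub> B"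
  proof
    fix a assume "a \<in> A"
    then have "a = a \<oplus> \<zero>" using A.a_subset by auto
    then show "a \<in> A <+>\<^bsub>M\<^esub> B" using \<open>a \<in> A\<close> B.zero_closed unfolding set_add_def' by blast
  qed
  show "B \<subseteq> A <+>\<^bsub>M\<^esub> B"
  proof
    fix a assume "a \<in> B"
    then have "a = \<zero> \<oplus> a" using B.a_subset by auto
    then show "a \<in> A <+>\<^bsub>M\<^esub> B" using \<open>a \<in> B\<close> A.zero_closed unfolding set_add_def' by blast
  qed
qed

lemma set_add_minimal:
  assumes "additive_subgroup C M" "A \<subseteq> C" "B \<subseteq> C"
  shows "A <+>\<^bsub>M\<^esub> B \<subseteq> C"
proof -
  interpret C: additive_subgroup C M by fact
  show ?thesis using assms(2,3) by (auto simp: set_add_def')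
qed

lemma orbit_span_Un_left:
  assumes "E \<subseteq> carrier M"
  shows "orbit_span M (S \<union> T) E = orbit_span M S E <+>\<^bsub>M\<^esub> orbit_span M T E"
proof
  note sub = additive_subgroup_orbit_span[OF assms]
  show "orbit_span M (S \<union> T) E \<subseteq> orbit_span M S E <+>\<^bsub>M\<^esub> orbit_span M T E"
    by (rule orbit_span_minimal)
      (use assms set_add_upper[OF sub sub] orbit_span_single in \<open>blast intro: add_additive_subgroups sub\<close>)+
  show "orbit_span M S E <+>\<^bsub>M\<^esub> orbit_span M T E \<subseteq> orbit_span M (S \<union> T) E"
    by (intro set_add_minimal sub orbit_span_mono) auto
qed

lemma orbit_span_Un_right:
  assumes "E \<subseteq> carrier M" "E' \<subseteq> carrier M"
  shows "orbit_span M T (E \<union> E') = orbit_span M T E <+>\<^bsub>M\<^esub> orbit_span M T E'"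
proof
  note sub = additive_subgroup_orbit_span[OF assms(1)] additive_subgroup_orbit_span[OF assms(2)]
  have E: "E \<union> E' \<subseteq> carrier M" using assms by auto
  show "orbit_span M T (E \<union> E') \<subseteq> orbit_span M T E <+>\<^bsub>M\<^esub> orbit_span M T E'"
    by (rule orbit_span_minimal)
      (use assms set_add_upper[OF sub] orbit_span_single in \<open>blast intro: add_additive_subgroups sub\<close>)+
  show "orbit_span M T E <+>\<^bsub>M\<^esub> orbit_span M T E' \<subseteq> orbit_span M T (E \<union> E')"
    by (intro set_add_minimal additive_subgroup_orbit_span E orbit_span_mono) auto
qed

lemma orbit_span_singleton:
  assumes "x \<in> carrier M"
  shows "orbit_span M T {x} = (\<lambda>a. a \<odot> x) ` supported T"
proof
  show "orbit_span M T {x} \<subseteq> (\<lambda>a. a \<odot> x) ` supported T"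
  proof
    fix y assume "y \<in> orbit_span M T {x}"
    then show "y \<in> (\<lambda>a. a \<odot> x) ` supported T"
    proof induction
      case zero
      then show ?case by (intro image_eqI[of _ _ 0]) (simp_all add: smult_zero_left assms)
    next
      case (step y t x' c)
      then obtain a where "a \<in> supported T" "y = a \<odot> x" by auto
      then show ?case using step
        by (intro image_eqI[of _ _ "Poly_Mapping.single t c + a"])
          (auto simp: smult_l_distr assms intro: supported_add supported_single)
    qed
  qed
  show "(\<lambda>a. a \<odot> x) ` supported T \<subseteq> orbit_span M T {x}"
  proof clarify
    fix a :: "'g \<Rightarrow>\<^sub>0 'k" assume "a \<in> supported T"
    then show "a \<odot> x \<in> orbit_span M T {x}"
      by (induction rule: supported_induct)
        (auto simp: smult_zero_left smult_l_distr assms intro: orbit_span.intros)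
  qed
qed

lemma finite_set_add: "finite A \<Longrightarrow> finite B \<Longrightarrow> finite (A <+>\<^bsub>M\<^esub> B)"
  by (simp add: set_add_def')

lemma orbit_span_empty [simp]: "orbit_span M T {} = {\<zero>}" "orbit_span M {} E = {\<zero>}"
  by (auto elim: orbit_span.cases intro: orbit_span.zero)

lemma finite_orbit_span:
  assumes "finite T" "finite E" "E \<subseteq> carrier M"
  shows "finite (orbit_span M T E)"
  using assms(2,3)
proof (induction E rule: finite_induct)
  case (insert x E)
  then have "orbit_span M T ({x} \<union> E) = orbit_span M T {x} <+>\<^bsub>M\<^esub> orbit_span M T E"
    by (intro orbit_span_Un_right) auto
  then show ?case using insert assms by (simp add: finite_set_add orbit_span_singleton)
qed simp

lemma smult_orbit_span:
  assumes "E \<subseteq> carrier M" "y \<in> orbit_span M S E"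
  shows "Poly_Mapping.single t c \<odot> y \<in> orbit_span M ((+) t ` S) E"
  using assms(2)
proof induction
  case zero
  then show ?case by (simp add: smult_zero_right orbit_span.zero)
next
  case (step y s x d)
  then have "x \<in> carrier M" "y \<in> carrier M" using assms orbit_span_closed[of E S] by auto
  then have "Poly_Mapping.single t c \<odot> (Poly_Mapping.single s d \<odot> x \<oplus> y) =
      Poly_Mapping.single (t + s) (c * d) \<odot> x \<oplus> Poly_Mapping.single t c \<odot> y"
    by (simp add: smult_r_distr smult_closed smult_assoc[symmetric] mult_single)
  then show ?case using step by (auto intro: orbit_span.step)
qed

lemma orbit_span_dilate:
  assumes "E \<subseteq> carrier M" "E' \<subseteq> orbit_span M S E"
  shows "orbit_span M T E' \<subseteq> orbit_span M (dilate T S) E"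
proof (rule orbit_span_minimal[OF additive_subgroup_orbit_span[OF assms(1)]])
  fix t x c assume "t \<in> T" "x \<in> E'"
  then have "Poly_Mapping.single t c \<odot> x \<in> orbit_span M ((+) t ` S) E"
    using assms smult_orbit_span by blast
  also have "\<dots> \<subseteq> orbit_span M (dilate T S) E"
    using \<open>t \<in> T\<close> by (intro orbit_span_mono) (auto simp: dilate_def)
  finally show "Poly_Mapping.single t c \<odot> x \<in> orbit_span M (dilate T S) E" .
qed

lemma single_smult_inverse:
  "x \<in> carrier M \<Longrightarrow> Poly_Mapping.single (- g) 1 \<odot> (Poly_Mapping.single g 1 \<odot> x) = x"
  by (simp add: smult_assoc[symmetric] mult_single smult_one)

lemma inj_on_single_smult: "inj_on ((\<odot>) (Poly_Mapping.single g 1)) (carrier M)"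
  by (rule inj_on_inverseI[of _ "(\<odot>) (Poly_Mapping.single (- g) 1)"]) (rule single_smult_inverse)

lemma card_orbit_span_translate:
  assumes "E \<subseteq> carrier M"
  shows "card (orbit_span M ((+) g ` T) E) = card (orbit_span M T E)"
proof -
  have sub: "(\<odot>) (Poly_Mapping.single h 1) ` orbit_span M S E \<subseteq> orbit_span M ((+) h ` S) E" for h S
    using smult_orbit_span[OF assms] by auto
  have "orbit_span M ((+) g ` T) E \<subseteq> (\<odot>) (Poly_Mapping.single g 1) ` orbit_span M T E"
  proof
    fix y assume y: "y \<in> orbit_span M ((+) g ` T) E"
    have "Poly_Mapping.single (- g) 1 \<odot> y \<in> orbit_span M ((+) (- g) ` (+) g ` T) E"
      using smult_orbit_span[OF assms y] .
    moreover have "(+) (- g) ` (+) g ` T = T" by (simp add: image_image add.assoc[symmetric])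
    moreover have "y \<in> carrier M" using y orbit_span_closed[OF assms] by auto
    ultimately show "y \<in> (\<odot>) (Poly_Mapping.single g 1) ` orbit_span M T E"
      using single_smult_inverse[of y "- g"] by (intro image_eqI) auto
  qed
  then have "orbit_span M ((+) g ` T) E = (\<odot>) (Poly_Mapping.single g 1) ` orbit_span M T E"
    using sub by blast
  moreover have "inj_on ((\<odot>) (Poly_Mapping.single g 1)) (orbit_span M T E)"
    using inj_on_single_smult orbit_span_closed[OF assms] by (rule inj_on_subset)
  ultimately show ?thesis by (simp add: card_image)
qed

text \<open>
  The first isomorphism theorem for \<open>a \<mapsto> a \<odot> x\<close>, in terms of cardinalities.
\<close>

lemma card_eq_card_smult_image_mult:
  assumes "x \<in> carrier M" "finite D"
    and add: "\<And>a b. a \<in> D \<Longrightarrow> b \<in> D \<Longrightarrow> a + b \<in> D"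
    and diff: "\<And>a b. a \<in> D \<Longrightarrow> b \<in> D \<Longrightarrow> a - b \<in> D"
  shows "card D = card ((\<lambda>a. a \<odot> x) ` D) * card {a\<in>D. a \<odot> x = \<zero>}"
proof (rule card_eq_card_image_mult[OF assms(2)])
  fix a assume a: "a \<in> D"
  have eq: "b \<odot> x = a \<odot> x \<longleftrightarrow> (b - a) \<odot> x = \<zero>" for b
    using assms(1) smult_closed[of x a] smult_closed[of x b]
    by (metis smult_diff_left a_minus_def add.inv_solve_right' add.inv_closed r_neg l_zero minus_equality minus_minus)
  have "bij_betw (\<lambda>b. b - a) {b\<in>D. b \<odot> x = a \<odot> x} {c\<in>D. c \<odot> x = \<zero>}"
    by (rule bij_betwI[where g = "\<lambda>c. c + a"]) (auto simp: eq add diff a)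
  then show "card {b\<in>D. b \<odot> x = a \<odot> x} = card {c\<in>D. c \<odot> x = \<zero>}"
    by (rule bij_betw_same_card)
qed

text \<open>
  The inverses of \<open>F\<close> occur because \<open>s\<close> acts on characters through the action of \<open>- s\<close>
  on the module. They turn right translation of \<open>F\<close> into left translation of the span.
\<close>

definition log_growth :: "'m set \<Rightarrow> 'g set \<Rightarrow> real" where
  "log_growth E F = ln (real (card (orbit_span M (uminus ` F) E)))"

lemma card_orbit_span_pos:
  assumes "finite T" "finite E" "E \<subseteq> carrier M"
  shows "card (orbit_span M T E) > 0"
  using finite_orbit_span[OF assms] orbit_span.zero[of M T E] by (auto simp: card_gt_0_iff)

text \<open>
  Submodularity is the logarithm of \<open>card (A + B) * card (A \<inter> B) = card A * card B\<close> for two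
  spans, as the span over an intersection lies in the intersection of the spans.
\<close>

lemma submodular_invariant_log_growth:
  assumes E: "finite E" "E \<subseteq> carrier M"
  shows "submodular_invariant (log_growth E)"
proof
  show "log_growth E {} = 0" by (simp add: log_growth_def)
next
  fix A B :: "'g set" assume "finite B" "A \<subseteq> B"
  then have "finite A" by (rule rev_finite_subset)
  have "card (orbit_span M (uminus ` A) E) \<le> card (orbit_span M (uminus ` B) E)"
    using \<open>finite B\<close> \<open>A \<subseteq> B\<close> E by (intro card_mono finite_orbit_span orbit_span_mono) auto
  moreover have "card (orbit_span M (uminus ` A) E) > 0"
    using \<open>finite A\<close> E by (intro card_orbit_span_pos) auto
  ultimately show "log_growth E A \<le> log_growth E B" by (simp add: log_growth_def)
next
  fix A B :: "'g set" assume AB: "finite A" "finite B"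
  let ?S = "\<lambda>A. orbit_span M (uminus ` A) E"
  have fin: "finite (?S A)" "finite (?S B)" using AB E by (auto intro!: finite_orbit_span)
  have "?S (A \<inter> B) \<subseteq> ?S A \<inter> ?S B"
    using orbit_span_mono[of "uminus ` (A \<inter> B)" _ E E M] by blast
  then have "card (?S (A \<union> B)) * card (?S (A \<inter> B)) \<le> card (?S (A \<union> B)) * card (?S A \<inter> ?S B)"
    using fin by (intro mult_left_mono card_mono) auto
  also have "?S (A \<union> B) = ?S A <+>\<^bsub>M\<^esub> ?S B"
    by (simp add: image_Un orbit_span_Un_left E)
  also have "card \<dots> * card (?S A \<inter> ?S B) = card (?S A) * card (?S B)"
    by (intro card_set_add additive_subgroup_orbit_span E fin)
  finally have le: "card (?S (A \<union> B)) * card (?S (A \<inter> B)) \<le> card (?S A) * card (?S B)"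
    by (simp add: image_Un orbit_span_Un_left E)
  have pos: "card (?S A) > 0" "card (?S B) > 0" "card (?S (A \<union> B)) > 0" "card (?S (A \<inter> B)) > 0"
    using AB E by (auto intro!: card_orbit_span_pos)
  have "ln (real (card (?S (A \<union> B)) * card (?S (A \<inter> B)))) \<le> ln (real (card (?S A) * card (?S B)))"
    using le pos by (subst ln_le_cancel_iff) (auto simp del: of_nat_mult)
  then show "log_growth E (A \<union> B) + log_growth E (A \<inter> B) \<le> log_growth E A + log_growth E B"
    using pos by (simp add: log_growth_def ln_mult)
next
  fix g and F :: "'g set"
  have "uminus ` (\<lambda>x. x + g) ` F = (+) (- g) ` uminus ` F"
    by (simp add: image_image group_add_class.minus_add)
  then show "log_growth E ((\<lambda>x. x + g) ` F) = log_growth E F"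
    using card_orbit_span_translate[OF E(2)] by (simp add: log_growth_def)
qed

definition growth_rate :: "'m set \<Rightarrow> real" where
  "growth_rate E = submodular_invariant.mean (log_growth E)"

section \<open>Characters of a module\<close>

definition characters :: "('m \<Rightarrow> complex) set" where
  "characters = topspace (pontryagin_dual M)"

lemma characters_iff:
  "u \<in> characters \<longleftrightarrow> u \<in> carrier M \<rightarrow>\<^sub>E sphere 0 1 \<and> (\<forall>x\<in>carrier M. \<forall>y\<in>carrier M. u (x \<oplus> y) = u x * u y)"
  by (auto simp: characters_def pontryagin_dual_def)

lemma norm_character: "u \<in> characters \<Longrightarrow> x \<in> carrier M \<Longrightarrow> norm (u x) = 1"
  by (auto simp: characters_iff PiE_iff)

lemma character_add: "u \<in> characters \<Longrightarrow> x \<in> carrier M \<Longrightarrow> y \<in> carrier M \<Longrightarrow> u (x \<oplus> y) = u x * u y"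
  by (simp add: characters_iff)

lemma character_zero: "u \<in> characters \<Longrightarrow> u \<zero> = 1"
  using character_add[of u \<zero> \<zero>] norm_character[of u \<zero>] by auto

definition multiple :: "nat \<Rightarrow> 'm \<Rightarrow> 'm" where
  "multiple n x = (of_nat n :: 'g \<Rightarrow>\<^sub>0 'k) \<odot> x"

lemma multiple_closed [simp]: "x \<in> carrier M \<Longrightarrow> multiple n x \<in> carrier M"
  by (simp add: multiple_def smult_closed)

lemma multiple_0 [simp]: "x \<in> carrier M \<Longrightarrow> multiple 0 x = \<zero>"
  by (simp add: multiple_def smult_zero_left)

lemma multiple_1 [simp]: "x \<in> carrier M \<Longrightarrow> multiple (Suc 0) x = x"
  by (simp add: multiple_def smult_one)

lemma multiple_add: "x \<in> carrier M \<Longrightarrow> multiple (m + n) x = multiple m x \<oplus> multiple n x"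
  by (simp add: multiple_def smult_l_distr)

lemma multiple_Suc: "x \<in> carrier M \<Longrightarrow> multiple (Suc n) x = x \<oplus> multiple n x"
  using multiple_add[of x "Suc 0" n] by simp

lemma multiple_mult: "x \<in> carrier M \<Longrightarrow> multiple (m * n) x = multiple m (multiple n x)"
  by (simp add: multiple_def smult_assoc)

lemma character_multiple: "u \<in> characters \<Longrightarrow> x \<in> carrier M \<Longrightarrow> u (multiple n x) = u x ^ n"
  by (induction n) (simp_all add: character_zero multiple_Suc character_add)

lemma prime_characteristic: "prime CHAR('k)"
  by (intro prime_CHAR_semidom finite_imp_CHAR_pos) simp

lemma multiple_mod: "x \<in> carrier M \<Longrightarrow> multiple (n mod CHAR('k)) x = multiple n x"
proof -
  have "(of_nat CHAR('k) :: 'g \<Rightarrow>\<^sub>0 'k) = Poly_Mapping.single 0 (of_nat CHAR('k))"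
    by (simp only: single_of_nat)
  then have "(of_nat CHAR('k) :: 'g \<Rightarrow>\<^sub>0 'k) = 0" by simp
  then have "(of_nat (CHAR('k) * (n div CHAR('k)) + n mod CHAR('k)) :: 'g \<Rightarrow>\<^sub>0 'k) = of_nat (n mod CHAR('k))"
    by (simp only: of_nat_add of_nat_mult mult_zero_left add_0)
  then have "(of_nat (n mod CHAR('k)) :: 'g \<Rightarrow>\<^sub>0 'k) = of_nat n"
    by (simp only: mult_div_mod_eq)
  then show "x \<in> carrier M \<Longrightarrow> multiple (n mod CHAR('k)) x = multiple n x" by (simp add: multiple_def)
qed

lemma multiple_cong: "x \<in> carrier M \<Longrightarrow> [m = n] (mod CHAR('k)) \<Longrightarrow> multiple m x = multiple n x"
  by (metis cong_def multiple_mod)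

lemma multiple_neg: "x \<in> carrier M \<Longrightarrow> \<ominus> multiple n x = multiple ((CHAR('k) - 1) * n) x"
proof -
  assume x: "x \<in> carrier M"
  have "multiple ((CHAR('k) - 1) * n) x \<oplus> multiple n x = multiple (CHAR('k) * n) x"
    using x prime_gt_0_nat[OF prime_characteristic] by (simp only: multiple_add[symmetric]) (metis Suc_diff_1 add.commute mult_Suc)
  also have "\<dots> = \<zero>" using x multiple_mod[of x "CHAR('k) * n"] by simp
  finally show ?thesis using x by (simp add: minus_equality)
qed

lemma multiple_in_subgroup:
  assumes "additive_subgroup C M" "x \<in> C"
  shows "multiple n x \<in> C"
proof -
  interpret additive_subgroup C M by fact
  show ?thesis
    using assms(2) a_subset by (induction n) (auto simp: multiple_Suc)
qed

text \<open>
  The factor \<open>n\<close> is invertible modulo the characteristic, which annihilates the module.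
\<close>

lemma in_subgroup_if_multiple:
  assumes "additive_subgroup C M" "x \<in> carrier M" "multiple n x \<in> C" "\<not> CHAR('k) dvd n"
  shows "x \<in> C"
proof -
  have "coprime n CHAR('k)" using assms(4) prime_characteristic by (metis coprime_commute prime_imp_coprime)
  then obtain m where "[n * m = Suc 0] (mod CHAR('k))" using cong_solve_coprime_nat by blast
  then have "multiple (m * n) x = multiple (Suc 0) x" using assms by (intro multiple_cong) (auto simp: mult.commute)
  then have "x = multiple m (multiple n x)" using assms by (simp add: multiple_mult smult_one)
  then show ?thesis using multiple_in_subgroup[OF assms(1,3)] by metis
qed

text \<open>
  This is the subgroup generated by \<open>C\<close> and \<open>x\<close>: since the characteristic annihilates
  \<open>x\<close>, the natural multiples of \<open>x\<close> include the negative ones.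
\<close>

definition adjoin :: "'m set \<Rightarrow> 'm \<Rightarrow> 'm set" where
  "adjoin C x = {c \<oplus> multiple n x | c n. c \<in> C}"

lemma adjoinI: "c \<in> C \<Longrightarrow> c \<oplus> multiple n x \<in> adjoin C x"
  by (auto simp: adjoin_def)

lemma adjoin_add:
  assumes "C \<subseteq> carrier M" "x \<in> carrier M" "c \<in> C" "c' \<in> C"
  shows "(c \<oplus> multiple n x) \<oplus> (c' \<oplus> multiple n' x) = (c \<oplus> c') \<oplus> multiple (n + n') x"
  using assms by (auto simp: multiple_add subset_iff a_ac)

lemma additive_subgroup_adjoin:
  assumes "additive_subgroup C M" "x \<in> carrier M"
  shows "additive_subgroup (adjoin C x) M" "C \<subseteq> adjoin C x" "x \<in> adjoin C x"
proof -
  interpret C: additive_subgroup C M by fact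
  note sub = C.a_subset
  have sub': "c \<in> C \<Longrightarrow> c \<in> carrier M" for c using sub by auto
  show "C \<subseteq> adjoin C x"
  proof
    fix c assume "c \<in> C"
    then show "c \<in> adjoin C x" using adjoinI[of c C 0 x] assms sub'[of c] by simp
  qed
  show "x \<in> adjoin C x"
    using adjoinI[of \<zero> C 1 x] assms C.zero_closed by (simp add: smult_one)
  show "additive_subgroup (adjoin C x) M"
  proof (rule additive_subgroup_intro)
    show "adjoin C x \<subseteq> carrier M" using assms sub' by (auto simp: adjoin_def)
    show "\<zero> \<in> adjoin C x" using \<open>C \<subseteq> adjoin C x\<close> C.zero_closed by auto
    fix y assume "y \<in> adjoin C x"
    then obtain c n where y: "y = c \<oplus> multiple n x" "c \<in> C" by (auto simp: adjoin_def)
    then have "\<ominus> y = \<ominus> c \<oplus> multiple ((CHAR('k) - 1) * n) x"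
      using assms sub' by (simp add: minus_add multiple_neg)
    then show "\<ominus> y \<in> adjoin C x" using y by (metis C.a_inv_closed adjoinI)
    fix z assume "z \<in> adjoin C x"
    then obtain c' n' where z: "z = c' \<oplus> multiple n' x" "c' \<in> C" by (auto simp: adjoin_def)
    show "y \<oplus> z \<in> adjoin C x"
      unfolding y(1) z(1) adjoin_add[OF sub assms(2) y(2) z(2)] by (intro adjoinI) (use y z in auto)
  qed
qed

lemma adjoin_unique:
  assumes "additive_subgroup C M" "x \<in> carrier M" "x \<notin> C" "c \<in> C" "c' \<in> C"
    and eq: "c \<oplus> multiple n x = c' \<oplus> multiple n' x"
  shows "[n = n'] (mod CHAR('k))"
proof -
  interpret C: additive_subgroup C M by fact
  have sub': "c \<in> C \<Longrightarrow> c \<in> carrier M" for c using C.a_subset by auto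
  have *: "CHAR('k) dvd n' - n" if "c \<in> C" "c' \<in> C" "n \<le> n'" and eq: "c \<oplus> multiple n x = c' \<oplus> multiple n' x" for c c' n n'
  proof (rule ccontr)
    assume nd: "\<not> CHAR('k) dvd n' - n"
    have "multiple n' x = multiple (n' - n) x \<oplus> multiple n x"
      using that assms(2) by (simp add: multiple_add[symmetric])
    then have "c \<oplus> multiple n x = (c' \<oplus> multiple (n' - n) x) \<oplus> multiple n x"
      using that assms(2) sub' by (simp add: a_assoc)
    then have "c = c' \<oplus> multiple (n' - n) x"
      using that assms(2) sub' by (simp add: add.right_cancel)
    then have "multiple (n' - n) x = \<ominus> c' \<oplus> c"
      using that assms(2) sub' by (simp add: r_neg1)
    then have "multiple (n' - n) x \<in> C" using that by simp
    then show False using in_subgroup_if_multiple assms nd by blast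
  qed
  show ?thesis
  proof (cases "n \<le> n'")
    case True
    then show ?thesis using *[OF assms(4,5) _ eq] by (simp add: cong_altdef_nat cong_sym)
  next
    case False
    then show ?thesis using *[OF assms(5,4) _ eq[symmetric]] by (simp add: cong_altdef_nat)
  qed
qed

lemma unit_root_power_characteristic: "unit_root CHAR('k) ^ CHAR('k) = 1"
  using prime_gt_0_nat[OF prime_characteristic] unfolding unit_root_def Complex.DeMoivre by simp

lemma norm_unit_root: "norm (unit_root CHAR('k)) = 1" by (simp add: unit_root_def)

lemma unit_root_power_cong: "[m = n] (mod CHAR('k)) \<Longrightarrow> unit_root CHAR('k) ^ m = unit_root CHAR('k) ^ n"
  by (metis cong_def div_mod_decomp power_add power_mult power_one unit_root_power_characteristic mult.commute mult_1)

lemma root_of_unity_cases: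
  assumes "z ^ CHAR('k) = 1"
  obtains n where "z = unit_root CHAR('k) ^ n"
proof -
  have "z \<in> (\<lambda>k. cis (2 * pi * real k / real CHAR('k))) ` {..<CHAR('k)}"
    using bij_betw_imp_surj_on[OF Complex.bij_betw_roots_unity[OF prime_gt_0_nat[OF prime_characteristic]]] assms by blast
  then obtain n where "z = cis (2 * pi * real n / real CHAR('k))" by auto
  then have "z = unit_root CHAR('k) ^ n" by (simp add: unit_root_def Complex.DeMoivre mult_ac)
  then show ?thesis by (rule that)
qed

lemma character_power_characteristic: "u \<in> characters \<Longrightarrow> x \<in> carrier M \<Longrightarrow> u x ^ CHAR('k) = 1"
  using multiple_mod[of x "CHAR('k)"] character_multiple[of u x "CHAR('k)"] character_zero[of u] by simp

text \<open>
  Zorn's lemma yields a subgroup \<open>C \<supseteq> A\<close> that is maximal among those avoiding \<open>x\<close>. For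
  \<open>y \<notin> C\<close>, some \<open>c + n y\<close> equals \<open>x\<close>, and \<open>n\<close> is invertible modulo the
  characteristic, so \<open>y \<in> C + \<langle>x\<rangle>\<close>. Hence the module is the direct sum of \<open>C\<close> and
  \<open>\<langle>x\<rangle>\<close>, and \<open>c + n x \<mapsto> \<zeta>\<^sup>n\<close> is a character, with \<open>\<zeta>\<close> a primitive root of unity.
\<close>

lemma separating_character:
  assumes A: "additive_subgroup A M" and x: "x \<in> carrier M" "x \<notin> A"
  obtains u where "u \<in> characters" "\<And>a. a \<in> A \<Longrightarrow> u a = 1" "u x = unit_root CHAR('k)"
proof -
  define \<C> where "\<C> = {C. additive_subgroup C M \<and> A \<subseteq> C \<and> x \<notin> C}"
  have "\<exists>C\<in>\<C>. \<forall>X\<in>\<C>. C \<subseteq> X \<longrightarrow> X = C"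
  proof (rule subset_Zorn_nonempty)
    show "\<C> \<noteq> {}" using A x by (auto simp: \<C>_def)
    fix S assume S: "S \<noteq> {}" "subset.chain \<C> S"
    have sg: "additive_subgroup C M" "A \<subseteq> C" "x \<notin> C" if "C \<in> S" for C
      using S that by (auto simp: \<C>_def subset.chain_def)
    have "additive_subgroup (\<Union>S) M"
    proof (rule additive_subgroup_intro)
      show "\<Union>S \<subseteq> carrier M" using sg additive_subgroup.a_subset by blast
      show "\<zero> \<in> \<Union>S" using S sg additive_subgroup.zero_closed by blast
      show "\<ominus> y \<in> \<Union>S" if y: "y \<in> \<Union>S" for y
      proof -
        obtain C where "y \<in> C" "C \<in> S" using y by auto
        then interpret additive_subgroup C M using sg by blast
        show ?thesis using \<open>y \<in> C\<close> \<open>C \<in> S\<close> by auto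
      qed
      show "y \<oplus> z \<in> \<Union>S" if yz: "y \<in> \<Union>S" "z \<in> \<Union>S" for y z
      proof -
        obtain C D where "y \<in> C" "z \<in> D" "C \<in> S" "D \<in> S" using yz by auto
        moreover from this have "C \<subseteq> D \<or> D \<subseteq> C" using S by (auto simp: subset.chain_def)
        ultimately obtain E where "y \<in> E" "z \<in> E" "E \<in> S" by blast
        then show ?thesis using sg additive_subgroup.a_closed by (metis UnionI)
      qed
    qed
    moreover have "A \<subseteq> \<Union>S" using S(1) sg(2) by blast
    ultimately show "\<Union>S \<in> \<C>" using sg(3) by (auto simp: \<C>_def)
  qed
  then obtain C where "C \<in> \<C>" and max: "\<And>X. X \<in> \<C> \<Longrightarrow> C \<subseteq> X \<Longrightarrow> X = C" by blast
  then have C: "additive_subgroup C M" "A \<subseteq> C" "x \<notin> C" by (auto simp: \<C>_def)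
  interpret C: additive_subgroup C M by fact
  have sub': "c \<in> C \<Longrightarrow> c \<in> carrier M" for c using C.a_subset by auto
  have all: "\<exists>c n. c \<in> C \<and> y = c \<oplus> multiple n x" if y: "y \<in> carrier M" for y
  proof (cases "y \<in> C")
    case True
    then show ?thesis using x sub' by (intro exI[of _ y] exI[of _ 0]) simp
  next
    case False
    note adj = additive_subgroup_adjoin[OF C(1) y]
    have "x \<in> adjoin C y"
    proof (rule ccontr)
      assume "x \<notin> adjoin C y"
      then have "adjoin C y \<in> \<C>" using adj C by (auto simp: \<C>_def)
      then show False using max adj False by blast
    qed
    then obtain c n where cn: "x = c \<oplus> multiple n y" "c \<in> C" by (auto simp: adjoin_def)
    have "\<not> CHAR('k) dvd n"
    proof
      assume "CHAR('k) dvd n"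
      then have "multiple n y = \<zero>" using multiple_mod[OF y, of n] y by simp
      then show False using cn C sub' by auto
    qed
    have "y \<in> adjoin C x"
    proof (rule in_subgroup_if_multiple[OF additive_subgroup_adjoin(1)[OF C(1) x(1)] y _ \<open>\<not> CHAR('k) dvd n\<close>])
      have "multiple n y = \<ominus> c \<oplus> x" unfolding cn(1) using cn(2) y sub' by (simp add: r_neg1)
      also have "\<dots> = \<ominus> c \<oplus> multiple 1 x" using x by (simp add: smult_one)
      finally show "multiple n y \<in> adjoin C x" using cn(2) by (metis C.a_inv_closed adjoinI)
    qed
    then show ?thesis by (auto simp: adjoin_def)
  qed
  \<comment> \<open>The exponent is determined modulo the characteristic only, which is all that the power
    depends on.\<close>
  define u where "u = (\<lambda>y\<in>carrier M. unit_root CHAR('k) ^ (SOME n. \<exists>c\<in>C. y = c \<oplus> multiple n x))"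
  have u: "u (c \<oplus> multiple n x) = unit_root CHAR('k) ^ n" if "c \<in> C" for c n
  proof -
    define n' where "n' = (SOME n'. \<exists>c'\<in>C. c \<oplus> multiple n x = c' \<oplus> multiple n' x)"
    have "\<exists>c'\<in>C. c \<oplus> multiple n x = c' \<oplus> multiple n' x"
      unfolding n'_def by (rule someI_ex) (use that in blast)
    then have "[n' = n] (mod CHAR('k))" using adjoin_unique[OF C(1) x(1) C(3) _ that] by metis
    then show ?thesis using that sub' x by (simp add: u_def n'_def[symmetric] unit_root_power_cong)
  qed
  show ?thesis
  proof
    show "u \<in> characters"
      unfolding characters_iff
    proof (intro conjI ballI)
      show "u \<in> carrier M \<rightarrow>\<^sub>E sphere 0 1" by (auto simp: u_def norm_power norm_unit_root)
      fix y z assume "y \<in> carrier M" "z \<in> carrier M"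
      then obtain c n c' n' where yz: "y = c \<oplus> multiple n x" "c \<in> C" "z = c' \<oplus> multiple n' x" "c' \<in> C"
        using all by metis
      have "y \<oplus> z = (c \<oplus> c') \<oplus> multiple (n + n') x"
        unfolding yz(1,3) by (rule adjoin_add[OF C.a_subset x(1) yz(2,4)])
      moreover have "u y = unit_root CHAR('k) ^ n" "u z = unit_root CHAR('k) ^ n'" using u yz by auto
      moreover have "u ((c \<oplus> c') \<oplus> multiple (n + n') x) = unit_root CHAR('k) ^ (n + n')" using yz by (intro u) auto
      ultimately show "u (y \<oplus> z) = u y * u z" by (simp add: power_add)
    qed
    show "u a = 1" if "a \<in> A" for a using u[of a 0] that C sub' x by auto
    show "u x = unit_root CHAR('k)" using u[of \<zero> 1] x by (simp add: smult_one)
  qed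
qed

definition restrictions :: "'m set \<Rightarrow> ('m \<Rightarrow> complex) set" where
  "restrictions A = (\<lambda>u. restrict u A) ` characters"

lemma character_mult_power:
  assumes "u \<in> characters" "w \<in> characters"
  shows "(\<lambda>y\<in>carrier M. u y * w y ^ n) \<in> characters"
  using assms by (auto simp: characters_iff PiE_iff norm_mult norm_power power_mult_distrib)

lemma trivial_character: "(\<lambda>y\<in>carrier M. 1) \<in> characters"
  by (auto simp: characters_iff)

lemma card_adjoin:
  assumes C: "additive_subgroup C M" and x: "x \<in> carrier M" "x \<notin> C"
  shows "card (adjoin C x) = card C * CHAR('k)"
proof -
  interpret C: additive_subgroup C M by fact
  have sub': "c \<in> C \<Longrightarrow> c \<in> carrier M" for c using C.a_subset by auto
  have "bij_betw (\<lambda>(c, n). c \<oplus> multiple n x) (C \<times> {..<CHAR('k)}) (adjoin C x)"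
    unfolding bij_betw_def
  proof
    show "inj_on (\<lambda>(c, n). c \<oplus> multiple n x) (C \<times> {..<CHAR('k)})"
    proof (rule inj_onI, clarify)
      fix c n c' n' assume *: "c \<in> C" "c' \<in> C" "n < CHAR('k)" "n' < CHAR('k)" "c \<oplus> multiple n x = c' \<oplus> multiple n' x"
      then have "n = n'" using adjoin_unique[OF C x *(1,2,5)] * by (simp add: cong_def)
      then show "c = c' \<and> n = n'" using * sub' x by simp
    qed
    have "c \<oplus> multiple n x \<in> (\<lambda>(c, n). c \<oplus> multiple n x) ` (C \<times> {..<CHAR('k)})" if "c \<in> C" for c n
      using that x prime_gt_0_nat[OF prime_characteristic] multiple_mod[OF x(1), of n]
      by (intro image_eqI[of _ _ "(c, n mod CHAR('k))"]) auto
    then show "(\<lambda>(c, n). c \<oplus> multiple n x) ` (C \<times> {..<CHAR('k)}) = adjoin C x"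
      by (auto simp: adjoin_def)
  qed
  then show ?thesis using bij_betw_same_card by (fastforce simp: card_cartesian_product)
qed

text \<open>
  A character of \<open>C + \<langle>x\<rangle>\<close> is determined by its restriction to \<open>C\<close> and its value at
  \<open>x\<close>. Multiplication by powers of a character that is trivial on \<open>C\<close> and primitive at
  \<open>x\<close> produces every possible value.
\<close>

lemma bij_betw_restrictions_adjoin:
  assumes C: "additive_subgroup C M" and x: "x \<in> carrier M" "x \<notin> C"
  shows "bij_betw (\<lambda>r. (restrict r C, r x)) (restrictions (adjoin C x)) (restrictions C \<times> {z. z ^ CHAR('k) = 1})"
  unfolding bij_betw_def
proof
  interpret C: additive_subgroup C M by fact
  have sub': "c \<in> C \<Longrightarrow> c \<in> carrier M" for c using C.a_subset by auto
  note adj = additive_subgroup_adjoin[OF C x(1)]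
  show "inj_on (\<lambda>r. (restrict r C, r x)) (restrictions (adjoin C x))"
  proof (rule inj_onI)
    fix r r' assume "r \<in> restrictions (adjoin C x)" "r' \<in> restrictions (adjoin C x)"
      and eq: "(restrict r C, r x) = (restrict r' C, r' x)"
    then obtain u u' where u: "r = restrict u (adjoin C x)" "r' = restrict u' (adjoin C x)"
      "u \<in> characters" "u' \<in> characters" by (auto simp: restrictions_def)
    have "u y = u' y" if y_in: "y \<in> adjoin C x" for y
    proof -
      obtain c n where y: "y = c \<oplus> multiple n x" "c \<in> C" using y_in by (auto simp: adjoin_def)
      have "r c = r' c" using eq y(2) by (metis fst_conv restrict_apply')
      then have "u c = u' c" using y(2) adj by (auto simp: u subset_iff)
      moreover have "u x = u' x" using eq adj by (auto simp: u)
      ultimately show ?thesis using y sub' x u by (simp add: character_add character_multiple)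
    qed
    then show "r = r'" unfolding u by (rule restrict_ext)
  qed
  show "(\<lambda>r. (restrict r C, r x)) ` restrictions (adjoin C x) = restrictions C \<times> {z. z ^ CHAR('k) = 1}"
  proof
    show "(\<lambda>r. (restrict r C, r x)) ` restrictions (adjoin C x) \<subseteq> restrictions C \<times> {z. z ^ CHAR('k) = 1}"
      using adj x by (auto simp: restrictions_def character_power_characteristic Int_absorb1)
    show "restrictions C \<times> {z. z ^ CHAR('k) = 1} \<subseteq> (\<lambda>r. (restrict r C, r x)) ` restrictions (adjoin C x)"
    proof clarify
      fix s and z :: complex assume "s \<in> restrictions C" "z ^ CHAR('k) = 1"
      then obtain u where u: "u \<in> characters" "s = restrict u C" by (auto simp: restrictions_def)
      obtain w where w: "w \<in> characters" "\<And>c. c \<in> C \<Longrightarrow> w c = 1" "w x = unit_root CHAR('k)"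
        using separating_character[OF C x] by blast
      have "u x \<noteq> 0" using norm_character[OF u(1) x(1)] by auto
      have "(z / u x) ^ CHAR('k) = 1" using \<open>z ^ CHAR('k) = 1\<close> character_power_characteristic[OF u(1) x(1)] by (simp add: power_divide)
      then obtain n where n: "z / u x = unit_root CHAR('k) ^ n" by (rule root_of_unity_cases)
      define v where "v = (\<lambda>y\<in>carrier M. u y * w y ^ n)"
      have "v \<in> characters" unfolding v_def by (rule character_mult_power[OF u(1) w(1)])
      moreover have "v c = u c" if "c \<in> C" for c using that w sub' by (simp add: v_def)
      moreover have "v x = z" using x w n[symmetric] \<open>u x \<noteq> 0\<close> by (simp add: v_def)
      ultimately show "(s, z) \<in> (\<lambda>r. (restrict r C, r x)) ` restrictions (adjoin C x)"
      proof (intro image_eqI[of _ _ "restrict v (adjoin C x)"])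
        have "restrict (restrict v (adjoin C x)) C = s"
          unfolding u(2) using adj(2) \<open>\<And>c. c \<in> C \<Longrightarrow> v c = u c\<close> by (intro restrict_ext) auto
        then show "(s, z) = (restrict (restrict v (adjoin C x)) C, restrict v (adjoin C x) x)"
          using adj(3) \<open>v x = z\<close> by simp
      qed (use \<open>v \<in> characters\<close> in \<open>auto simp: restrictions_def\<close>)
    qed
  qed
qed

text \<open>
  Finite duality together with the extension of characters. A largest subgroup \<open>H \<subseteq> A\<close> that
  satisfies the claim is \<open>A\<close>, because adjoining one more element multiplies both
  cardinalities by the characteristic.
\<close>

lemma card_restrictions:
  assumes A: "additive_subgroup A M" "finite A"
  shows "finite (restrictions A) \<and> card (restrictions A) = card A"
proof -
  define P where "P = (\<lambda>H. additive_subgroup H M \<and> H \<subseteq> A \<and> finite (restrictions H) \<and> card (restrictions H) = card H)"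
  interpret A: additive_subgroup A M by fact
  have "P {\<zero>}"
  proof -
    have "\<exists>t. restrictions {\<zero>} = {t}"
    proof
      have "restrict u {\<zero>} = (\<lambda>y\<in>{\<zero>}. 1)" if "u \<in> characters" for u
        using character_zero[OF that] by (intro restrict_ext) simp
      then show "restrictions {\<zero>} = {\<lambda>y\<in>{\<zero>}. 1}"
        unfolding restrictions_def using trivial_character by (simp cong: image_cong) (simp add: image_constant[OF trivial_character])
    qed
    moreover have "additive_subgroup {\<zero>} M" using additive_subgroup_orbit_span[of "{}"] by simp
    ultimately show ?thesis using A.zero_closed by (auto simp: P_def)
  qed
  moreover have "\<forall>H. P H \<longrightarrow> card H < Suc (card A)"
    using A(2) by (auto simp: P_def less_Suc_eq_le intro: card_mono)
  ultimately have "\<exists>H. P H \<and> (\<forall>H'. P H' \<longrightarrow> card H' \<le> card H)"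
    by (rule Lattices_Big.ex_has_greatest_nat)
  then obtain H where H: "P H" and max: "\<And>H'. P H' \<Longrightarrow> card H' \<le> card H" by blast
  have "H = A"
  proof (rule ccontr)
    assume "H \<noteq> A"
    then obtain x where x: "x \<in> A" "x \<notin> H" using H by (auto simp: P_def)
    have xM: "x \<in> carrier M" using x A.a_subset by auto
    have sg: "additive_subgroup H M" using H by (simp add: P_def)
    note adj = additive_subgroup_adjoin[OF sg xM]
    have "adjoin H x \<subseteq> A"
      using H x multiple_in_subgroup[OF A(1) x(1)] by (auto simp: adjoin_def P_def)
    have bij: "bij_betw (\<lambda>r. (restrict r H, r x)) (restrictions (adjoin H x)) (restrictions H \<times> {z. z ^ CHAR('k) = 1})"
      by (rule bij_betw_restrictions_adjoin[OF sg xM x(2)])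
    have p0: "CHAR('k) > 0" using prime_gt_0_nat[OF prime_characteristic] .
    have "finite {z::complex. z ^ CHAR('k) = 1}"
      by (rule finite_roots_unity) (use p0 in simp)
    then have "finite (restrictions (adjoin H x))"
      using bij_betw_finite[OF bij] H by (simp add: P_def)
    moreover have "card (restrictions (adjoin H x)) = card (adjoin H x)"
      using bij_betw_same_card[OF bij] H card_adjoin[OF sg xM x(2)] card_roots_unity_eq[OF p0]
      by (simp add: P_def card_cartesian_product)
    ultimately have "P (adjoin H x)" using adj \<open>adjoin H x \<subseteq> A\<close> by (simp add: P_def)
    then have "card (adjoin H x) \<le> card H" by (rule max)
    moreover have "card H < card (adjoin H x)"
      using \<open>adjoin H x \<subseteq> A\<close> A(2) adj x by (intro psubset_card_mono) (auto intro: finite_subset)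
    ultimately show False by simp
  qed
  then show ?thesis using H by (simp add: P_def)
qed

section \<open>Entropy of the dual action\<close>

lemma topspace_dual: "topspace (pontryagin_dual M) = characters"
  by (simp add: characters_def)

lemma continuous_map_evaluation:
  assumes "x \<in> carrier M"
  shows "continuous_map (pontryagin_dual M) euclidean (\<lambda>u. u x)"
proof -
  have "continuous_map (product_topology (\<lambda>_. top_of_set (sphere 0 1)) (carrier M)) (top_of_set (sphere (0::complex) 1)) (\<lambda>u. u x)"
    by (rule continuous_map_product_projection[OF assms])
  then have "continuous_map (product_topology (\<lambda>_. top_of_set (sphere (0::complex) 1)) (carrier M)) euclidean (\<lambda>u. u x)"
    by (rule continuous_map_into_fulltopology)
  then show ?thesis unfolding pontryagin_dual_def by (rule continuous_map_from_subtopology)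
qed

text \<open>
  The characters form a closed subset of a product of circles.
\<close>

lemma compact_space_dual: "compact_space (pontryagin_dual M)"
proof -
  define P where "P = product_topology (\<lambda>_. top_of_set (sphere (0::complex) 1)) (carrier M)"
  define S :: "('m \<Rightarrow> complex) set" where "S = {u. \<forall>x\<in>carrier M. \<forall>y\<in>carrier M. u (x \<oplus> y) = u x * u y}"
  have proj: "continuous_map P euclidean (\<lambda>u. u x)" if "x \<in> carrier M" for x
    using continuous_map_product_projection[OF that, of "\<lambda>_. top_of_set (sphere (0::complex) 1)"]
    unfolding P_def by (rule continuous_map_into_fulltopology)
  have "compact_space P"
    unfolding P_def compact_space_product_topology
    by (intro disjI2 ballI) (simp add: compact_space_subtopology)
  moreover have "closedin P (topspace P \<inter> S)"
  proof -
    have "closedin P {u \<in> topspace P. u (x \<oplus> y) - u x * u y \<in> {0}}" if "x \<in> carrier M" "y \<in> carrier M" for x y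
    proof (rule closedin_continuous_map_preimage)
      have "continuous_map P euclidean (\<lambda>u. u x * u y)"
        using proj[OF that(1)] proj[OF that(2)] by (simp add: continuous_map_atin tendsto_mult)
      then show "continuous_map P euclidean (\<lambda>u. u (x \<oplus> y) - u x * u y)"
        using that by (intro continuous_map_diff proj) auto
    qed simp
    then have "closedin P (\<Inter>q\<in>carrier M \<times> carrier M. {u \<in> topspace P. u (fst q \<oplus> snd q) - u (fst q) * u (snd q) \<in> {0}})"
      by (intro closedin_INT) (auto intro: zero_closed)
    also have "(\<Inter>q\<in>carrier M \<times> carrier M. {u \<in> topspace P. u (fst q \<oplus> snd q) - u (fst q) * u (snd q) \<in> {0}}) = topspace P \<inter> S"
      by (auto simp: S_def intro: zero_closed)
    finally show ?thesis .
  qed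
  ultimately have "compactin P (topspace P \<inter> S)" by (rule closedin_compact_space)
  then have "compact_space (subtopology P (topspace P \<inter> S))" by (rule compact_space_subtopology)
  moreover have "pontryagin_dual M = subtopology P S"
    by (simp add: pontryagin_dual_def P_def S_def)
  ultimately show ?thesis by (simp only: subtopology_restrict)
qed

definition cylinder :: "('m \<Rightarrow> complex) \<Rightarrow> 'm set \<Rightarrow> ('m \<Rightarrow> complex) set" where
  "cylinder u A = {v \<in> characters. \<forall>x\<in>A. v x = u x}"

text \<open>
  Characters take values in the finite group of roots of unity of order the characteristic of
  \<open>k\<close>, so prescribing the value at one point is an open condition.
\<close>

lemma openin_cylinder:
  assumes "finite A" "A \<subseteq> carrier M" "u \<in> characters"
  shows "openin (pontryagin_dual M) (cylinder u A)"
  using assms(1,2)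
proof (induction A rule: finite_induct)
  case empty
  then show ?case using openin_topspace[of "pontryagin_dual M"] by (simp add: cylinder_def topspace_dual)
next
  case (insert x A)
  let ?Z = "{z::complex. z ^ CHAR('k) = 1} - {u x}"
  have "finite ?Z" using finite_roots_unity[of "CHAR('k)"] prime_ge_1_nat[OF prime_characteristic] by simp
  then have "open (- ?Z)" by (intro open_Compl finite_imp_closed)
  then have "openin (pontryagin_dual M) {v \<in> topspace (pontryagin_dual M). v x \<in> - ?Z}"
    using insert by (intro openin_continuous_map_preimage[OF continuous_map_evaluation]) auto
  then have "openin (pontryagin_dual M) ({v \<in> topspace (pontryagin_dual M). v x \<in> - ?Z} \<inter> cylinder u A)"
    using insert by (intro openin_Int) auto
  also have "{v \<in> topspace (pontryagin_dual M). v x \<in> - ?Z} \<inter> cylinder u A = cylinder u (insert x A)"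
    using insert.prems by (auto simp: cylinder_def topspace_dual character_power_characteristic)
  finally show ?case .
qed

lemma cylinder_subset_open:
  assumes "openin (pontryagin_dual M) U" "u \<in> U"
  obtains A where "finite A" "A \<subseteq> carrier M" "cylinder u A \<subseteq> U"
proof -
  define P where "P = product_topology (\<lambda>_. top_of_set (sphere (0::complex) 1)) (carrier M)"
  obtain W where W: "openin P W" "U = W \<inter> {u. \<forall>x\<in>carrier M. \<forall>y\<in>carrier M. u (x \<oplus> y) = u x * u y}"
    using assms(1) by (auto simp: pontryagin_dual_def openin_subtopology P_def)
  then have "u \<in> W" using assms(2) by simp
  then obtain V where V: "finite {x \<in> carrier M. V x \<noteq> sphere 0 1}" "u \<in> Pi\<^sub>E (carrier M) V" "Pi\<^sub>E (carrier M) V \<subseteq> W"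
    using W(1) unfolding P_def openin_product_topology_alt by fastforce
  have "cylinder u {x \<in> carrier M. V x \<noteq> sphere 0 1} \<subseteq> U"
  proof
    fix v assume v: "v \<in> cylinder u {x \<in> carrier M. V x \<noteq> sphere 0 1}"
    then have "v \<in> characters" by (simp add: cylinder_def)
    have "v x \<in> V x" if "x \<in> carrier M" for x
    proof (cases "V x = sphere 0 1")
      case True
      then show ?thesis using norm_character[OF \<open>v \<in> characters\<close> that] by simp
    next
      case False
      then show ?thesis using v V(2) that by (auto simp: cylinder_def)
    qed
    then have "v \<in> Pi\<^sub>E (carrier M) V" using \<open>v \<in> characters\<close> by (auto simp: characters_iff PiE_iff)
    then show "v \<in> U" using V(3) W(2) \<open>v \<in> characters\<close> by (auto simp: characters_iff)
  qed
  with V(1) show ?thesis by (intro that) auto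
qed

abbreviation act :: "'g \<Rightarrow> ('m \<Rightarrow> complex) \<Rightarrow> 'm \<Rightarrow> complex" where
  "act \<equiv> dual_action (int_group_module M)"

lemma act_apply: "x \<in> carrier M \<Longrightarrow> act g u x = u (Poly_Mapping.single (- g) 1 \<odot> x)"
  by (simp add: dual_action_def int_group_module_def map_single)

lemma act_characters: "u \<in> characters \<Longrightarrow> act g u \<in> characters"
  unfolding characters_iff
proof (intro conjI ballI)
  assume u: "u \<in> carrier M \<rightarrow>\<^sub>E sphere 0 1 \<and> (\<forall>x\<in>carrier M. \<forall>y\<in>carrier M. u (x \<oplus> y) = u x * u y)"
  have "act g u x \<in> sphere 0 1" if "x \<in> carrier M" for x
    unfolding act_apply[OF that] using u smult_closed[OF that] by (auto simp: PiE_iff)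
  moreover have "act g u \<in> extensional (carrier M)"
    by (auto simp: dual_action_def int_group_module_def)
  ultimately show "act g u \<in> carrier M \<rightarrow>\<^sub>E sphere 0 1" unfolding PiE_iff by blast
  fix x y assume "x \<in> carrier M" "y \<in> carrier M"
  then show "act g u (x \<oplus> y) = act g u x * act g u y"
    using u by (simp add: act_apply smult_r_distr smult_closed)
qed

text \<open>
  By compactness there is one finite set \<open>E\<close> such that the value of a character on \<open>E\<close>
  determines a member of \<open>\<U>\<close> in which it lies. Then the restriction of a character to the
  span of \<open>F\<^sup>-\<^sup>1 E\<close> determines a member of the join, and one member for each restriction is
  enough.
\<close>

lemma finite_subcover_join:
  assumes "open_cover (pontryagin_dual M) \<U>"
  obtains E where "finite E" "E \<subseteq> carrier M"
    "\<And>F. finite F \<Longrightarrow> \<exists>\<V>. \<V> \<subseteq> cover_join (pontryagin_dual M) act F \<U> \<and> finite \<V> \<and>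
        card \<V> \<le> card (orbit_span M (uminus ` F) E) \<and> \<Union>\<V> = characters"
proof -
  have opn: "\<And>U. U \<in> \<U> \<Longrightarrow> openin (pontryagin_dual M) U" and un: "\<Union>\<U> = characters"
    using assms by (auto simp: open_cover_def topspace_dual)
  have "\<exists>A. finite A \<and> A \<subseteq> carrier M \<and> (\<exists>U\<in>\<U>. cylinder u A \<subseteq> U)" if u: "u \<in> characters" for u
  proof -
    obtain U where U: "U \<in> \<U>" "u \<in> U" using un u by blast
    obtain A where "finite A" "A \<subseteq> carrier M" "cylinder u A \<subseteq> U"
      by (rule cylinder_subset_open[OF opn[OF U(1)] U(2)])
    then show ?thesis using U by blast
  qed
  then obtain A where A: "\<And>u. u \<in> characters \<Longrightarrow> finite (A u) \<and> A u \<subseteq> carrier M \<and> (\<exists>U\<in>\<U>. cylinder u (A u) \<subseteq> U)"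
    by metis
  let ?C = "(\<lambda>u. cylinder u (A u)) ` characters"
  have "\<Union>?C = topspace (pontryagin_dual M)"
    by (auto simp: cylinder_def topspace_dual)
  moreover have "\<forall>U\<in>?C. openin (pontryagin_dual M) U" using A by (auto intro: openin_cylinder)
  ultimately have "\<exists>\<F>. finite \<F> \<and> \<F> \<subseteq> ?C \<and> \<Union>\<F> = topspace (pontryagin_dual M)"
    using compact_space_dual[unfolded compact_space, THEN spec, of ?C] by simp
  then obtain C' where C': "finite C'" "C' \<subseteq> ?C" "\<Union>C' = topspace (pontryagin_dual M)"
    by (elim exE conjE)
  from finite_subset_image[OF C'(1,2)]
  obtain I where I: "I \<subseteq> characters" "finite I" "C' = (\<lambda>u. cylinder u (A u)) ` I"
    by (elim exE conjE)
  then have cover: "(\<Union>u\<in>I. cylinder u (A u)) = characters" using C'(3) by (simp add: topspace_dual)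
  define E where "E = (\<Union>u\<in>I. A u)"
  have E: "finite E" "E \<subseteq> carrier M" using I A by (auto simp: E_def)
  have "\<exists>U\<in>\<U>. cylinder v E \<subseteq> U" if "v \<in> characters" for v
  proof -
    obtain u where u: "u \<in> I" "v \<in> cylinder u (A u)" using cover \<open>v \<in> characters\<close> by auto
    then have "cylinder v E \<subseteq> cylinder u (A u)" by (auto simp: cylinder_def E_def)
    then show ?thesis using A[of u] u I(1) by blast
  qed
  then obtain \<phi> where \<phi>: "\<And>v. v \<in> characters \<Longrightarrow> \<phi> v \<in> \<U> \<and> cylinder v E \<subseteq> \<phi> v" by metis
  show ?thesis
  proof
    fix F :: "'g set" assume F: "finite F"
    let ?B = "orbit_span M (uminus ` F) E"
    have B: "additive_subgroup ?B M" "finite ?B"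
      using E F by (auto intro!: additive_subgroup_orbit_span finite_orbit_span)
    note R = card_restrictions[OF B]
    have "\<exists>u. u \<in> characters \<and> restrict u ?B = r" if "r \<in> restrictions ?B" for r
      using that by (auto simp: restrictions_def)
    then obtain rep where rep: "\<And>r. r \<in> restrictions ?B \<Longrightarrow> rep r \<in> characters \<and> restrict (rep r) ?B = r"
      by metis
    define J where "J = (\<lambda>u. {x \<in> topspace (pontryagin_dual M). \<forall>s\<in>F. act s x \<in> \<phi> (act s u)})"
    have "J u \<in> cover_join (pontryagin_dual M) act F \<U>" if "u \<in> characters" for u
      unfolding cover_join_def J_def
      using \<phi> act_characters[OF that] by (intro CollectI exI[of _ "\<lambda>s. \<phi> (act s u)"]) auto
    then have 1: "(\<lambda>r. J (rep r)) ` restrictions ?B \<subseteq> cover_join (pontryagin_dual M) act F \<U>"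
      using rep by auto
    have "v \<in> J (rep (restrict v ?B))" if v: "v \<in> characters" for v
    proof -
      define u where "u = rep (restrict v ?B)"
      have "restrict v ?B \<in> restrictions ?B" using v by (auto simp: restrictions_def)
      then have u: "u \<in> characters" "restrict u ?B = restrict v ?B" using rep by (auto simp: u_def)
      have "act s v \<in> \<phi> (act s u)" if s: "s \<in> F" for s
      proof -
        have "act s v x = act s u x" if x: "x \<in> E" for x
        proof -
          have "Poly_Mapping.single (- s) 1 \<odot> x \<in> ?B" using s x E by (intro orbit_span_single) auto
          then have "u (Poly_Mapping.single (- s) 1 \<odot> x) = v (Poly_Mapping.single (- s) 1 \<odot> x)"
            using u(2) by (metis restrict_apply')
          then show ?thesis using x E by (auto simp: act_apply)
        qed
        then have "act s v \<in> cylinder (act s u) E" using act_characters[OF v] by (simp add: cylinder_def)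
        then show ?thesis using \<phi>[OF act_characters[OF u(1)]] by auto
      qed
      then show ?thesis using v by (simp add: J_def u_def topspace_dual)
    qed
    then have 2: "\<Union>((\<lambda>r. J (rep r)) ` restrictions ?B) = characters"
      by (auto simp: restrictions_def J_def topspace_dual)
    have 3: "card ((\<lambda>r. J (rep r)) ` restrictions ?B) \<le> card ?B"
      using R card_image_le by metis
    show "\<exists>\<V>. \<V> \<subseteq> cover_join (pontryagin_dual M) act F \<U> \<and> finite \<V> \<and> card \<V> \<le> card ?B \<and> \<Union>\<V> = characters"
      using 1 2 3 R by blast
  qed (use E in auto)
qed

lemma character_eq_on_orbit_span:
  assumes "u \<in> characters" "v \<in> characters" "E \<subseteq> carrier M"
    and "\<And>t x c. t \<in> T \<Longrightarrow> x \<in> E \<Longrightarrow> u (Poly_Mapping.single t c \<odot> x) = v (Poly_Mapping.single t c \<odot> x)"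
    and "y \<in> orbit_span M T E"
  shows "u y = v y"
  using assms(5)
proof induction
  case zero
  then show ?case using assms by (simp add: character_zero)
next
  case (step y t x c)
  then show ?case
    using assms(3,4) orbit_span_closed[OF assms(3), of T]
    by (auto simp: character_add[OF assms(1)] character_add[OF assms(2)] smult_closed subset_iff)
qed

text \<open>
  Let \<open>\<U>\<close> be the partition by restriction to the \<open>k\<close>-span of \<open>E\<close>. Characters in the
  same member of the join over \<open>F\<close> agree on the span of \<open>F\<^sup>-\<^sup>1 E\<close>, so a subcover needs a
  member for each restriction.
\<close>

lemma card_le_cover_number_join:
  assumes E: "finite E" "E \<subseteq> carrier M"
  obtains \<U> where "open_cover (pontryagin_dual M) \<U>"
    "\<And>F. finite F \<Longrightarrow> card (orbit_span M (uminus ` F) E) \<le>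
        cover_number (pontryagin_dual M) (cover_join (pontryagin_dual M) act F \<U>)"
proof -
  \<comment> \<open>The \<open>k\<close>-span rather than \<open>E\<close> itself: agreement of characters at \<open>x\<close> does not imply
    agreement at \<open>c x\<close> for \<open>c \<in> k\<close>.\<close>
  let ?V = "orbit_span M {0} E"
  have V: "finite ?V" "?V \<subseteq> carrier M"
    using finite_orbit_span[OF _ E, of "{0}"] orbit_span_closed[OF E(2)] by auto
  define \<U> where "\<U> = (\<lambda>u. cylinder u ?V) ` characters"
  have oc: "open_cover (pontryagin_dual M) \<U>"
    unfolding open_cover_def \<U>_def topspace_dual using openin_cylinder[OF V] by (auto simp: cylinder_def)
  show ?thesis
  proof (rule that[OF oc])
    fix F :: "'g set" assume F: "finite F"
    let ?B = "orbit_span M (uminus ` F) E" and ?J = "cover_join (pontryagin_dual M) act F \<U>"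
    have B: "additive_subgroup ?B M" "finite ?B"
      using E F by (auto intro!: additive_subgroup_orbit_span finite_orbit_span)
    have R: "card (restrictions ?B) = card ?B" using card_restrictions[OF B] by simp
    let ?P = "\<lambda>n. \<exists>\<V>. \<V> \<subseteq> ?J \<and> finite \<V> \<and> card \<V> = n \<and> \<Union>\<V> = topspace (pontryagin_dual M)"
    obtain E' where "finite E'" "E' \<subseteq> carrier M"
      and "\<And>F. finite F \<Longrightarrow> \<exists>\<V>. \<V> \<subseteq> cover_join (pontryagin_dual M) act F \<U> \<and> finite \<V> \<and>
        card \<V> \<le> card (orbit_span M (uminus ` F) E') \<and> \<Union>\<V> = characters"
      by (rule finite_subcover_join[OF oc]) blast
    from this(3)[OF F] have "\<exists>n. ?P n" unfolding topspace_dual by blast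
    then have "?P (cover_number (pontryagin_dual M) ?J)" unfolding cover_number_def by (rule LeastI_ex)
    then obtain \<V> where \<V>: "\<V> \<subseteq> ?J" "finite \<V>" "card \<V> = cover_number (pontryagin_dual M) ?J" "\<Union>\<V> = characters"
      unfolding topspace_dual by blast
    have agree: "restrict u ?B = restrict v ?B" if W: "W \<in> ?J" "u \<in> W" "v \<in> W" for W u v
    proof -
      obtain c where c: "W = {x \<in> topspace (pontryagin_dual M). \<forall>s\<in>F. act s x \<in> c s}" "\<forall>s\<in>F. c s \<in> \<U>"
        using W(1) by (auto simp: cover_join_def)
      have uv: "u \<in> characters" "v \<in> characters" using W c by (auto simp: topspace_dual)
      have eq: "u (Poly_Mapping.single t d \<odot> x) = v (Poly_Mapping.single t d \<odot> x)"
        if t: "t \<in> uminus ` F" and x: "x \<in> E" for t x d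
      proof -
        obtain s where s: "s \<in> F" "t = - s" using t by auto
        obtain w where "c s = cylinder w ?V" using c(2) s(1) by (auto simp: \<U>_def)
        then have "act s u \<in> cylinder w ?V" "act s v \<in> cylinder w ?V" using W(2,3) c(1) s(1) by auto
        moreover have y: "Poly_Mapping.single 0 d \<odot> x \<in> ?V" using x E by (intro orbit_span_single) auto
        ultimately have "act s u (Poly_Mapping.single 0 d \<odot> x) = act s v (Poly_Mapping.single 0 d \<odot> x)"
          by (simp add: cylinder_def)
        moreover have "Poly_Mapping.single 0 d \<odot> x \<in> carrier M" using y V(2) by blast
        moreover have "Poly_Mapping.single (- s) 1 \<odot> (Poly_Mapping.single 0 d \<odot> x) = Poly_Mapping.single t d \<odot> x"
          using x E s by (auto simp: smult_assoc[symmetric] mult_single)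
        ultimately show ?thesis by (simp add: act_apply)
      qed
      show ?thesis by (rule restrict_ext) (rule character_eq_on_orbit_span[OF uv E(2) eq])
    qed
    have "\<exists>W\<in>\<V>. \<exists>u\<in>W. restrict u ?B = r" if r: "r \<in> restrictions ?B" for r
    proof -
      obtain u where "u \<in> characters" "r = restrict u ?B" using r by (auto simp: restrictions_def)
      then show ?thesis using \<V>(4) by blast
    qed
    then obtain \<psi> where \<psi>: "\<And>r. r \<in> restrictions ?B \<Longrightarrow> \<psi> r \<in> \<V> \<and> (\<exists>u\<in>\<psi> r. restrict u ?B = r)" by metis
    have "inj_on \<psi> (restrictions ?B)"
    proof (rule inj_onI)
      fix r r' assume r: "r \<in> restrictions ?B" "r' \<in> restrictions ?B" "\<psi> r = \<psi> r'"
      obtain u where u: "u \<in> \<psi> r" "restrict u ?B = r" using \<psi>[OF r(1)] by blast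
      obtain u' where u': "u' \<in> \<psi> r" "restrict u' ?B = r'" using \<psi>[OF r(2)] r(3) by auto
      have "\<psi> r \<in> ?J" using \<psi>[OF r(1)] \<V>(1) by blast
      from agree[OF this u(1) u'(1)] show "r = r'" using u u' by simp
    qed
    then have "card (restrictions ?B) \<le> card \<V>"
      by (rule card_inj_on_le) (use \<psi> \<V> in auto)
    then show "card ?B \<le> cover_number (pontryagin_dual M) ?J" using R \<V>(3) by simp
  qed
qed

lemma pontryagin_dual_int_group_module: "pontryagin_dual (int_group_module M) = pontryagin_dual M"
  by (simp add: pontryagin_dual_def int_group_module_def)

lemma Limsup_log_growth:
  assumes "amenable TYPE('g)" "finite E" "E \<subseteq> carrier M"
  shows "Limsup folner_filter (\<lambda>F. ereal (log_growth E F / real (card F))) = ereal (growth_rate E)"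
proof (rule lim_imp_Limsup)
  interpret submodular_invariant "log_growth E" using assms by (intro submodular_invariant_log_growth)
  show "((\<lambda>F. ereal (log_growth E F / real (card F))) \<longlongrightarrow> ereal (growth_rate E)) folner_filter"
    using tendsto_mean by (simp add: growth_rate_def)
qed (use folner_filter_neq_bot[OF assms(1)] in simp)

text \<open>
  Peters' formula for the entropy of the dual action. Open covers are bounded above by
  \<open>finite_subcover_join\<close> and partitions from below by \<open>card_le_cover_number_join\<close>; both
  bounds have growth rates as their limits.
\<close>

proposition torsion_eq_SUP_growth_rate:
  assumes "amenable TYPE('g)"
  shows "torsion (int_group_module M) = (SUP E\<in>{E. finite E \<and> E \<subseteq> carrier M}. ereal (growth_rate E))"
  unfolding torsion_def topological_entropy_def pontryagin_dual_int_group_module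
proof (intro antisym SUP_least)
  fix \<U> assume "\<U> \<in> {\<U>. open_cover (pontryagin_dual M) \<U>}"
  then obtain E where E: "finite E" "E \<subseteq> carrier M" and
    sub: "\<And>F. finite F \<Longrightarrow> \<exists>\<V>. \<V> \<subseteq> cover_join (pontryagin_dual M) act F \<U> \<and> finite \<V> \<and>
        card \<V> \<le> card (orbit_span M (uminus ` F) E) \<and> \<Union>\<V> = characters"
    using finite_subcover_join[of \<U>] by (metis (no_types, lifting) mem_Collect_eq)
  have le: "cover_number (pontryagin_dual M) (cover_join (pontryagin_dual M) act F \<U>) \<le> card (orbit_span M (uminus ` F) E)"
    if F: "finite F" for F
  proof -
    obtain \<V> where \<V>: "\<V> \<subseteq> cover_join (pontryagin_dual M) act F \<U>" "finite \<V>"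
      "card \<V> \<le> card (orbit_span M (uminus ` F) E)" "\<Union>\<V> = characters" using sub[OF F] by blast
    have "cover_number (pontryagin_dual M) (cover_join (pontryagin_dual M) act F \<U>) \<le> card \<V>"
      unfolding cover_number_def topspace_dual by (rule Least_le) (use \<V> in blast)
    then show ?thesis using \<V>(3) by linarith
  qed
  from eventually_finite_nonempty have "\<forall>\<^sub>F F in folner_filter. ereal (ln (real (cover_number (pontryagin_dual M) (cover_join (pontryagin_dual M) act F \<U>))) / real (card F))
      \<le> ereal (log_growth E F / real (card F))"
    by eventually_elim (auto simp: log_growth_def intro!: divide_right_mono ln_of_nat_mono le)
  then have "cover_entropy (pontryagin_dual M) act \<U> \<le> ereal (growth_rate E)"
    unfolding cover_entropy_def Limsup_log_growth[OF assms E, symmetric] by (rule Limsup_mono)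
  also have "\<dots> \<le> (SUP E\<in>{E. finite E \<and> E \<subseteq> carrier M}. ereal (growth_rate E))"
    using E by (intro SUP_upper) auto
  finally show "cover_entropy (pontryagin_dual M) act \<U> \<le> \<dots>" .
next
  fix E assume "E \<in> {E. finite E \<and> E \<subseteq> carrier M}"
  then have E: "finite E" "E \<subseteq> carrier M" by auto
  then obtain \<U> where \<U>: "open_cover (pontryagin_dual M) \<U>"
    and le: "\<And>F. finite F \<Longrightarrow> card (orbit_span M (uminus ` F) E) \<le>
        cover_number (pontryagin_dual M) (cover_join (pontryagin_dual M) act F \<U>)"
    by (rule card_le_cover_number_join) blast
  from eventually_finite_nonempty have "\<forall>\<^sub>F F in folner_filter. ereal (log_growth E F / real (card F))
      \<le> ereal (ln (real (cover_number (pontryagin_dual M) (cover_join (pontryagin_dual M) act F \<U>))) / real (card F))"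
    by eventually_elim (auto simp: log_growth_def intro!: divide_right_mono ln_of_nat_mono le)
  then have "ereal (growth_rate E) \<le> cover_entropy (pontryagin_dual M) act \<U>"
    unfolding cover_entropy_def Limsup_log_growth[OF assms E, symmetric] by (rule Limsup_mono)
  also have "\<dots> \<le> (SUP \<U>\<in>{\<U>. open_cover (pontryagin_dual M) \<U>}. cover_entropy (pontryagin_dual M) act \<U>)"
    using \<U> by (intro SUP_upper) auto
  finally show "ereal (growth_rate E) \<le> \<dots>" .
qed

section \<open>Growth rates and extensions by one element\<close>

lemma growth_rate_le:
  assumes "finite E" "E \<subseteq> carrier M" "finite F" "F \<noteq> {}"
  shows "growth_rate E \<le> log_growth E F / real (card F)"
  unfolding growth_rate_def using assms submodular_invariant.mean_le[OF submodular_invariant_log_growth] by blast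

lemma growth_rate_nonneg: "finite E \<Longrightarrow> E \<subseteq> carrier M \<Longrightarrow> growth_rate E \<ge> 0"
  unfolding growth_rate_def by (intro submodular_invariant.mean_nonneg submodular_invariant_log_growth)

lemma tendsto_growth_rate:
  assumes "finite E" "E \<subseteq> carrier M"
  shows "((\<lambda>F. log_growth E F / real (card F)) \<longlongrightarrow> growth_rate E) folner_filter"
  unfolding growth_rate_def by (intro submodular_invariant.tendsto_mean submodular_invariant_log_growth assms)

lemma tendsto_growth_rate_dilate:
  assumes "finite E" "E \<subseteq> carrier M" "finite K" "0 \<in> K"
  shows "((\<lambda>F. log_growth E (dilate K F) / real (card F)) \<longlongrightarrow> growth_rate E) folner_filter"
  unfolding growth_rate_def by (intro submodular_invariant.tendsto_mean_dilate submodular_invariant_log_growth assms)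

lemma log_growth_mono:
  assumes "finite E" "E \<subseteq> carrier M" "finite E'" "E' \<subseteq> carrier M" "finite F" "finite F'"
    and "orbit_span M (uminus ` F) E \<subseteq> orbit_span M (uminus ` F') E'"
  shows "log_growth E F \<le> log_growth E' F'"
  unfolding log_growth_def
  by (intro ln_of_nat_mono card_mono finite_orbit_span) (use assms in auto)

lemma orbit_span_neg_dilate:
  assumes "E \<subseteq> carrier M" "E' \<subseteq> orbit_span M S E" "uminus ` S \<subseteq> K"
  shows "orbit_span M (uminus ` F) E' \<subseteq> orbit_span M (uminus ` dilate K F) E"
proof -
  have "uminus ` uminus ` S \<subseteq> uminus ` K" using assms(3) by (rule image_mono)
  then have "S \<subseteq> uminus ` K" by (simp add: image_image)
  then have "dilate (uminus ` F) S \<subseteq> uminus ` dilate K F"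
    unfolding uminus_dilate by (rule dilate_mono_right)
  then have "orbit_span M (dilate (uminus ` F) S) E \<subseteq> orbit_span M (uminus ` dilate K F) E"
    by (rule orbit_span_mono) simp
  with orbit_span_dilate[OF assms(1,2)] show ?thesis by (rule order_trans)
qed

text \<open>
  The span of \<open>F\<^sup>-\<^sup>1 E'\<close> lies in that of \<open>(K F)\<^sup>-\<^sup>1 E\<close> with \<open>K = S\<^sup>-\<^sup>1\<close>, and dilation
  by a fixed set does not affect the limit.
\<close>

lemma growth_rate_le_if_subset_orbit_span:
  assumes am: "amenable TYPE('g)" and E: "finite E" "E \<subseteq> carrier M" "finite E'" "E' \<subseteq> carrier M"
    and S: "finite S" "E' \<subseteq> orbit_span M S E"
  shows "growth_rate E' \<le> growth_rate E"
proof (rule tendsto_le[OF folner_filter_neq_bot[OF am]])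
  let ?K = "insert 0 (uminus ` S)"
  show "((\<lambda>F. log_growth E (dilate ?K F) / real (card F)) \<longlongrightarrow> growth_rate E) folner_filter"
    by (rule tendsto_growth_rate_dilate[OF E(1,2)]) (use S in auto)
  show "((\<lambda>F. log_growth E' F / real (card F)) \<longlongrightarrow> growth_rate E') folner_filter"
    by (rule tendsto_growth_rate[OF E(3,4)])
  from eventually_finite_nonempty
  show "\<forall>\<^sub>F F in folner_filter. log_growth E' F / real (card F) \<le> log_growth E (dilate ?K F) / real (card F)"
  proof eventually_elim
    case (elim F)
    then have "log_growth E' F \<le> log_growth E (dilate ?K F)"
      using S by (intro log_growth_mono E orbit_span_neg_dilate[OF E(2) S(2)]) auto
    then show ?case by (rule divide_right_mono) simp
  qed
qed

lemma mem_orbit_span_0: "E \<subseteq> carrier M \<Longrightarrow> x \<in> E \<Longrightarrow> x \<in> orbit_span M {0} E"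
  using orbit_span_single[of E 0 "{0}" x 1] by (auto simp: smult_one)

lemma growth_rate_mono:
  assumes "amenable TYPE('g)" "finite E" "E \<subseteq> carrier M" "E' \<subseteq> E"
  shows "growth_rate E' \<le> growth_rate E"
proof (rule growth_rate_le_if_subset_orbit_span[of E E' "{0}"])
  show "E' \<subseteq> orbit_span M {0} E" using assms mem_orbit_span_0[OF assms(3)] by blast
qed (use assms finite_subset in auto)

lemma growth_rate_empty: "growth_rate {} = 0"
  using growth_rate_le[of "{}" "{0}"] growth_rate_nonneg[of "{}"] by (simp add: log_growth_def)

lemma card_uminus_image: "card (uminus ` F) = card (F :: 'g set)"
  by (intro card_image) (auto simp: inj_on_def)

text \<open>
  The span of \<open>F\<^sup>-\<^sup>1 x\<close> has dimension \<open>card F\<close> and is independent of that of \<open>F\<^sup>-\<^sup>1 E\<close>.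
\<close>

lemma growth_rate_insert_free:
  assumes am: "amenable TYPE('g)" and E: "finite E" "E \<subseteq> carrier M" and x: "x \<in> carrier M"
    and free: "\<And>a T. finite T \<Longrightarrow> a \<odot> x \<in> orbit_span M T E \<Longrightarrow> a = 0"
  shows "growth_rate (insert x E) = growth_rate E + ln (real CARD('k))"
proof (rule tendsto_unique[OF folner_filter_neq_bot[OF am]])
  have ins: "finite (insert x E)" "insert x E \<subseteq> carrier M" using E x by auto
  show "((\<lambda>F. log_growth (insert x E) F / real (card F)) \<longlongrightarrow> growth_rate (insert x E)) folner_filter"
    by (rule tendsto_growth_rate[OF ins])
  have "((\<lambda>F. log_growth E F / real (card F) + ln (real CARD('k))) \<longlongrightarrow> growth_rate E + ln (real CARD('k))) folner_filter"
    by (intro tendsto_intros tendsto_growth_rate E)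
  moreover have "\<forall>\<^sub>F F in folner_filter. log_growth E F / real (card F) + ln (real CARD('k)) =
      log_growth (insert x E) F / real (card F)"
    using eventually_finite_nonempty
  proof eventually_elim
    case (elim F)
    let ?T = "uminus ` F"
    let ?A = "orbit_span M ?T {x}" and ?B = "orbit_span M ?T E"
    have x1: "{x} \<subseteq> carrier M" using x by auto
    have fin: "finite ?T" "finite ?A" "finite ?B"
      using elim E x by (auto intro!: finite_orbit_span)
    note sub = additive_subgroup_orbit_span[OF x1, of ?T] additive_subgroup_orbit_span[OF E(2), of ?T]
    have "inj_on (\<lambda>a. a \<odot> x) (supported ?T)"
    proof (rule inj_onI)
      fix a b :: "'g \<Rightarrow>\<^sub>0 'k" assume "a \<odot> x = b \<odot> x"
      then have "(a - b) \<odot> x = \<zero>" using x by (simp add: smult_diff_left smult_closed a_minus_def r_neg)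
      then have "(a - b) \<odot> x \<in> orbit_span M {} E" by simp
      then show "a = b" using free[of "{}" "a - b"] by simp
    qed
    then have cA: "card ?A = CARD('k) ^ card F"
      using elim x by (simp add: orbit_span_singleton card_image card_supported card_uminus_image)
    have "?A \<inter> ?B = {\<zero>}"
    proof
      show "?A \<inter> ?B \<subseteq> {\<zero>}"
      proof
        fix y assume "y \<in> ?A \<inter> ?B"
        then obtain a where "y = a \<odot> x" "a \<odot> x \<in> ?B" using x by (auto simp: orbit_span_singleton)
        moreover from this have "a = 0" using free[OF fin(1)] by blast
        ultimately show "y \<in> {\<zero>}" using x by (simp add: smult_zero_left)
      qed
    qed (auto intro: orbit_span.zero)
    moreover have "orbit_span M ?T (insert x E) = ?A <+>\<^bsub>M\<^esub> ?B"
      using orbit_span_Un_right[OF x1 E(2), of ?T] by simp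
    ultimately have "card (orbit_span M ?T (insert x E)) = CARD('k) ^ card F * card ?B"
      using card_set_add[OF sub fin(2,3)] cA by simp
    then have "log_growth (insert x E) F = real (card F) * ln (real CARD('k)) + log_growth E F"
      using card_orbit_span_pos[OF fin(1) E] by (simp add: log_growth_def ln_mult ln_realpow)
    moreover have "card F > 0" using elim by (simp add: card_gt_0_iff)
    ultimately show ?case by (simp add: field_simps)
  qed
  ultimately show "((\<lambda>F. log_growth (insert x E) F / real (card F)) \<longlongrightarrow> growth_rate E + ln (real CARD('k))) folner_filter"
    by (rule Lim_transform_eventually)
qed

text \<open>
  Let \<open>A\<close> be the span of \<open>(K F)\<^sup>-\<^sup>1 E\<close>, and let \<open>C\<close> be the space of coefficients with
  support in \<open>(K F)\<^sup>-\<^sup>1\<close>, so that \<open>B = C x\<close> contains \<open>F\<^sup>-\<^sup>1 x\<close>. The choice of \<open>K\<close>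
  ensures that \<open>C\<close> contains the space \<open>D\<close> of all \<open>a f\<close> with \<open>a\<close> supported in
  \<open>F\<^sup>-\<^sup>1\<close>, and that \<open>D x \<subseteq> A\<close>. As \<open>f\<close> is not a zero-divisor, \<open>D\<close> has dimension
  \<open>card F\<close>, so \<open>B\<close> enlarges \<open>A\<close> by at most the codimension \<open>card (K F) - card F\<close> of
  \<open>D\<close> in \<open>C\<close>.
\<close>

lemma log_growth_insert_torsion:
  assumes nzd: "\<And>a b :: 'g \<Rightarrow>\<^sub>0 'k. a * b = 0 \<Longrightarrow> a = 0 \<or> b = 0"
    and E: "finite E" "E \<subseteq> carrier M" and x: "x \<in> carrier M"
    and f: "f \<noteq> 0" "finite S" "f \<odot> x \<in> orbit_span M S E"
    and K: "K = insert 0 (uminus ` S \<union> uminus ` Poly_Mapping.keys f)"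
    and F: "finite F"
  shows "log_growth (insert x E) F \<le> log_growth E (dilate K F) +
    (real (card (dilate K F)) - real (card F)) * ln (real CARD('k))"
proof -
  let ?T = "uminus ` F" and ?T' = "uminus ` dilate K F"
  let ?A = "orbit_span M ?T' E" and ?B = "orbit_span M ?T' {x}"
  let ?C = "supported ?T' :: ('g \<Rightarrow>\<^sub>0 'k) set" and ?D = "(\<lambda>a. a * f) ` supported ?T"
  let ?ann = "\<lambda>D. {a \<in> D. a \<odot> x = \<zero>}"
  have K': "finite K" "0 \<in> K" using f K by auto
  have x1: "{x} \<subseteq> carrier M" using x by auto
  have fin: "finite ?T" "finite ?T'" "finite ?A" "finite ?B" "finite ?C" "finite ?D"
    using F E x K' by (auto intro!: finite_orbit_span)
  note sub = additive_subgroup_orbit_span[OF E(2), of ?T'] additive_subgroup_orbit_span[OF x1, of ?T']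
  have DC: "?D \<subseteq> ?C"
  proof clarify
    fix a :: "'g \<Rightarrow>\<^sub>0 'k" assume a: "a \<in> supported ?T"
    have "Poly_Mapping.keys (a * f) \<subseteq> {s + t | s t. s \<in> Poly_Mapping.keys a \<and> t \<in> Poly_Mapping.keys f}"
      by (rule keys_mult)
    also have "\<dots> \<subseteq> ?T'"
    proof clarify
      fix s t assume "s \<in> Poly_Mapping.keys a" "t \<in> Poly_Mapping.keys f"
      then have "s \<in> ?T" "- t \<in> K" using a by (auto simp: supported_def K)
      then have "s \<in> ?T" "- (- t) \<in> uminus ` K" by blast+
      then show "s + t \<in> ?T'" using plus_in_dilate[of s ?T t "uminus ` K"] by (simp add: uminus_dilate)
    qed
    finally show "a * f \<in> ?C" by (simp add: supported_def)
  qed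
  have "inj_on (\<lambda>a. a * f) (supported ?T)"
  proof (rule inj_onI)
    fix a b assume "a * f = b * f"
    then have "(a - b) * f = 0" by (simp add: left_diff_distrib)
    then show "a = b" using nzd f(1) by fastforce
  qed
  then have cD: "card ?D = CARD('k) ^ card F"
    using fin by (simp add: card_image card_supported card_uminus_image)
  have cC: "card ?C = CARD('k) ^ card (dilate K F)"
    using fin by (simp add: card_supported card_uminus_image)
  have "(\<lambda>a. a \<odot> x) ` ?D \<subseteq> ?A"
  proof clarify
    fix a :: "'g \<Rightarrow>\<^sub>0 'k" assume a: "a \<in> supported ?T"
    have fx: "f \<odot> x \<in> carrier M" using x by (rule smult_closed)
    have "(a * f) \<odot> x = a \<odot> (f \<odot> x)" using x by (rule smult_assoc)
    also have "\<dots> \<in> orbit_span M ?T {f \<odot> x}" using a fx by (simp add: orbit_span_singleton)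
    also have "\<dots> \<subseteq> ?A" by (rule orbit_span_neg_dilate[OF E(2), of _ S]) (use f K in auto)
    finally show "(a * f) \<odot> x \<in> ?A" .
  qed
  moreover have "(\<lambda>a. a \<odot> x) ` ?D \<subseteq> ?B" using DC x by (auto simp: orbit_span_singleton)
  ultimately have cI: "card ((\<lambda>a. a \<odot> x) ` ?D) \<le> card (?A \<inter> ?B)"
    using fin by (intro card_mono) auto
  have cD': "card ?D = card ((\<lambda>a. a \<odot> x) ` ?D) * card (?ann ?D)"
  proof (rule card_eq_card_smult_image_mult[OF x fin(6)])
    fix a b assume "a \<in> ?D" "b \<in> ?D"
    then obtain a' b' where *: "a = a' * f" "b = b' * f" "a' \<in> supported ?T" "b' \<in> supported ?T" by auto
    then show "a + b \<in> ?D" by (intro image_eqI[of _ _ "a' + b'"]) (auto simp: distrib_right intro: supported_add)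
    show "a - b \<in> ?D" using * by (intro image_eqI[of _ _ "a' - b'"]) (auto simp: left_diff_distrib intro: supported_diff)
  qed
  have cC': "card ?C = card ?B * card (?ann ?C)"
    unfolding orbit_span_singleton[OF x]
    by (rule card_eq_card_smult_image_mult[OF x fin(5)]) (auto intro: supported_add supported_diff)
  have cann: "card (?ann ?D) \<le> card (?ann ?C)" using DC fin by (intro card_mono) auto
  have "card (?A <+>\<^bsub>M\<^esub> ?B) * card ?D = card (?A <+>\<^bsub>M\<^esub> ?B) * card ((\<lambda>a. a \<odot> x) ` ?D) * card (?ann ?D)"
    using cD' by simp
  also have "\<dots> \<le> card (?A <+>\<^bsub>M\<^esub> ?B) * card (?A \<inter> ?B) * card (?ann ?C)"
    by (intro mult_mono cI cann) auto
  also have "\<dots> = card ?A * card ?C"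
    using card_set_add[OF sub fin(3,4)] cC' by simp
  finally have le: "card (orbit_span M ?T' (insert x E)) * CARD('k) ^ card F \<le> card ?A * CARD('k) ^ card (dilate K F)"
    using orbit_span_Un_right[OF E(2) x1, of ?T'] cD cC by simp
  have pos: "card ?A > 0" "card (orbit_span M ?T' (insert x E)) > 0"
    using fin E x by (auto intro!: card_orbit_span_pos)
  have "ln (real (card (orbit_span M ?T' (insert x E)) * CARD('k) ^ card F)) \<le> ln (real (card ?A * CARD('k) ^ card (dilate K F)))"
    by (rule ln_of_nat_mono[OF le])
  then have "log_growth (insert x E) (dilate K F) + real (card F) * ln (real CARD('k)) \<le>
      log_growth E (dilate K F) + real (card (dilate K F)) * ln (real CARD('k))"
    using pos by (simp add: log_growth_def ln_mult ln_realpow)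
  moreover have "log_growth (insert x E) F \<le> log_growth (insert x E) (dilate K F)"
    using E x F K' subset_dilate[OF K'(2), of F] by (intro log_growth_mono orbit_span_mono) auto
  ultimately show ?thesis by (simp add: algebra_simps)
qed

lemma growth_rate_insert_torsion:
  assumes am: "amenable TYPE('g)" and nzd: "\<And>a b :: 'g \<Rightarrow>\<^sub>0 'k. a * b = 0 \<Longrightarrow> a = 0 \<or> b = 0"
    and E: "finite E" "E \<subseteq> carrier M" and x: "x \<in> carrier M"
    and f: "f \<noteq> 0" "finite S" "f \<odot> x \<in> orbit_span M S E"
  shows "growth_rate (insert x E) = growth_rate E"
proof (rule antisym)
  define K where "K = insert 0 (uminus ` S \<union> uminus ` Poly_Mapping.keys f)"
  have K: "finite K" "0 \<in> K" using f by (auto simp: K_def)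
  have ins: "finite (insert x E)" "insert x E \<subseteq> carrier M" using E x by auto
  let ?q = "ln (real CARD('k))"
  show "growth_rate E \<le> growth_rate (insert x E)" by (rule growth_rate_mono[OF am ins]) auto
  show "growth_rate (insert x E) \<le> growth_rate E"
  proof (rule tendsto_le[OF folner_filter_neq_bot[OF am]])
    have "((\<lambda>F. log_growth E (dilate K F) / real (card F) + (real (card (dilate K F)) / real (card F) - 1) * ?q)
        \<longlongrightarrow> growth_rate E + (1 - 1) * ?q) folner_filter"
      by (intro tendsto_intros tendsto_growth_rate_dilate tendsto_card_dilate E K)
    then show "((\<lambda>F. log_growth E (dilate K F) / real (card F) + (real (card (dilate K F)) / real (card F) - 1) * ?q)
        \<longlongrightarrow> growth_rate E) folner_filter" by simp
    show "((\<lambda>F. log_growth (insert x E) F / real (card F)) \<longlongrightarrow> growth_rate (insert x E)) folner_filter"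
      by (rule tendsto_growth_rate[OF ins])
    from eventually_finite_nonempty
    show "\<forall>\<^sub>F F in folner_filter. log_growth (insert x E) F / real (card F) \<le>
        log_growth E (dilate K F) / real (card F) + (real (card (dilate K F)) / real (card F) - 1) * ?q"
    proof eventually_elim
      case (elim F)
      then have "real (card F) > 0" by (simp add: card_gt_0_iff)
      moreover have "log_growth (insert x E) F \<le> log_growth E (dilate K F) + (real (card (dilate K F)) - real (card F)) * ?q"
        using log_growth_insert_torsion[OF nzd E x f K_def] elim by blast
      ultimately show ?case by (simp add: field_simps)
    qed
  qed
qed

text \<open>
  Each new element adds either nothing or \<open>ln (card k)\<close>, according to whether it is torsion
  modulo the submodule generated by the previous ones.
\<close>

lemma growth_rate_eq_nat_mult:
  assumes am: "amenable TYPE('g)" and nzd: "\<And>a b :: 'g \<Rightarrow>\<^sub>0 'k. a * b = 0 \<Longrightarrow> a = 0 \<or> b = 0"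
    and "finite E" "E \<subseteq> carrier M"
  shows "\<exists>n::nat. growth_rate E = real n * ln (real CARD('k))"
  using assms(3,4)
proof (induction E rule: finite_induct)
  case empty
  then show ?case by (intro exI[of _ 0]) (simp add: growth_rate_empty)
next
  case (insert x E)
  then obtain n where n: "growth_rate E = real n * ln (real CARD('k))" by auto
  have E: "finite E" "E \<subseteq> carrier M" "x \<in> carrier M" using insert by auto
  show ?case
  proof (cases "\<exists>f S. f \<noteq> 0 \<and> finite S \<and> f \<odot> x \<in> orbit_span M S E")
    case True
    then obtain f S where "f \<noteq> 0" "finite S" "f \<odot> x \<in> orbit_span M S E" by blast
    from growth_rate_insert_torsion[OF am nzd E this] n show ?thesis by auto
  next
    case False
    then have "growth_rate (insert x E) = growth_rate E + ln (real CARD('k))"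
      by (intro growth_rate_insert_free[OF am E]) blast
    then show ?thesis using n by (intro exI[of _ "Suc n"]) (simp add: algebra_simps)
  qed
qed

text \<open>
  For \<open>F\<close> the inverse of the support of \<open>a\<close>, the map from the coefficients supported in
  \<open>F\<^sup>-\<^sup>1\<close> to the span of \<open>F\<^sup>-\<^sup>1 x\<close> has \<open>a\<close> in its kernel. As an infimum, the growth
  rate is bounded by this single \<open>F\<close>.
\<close>

lemma growth_rate_singleton_less:
  assumes x: "x \<in> carrier M" and a: "a \<noteq> 0" "a \<odot> x = \<zero>"
  shows "growth_rate {x} < ln (real CARD('k))"
proof -
  let ?T = "Poly_Mapping.keys a" and ?F = "uminus ` Poly_Mapping.keys a"
  have T: "uminus ` ?F = ?T" by (simp add: image_image)
  have ne: "?T \<noteq> {}" using a(1) by (simp add: poly_mapping_eq_iff fun_eq_iff set_eq_iff in_keys_iff)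
  let ?D = "supported ?T :: ('g \<Rightarrow>\<^sub>0 'k) set"
  \<comment> \<open>Two elements in the kernel, so the image has at most half as many elements as the domain.\<close>
  have "{0, a} \<subseteq> {b \<in> ?D. b \<odot> x = \<zero>}" using a x by (auto simp: smult_zero_left supported_def)
  then have "card {0, a} \<le> card {b \<in> ?D. b \<odot> x = \<zero>}" by (intro card_mono) auto
  then have two: "2 \<le> card {b \<in> ?D. b \<odot> x = \<zero>}" using a(1) by simp
  have "card ?D = card (orbit_span M ?T {x}) * card {b \<in> ?D. b \<odot> x = \<zero>}"
    unfolding orbit_span_singleton[OF x]
    by (rule card_eq_card_smult_image_mult[OF x]) (auto intro: supported_add supported_diff)
  moreover have pos: "card (orbit_span M ?T {x}) > 0" using x by (intro card_orbit_span_pos) auto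
  ultimately have "card (orbit_span M ?T {x}) * 2 \<le> CARD('k) ^ card ?T"
    using two by (simp add: card_supported)
  then have "real (card (orbit_span M ?T {x})) < real (CARD('k) ^ card ?T)" using pos by linarith
  then have "ln (real (card (orbit_span M ?T {x}))) < ln (real CARD('k) ^ card ?T)"
    using pos by (simp)
  then have "log_growth {x} ?F < real (card ?F) * ln (real CARD('k))"
    using card_uminus_image[of ?T] by (simp add: log_growth_def T ln_realpow)
  moreover have "card ?F > 0" using ne by (simp add: card_gt_0_iff)
  ultimately have "log_growth {x} ?F / real (card ?F) < ln (real CARD('k))" by (simp add: field_simps)
  then show ?thesis using growth_rate_le[of "{x}" ?F] x ne by auto
qed

proposition torsion_eq_growth_rate:
  assumes am: "amenable TYPE('g)" and S: "finite S" "S \<subseteq> carrier M"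
    and gen: "\<And>x. x \<in> carrier M \<Longrightarrow> \<exists>T. finite T \<and> x \<in> orbit_span M T S"
  shows "torsion (int_group_module M) = ereal (growth_rate S)"
  unfolding torsion_eq_SUP_growth_rate[OF am]
proof (rule antisym)
  show "ereal (growth_rate S) \<le> (SUP E\<in>{E. finite E \<and> E \<subseteq> carrier M}. ereal (growth_rate E))"
    using S by (intro SUP_upper) auto
  show "(SUP E\<in>{E. finite E \<and> E \<subseteq> carrier M}. ereal (growth_rate E)) \<le> ereal (growth_rate S)"
  proof (rule SUP_least)
    fix E assume "E \<in> {E. finite E \<and> E \<subseteq> carrier M}"
    then have E: "finite E" "E \<subseteq> carrier M" by auto
    then obtain T where T: "\<And>x. x \<in> E \<Longrightarrow> finite (T x) \<and> x \<in> orbit_span M (T x) S"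
      using gen by (metis subsetD)
    have "finite (\<Union>x\<in>E. T x)" using E T by auto
    moreover have "E \<subseteq> orbit_span M (\<Union>x\<in>E. T x) S"
      using T orbit_span_mono[of "T _" "\<Union>x\<in>E. T x" S S M] by blast
    ultimately show "ereal (growth_rate E) \<le> ereal (growth_rate S)"
      using growth_rate_le_if_subset_orbit_span[OF am S E] by simp
  qed
qed

lemma finitely_generated_orbit_span:
  assumes "finitely_generated M"
  obtains S where "finite S" "S \<subseteq> carrier M" "\<And>x. x \<in> carrier M \<Longrightarrow> \<exists>T. finite T \<and> x \<in> orbit_span M T S"
proof -
  obtain S where S: "finite S" "S \<subseteq> carrier M"
    and gen: "\<And>x. x \<in> carrier M \<Longrightarrow> \<exists>a. x = (\<Oplus>s\<in>S. a s \<odot> s)"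
    using assms by (auto simp: finitely_generated_def)
  have "\<exists>T. finite T \<and> x \<in> orbit_span M T S" if x: "x \<in> carrier M" for x
  proof -
    obtain a where a: "x = (\<Oplus>s\<in>S. a s \<odot> s)" using gen[OF x] by blast
    let ?T = "\<Union>s\<in>S. Poly_Mapping.keys (a s)"
    have "(\<Oplus>s\<in>R. a s \<odot> s) \<in> orbit_span M ?T S" if "R \<subseteq> S" for R
      using finite_subset[OF that S(1)] that
    proof (induction R rule: finite_induct)
      case empty
      then show ?case by (simp add: orbit_span.zero)
    next
      case (insert s R)
      have s: "s \<in> carrier M" using insert S by auto
      have "a s \<odot> s \<in> orbit_span M ?T {s}"
        using insert.prems s by (auto simp: orbit_span_singleton supported_def)
      then have "a s \<odot> s \<in> orbit_span M ?T S"
        using orbit_span_mono[of ?T ?T "{s}" S M] insert.prems by auto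
      moreover have "(\<Oplus>s\<in>insert s R. a s \<odot> s) = a s \<odot> s \<oplus> (\<Oplus>s\<in>R. a s \<odot> s)"
        using insert S by (intro finsum_insert) (auto intro!: smult_closed)
      ultimately show ?case using insert S by (auto intro: orbit_span_add)
    qed
    then have "x \<in> orbit_span M ?T S" using a by auto
    then show ?thesis using S by (intro exI[of _ ?T]) auto
  qed
  with S show ?thesis by (rule that)
qed

lemma countable_if_finitely_generated:
  assumes "finitely_generated M" "countable (UNIV :: 'g set)"
  shows "countable (carrier M)"
proof -
  obtain S where S: "finite S" "S \<subseteq> carrier M" "\<And>x. x \<in> carrier M \<Longrightarrow> \<exists>T. finite T \<and> x \<in> orbit_span M T S"
    using finitely_generated_orbit_span[OF assms(1)] by blast
  have "countable {T :: 'g set. finite T \<and> T \<subseteq> UNIV}"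
    using assms(2) by (rule countable_Collect_finite_subset)
  then have "countable (\<Union>T\<in>{T :: 'g set. finite T \<and> T \<subseteq> UNIV}. orbit_span M T S)"
    using S by (intro countable_UN) (auto intro!: countable_finite[OF finite_orbit_span])
  moreover have "carrier M \<subseteq> (\<Union>T\<in>{T :: 'g set. finite T \<and> T \<subseteq> UNIV}. orbit_span M T S)"
    using S(3) by auto
  ultimately show ?thesis using countable_subset by blast
qed

end

section \<open>Cyclic modules\<close>

lemma left_module_regular_module: "left_module (regular_module :: ('r::ring_1, 'r) module)"
proof -
  have "abelian_group (regular_module :: ('r, 'r) module)"
  proof (rule abelian_groupI)
    fix x :: 'r
    show "\<exists>y\<in>carrier regular_module. y \<oplus>\<^bsub>regular_module\<^esub> x = \<zero>\<^bsub>regular_module\<^esub>"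
      by (intro bexI[of _ "- x"]) (simp_all add: regular_module_def)
  qed (simp_all add: regular_module_def add.commute add.assoc)
  then show ?thesis
    by (intro left_module.intro left_module_axioms.intro)
      (simp_all add: regular_module_def distrib_left distrib_right mult.assoc)
qed

definition coset :: "'r::ring_1 set \<Rightarrow> 'r \<Rightarrow> 'r set" where
  "coset J a = (\<lambda>h. h + a) ` J"

lemma r_coset_regular_module: "J +>\<^bsub>regular_module\<^esub> a = coset J a"
  by (auto simp: a_r_coset_def' coset_def regular_module_def)

context
  fixes J :: "'r::ring_1 set"
  assumes J: "left_ideal J"
begin

lemma left_ideal_zero: "0 \<in> J"
  and left_ideal_add: "x \<in> J \<Longrightarrow> y \<in> J \<Longrightarrow> x + y \<in> J"
  and left_ideal_mult: "x \<in> J \<Longrightarrow> a * x \<in> J"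
  using J by (auto simp: left_ideal_def)

lemma left_ideal_minus: "x \<in> J \<Longrightarrow> - x \<in> J"
  using left_ideal_mult[of x "- 1"] by simp

lemma left_ideal_diff: "x \<in> J \<Longrightarrow> y \<in> J \<Longrightarrow> x - y \<in> J"
  using left_ideal_add[of x "- y"] left_ideal_minus[of y] by simp

lemma mem_coset_iff: "x \<in> coset J a \<longleftrightarrow> x - a \<in> J"
  by (auto simp: coset_def image_iff intro: bexI[of _ "x - a"])

lemma coset_eq_iff: "coset J a = coset J b \<longleftrightarrow> a - b \<in> J"
proof
  assume "coset J a = coset J b"
  then have "a \<in> coset J b" using left_ideal_zero mem_coset_iff[of a a] by simp
  then show "a - b \<in> J" by (simp add: mem_coset_iff)
next
  assume ab: "a - b \<in> J"
  have "x - a \<in> J \<longleftrightarrow> x - b \<in> J" for x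
    using left_ideal_add[of "x - a" "a - b"] left_ideal_diff[of "x - b" "a - b"] ab by auto
  then show "coset J a = coset J b" by (auto simp: mem_coset_iff)
qed

lemma coset_zero: "coset J 0 = J"
  by (simp add: coset_def)

lemma carrier_quotient: "carrier (quotient_module regular_module J) = range (coset J)"
  by (auto simp: quotient_module_def A_RCOSETS_def' r_coset_regular_module)
    (auto simp: regular_module_def)

lemma zero_quotient: "\<zero>\<^bsub>quotient_module regular_module J\<^esub> = coset J 0"
  by (simp add: quotient_module_def coset_zero)

lemma add_quotient: "coset J a \<oplus>\<^bsub>quotient_module regular_module J\<^esub> coset J b = coset J (a + b)"
proof -
  have "coset J a <+>\<^bsub>regular_module\<^esub> coset J b = (\<Union>x\<in>coset J a. \<Union>y\<in>coset J b. {x + y})"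
    by (simp add: set_add_def' regular_module_def)
  also have "\<dots> = coset J (a + b)"
  proof (intro equalityI subsetI)
    fix z assume "z \<in> (\<Union>x\<in>coset J a. \<Union>y\<in>coset J b. {x + y})"
    then obtain x y where "z = x + y" "x - a \<in> J" "y - b \<in> J" by (auto simp: mem_coset_iff)
    then show "z \<in> coset J (a + b)"
      using left_ideal_add[of "x - a" "y - b"] by (simp add: mem_coset_iff algebra_simps)
  next
    fix z assume "z \<in> coset J (a + b)"
    then have "z - b \<in> coset J a" "b \<in> coset J b"
      using left_ideal_zero by (simp_all add: mem_coset_iff algebra_simps)
    then have "(z - b) + b \<in> (\<Union>x\<in>coset J a. \<Union>y\<in>coset J b. {x + y})" by blast
    then show "z \<in> (\<Union>x\<in>coset J a. \<Union>y\<in>coset J b. {x + y})" by simp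
  qed
  finally show ?thesis by (simp add: quotient_module_def)
qed

lemma smult_quotient: "c \<odot>\<^bsub>quotient_module regular_module J\<^esub> coset J a = coset J (c * a)"
proof -
  have "c \<odot>\<^bsub>quotient_module regular_module J\<^esub> coset J a = (\<Union>x\<in>coset J a. coset J (c * x))"
    by (simp add: quotient_module_def r_coset_regular_module) (simp add: regular_module_def)
  also have "\<dots> = (\<Union>x\<in>coset J a. coset J (c * a))"
  proof (intro SUP_cong refl)
    fix x assume "x \<in> coset J a"
    then show "coset J (c * x) = coset J (c * a)"
      using left_ideal_mult[of "x - a" c] by (simp add: coset_eq_iff mem_coset_iff right_diff_distrib)
  qed
  also have "\<dots> = coset J (c * a)" using left_ideal_zero by (auto simp: coset_def)
  finally show ?thesis .
qed

lemma left_module_quotient: "left_module (quotient_module regular_module J)"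
proof -
  note simps = carrier_quotient zero_quotient add_quotient smult_quotient
  have "abelian_group (quotient_module regular_module J)"
  proof (rule abelian_groupI)
    fix x assume "x \<in> carrier (quotient_module regular_module J)"
    then obtain a where "x = coset J a" by (auto simp: simps)
    then show "\<exists>y\<in>carrier (quotient_module regular_module J).
        y \<oplus>\<^bsub>quotient_module regular_module J\<^esub> x = \<zero>\<^bsub>quotient_module regular_module J\<^esub>"
      by (intro bexI[of _ "coset J (- a)"]) (simp_all add: simps)
  qed (auto simp: simps ac_simps)
  then show ?thesis
    by (intro left_module.intro left_module_axioms.intro)
      (auto simp: simps distrib_left distrib_right mult.assoc)
qed

end

lemma left_ideal_principal: "left_ideal (principal_left_ideal f)"
  unfolding left_ideal_def principal_left_ideal_def
proof (intro conjI ballI allI)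
  show "0 \<in> range (\<lambda>a. a * f)" by (auto simp: image_iff intro: exI[of _ 0])
  fix x assume "x \<in> range (\<lambda>a. a * f)"
  then obtain a where x: "x = a * f" by auto
  show "b * x \<in> range (\<lambda>a. a * f)" for b by (auto simp: x mult.assoc[symmetric])
  fix y assume "y \<in> range (\<lambda>a. a * f)"
  then obtain b where "y = b * f" by auto
  then have "x + y = (a + b) * f" using x by (simp add: distrib_right)
  then show "x + y \<in> range (\<lambda>a. a * f)" by blast
qed

lemma principal_left_ideal_eq_0_iff: "principal_left_ideal f = {0} \<longleftrightarrow> f = 0"
proof
  assume "principal_left_ideal f = {0}"
  moreover have "1 * f \<in> principal_left_ideal f" unfolding principal_left_ideal_def by blast
  ultimately show "f = 0" by simp
qed (auto simp: principal_left_ideal_def)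

lemma group_ring_module_regular: "group_ring_module (regular_module :: ('g::group_add \<Rightarrow>\<^sub>0 'k::{field,finite}, _) module)"
  by (rule group_ring_module.intro[OF left_module_regular_module])

lemma group_ring_module_quotient:
  "left_ideal J \<Longrightarrow> group_ring_module (quotient_module regular_module (J :: ('g::group_add \<Rightarrow>\<^sub>0 'k::{field,finite}) set))"
  by (rule group_ring_module.intro[OF left_module_quotient])

lemma quotient_generator:
  fixes J :: "('g::group_add \<Rightarrow>\<^sub>0 'k::{field,finite}) set"
  assumes J: "left_ideal J"
  defines "Q \<equiv> quotient_module regular_module J"
  shows "coset J 1 \<in> carrier Q"
    and "a \<odot>\<^bsub>Q\<^esub> coset J 1 = coset J a"
    and "a \<odot>\<^bsub>Q\<^esub> coset J 1 = \<zero>\<^bsub>Q\<^esub> \<longleftrightarrow> a \<in> J"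
    and "x \<in> carrier Q \<Longrightarrow> \<exists>a. x = a \<odot>\<^bsub>Q\<^esub> coset J 1"
  unfolding Q_def
  by (auto simp: carrier_quotient[OF J] smult_quotient[OF J] zero_quotient[OF J] coset_eq_iff[OF J])

lemma torsion_quotient:
  fixes J :: "('g::group_add \<Rightarrow>\<^sub>0 'k::{field,finite}) set"
  assumes am: "amenable TYPE('g)" and J: "left_ideal J"
  shows "torsion (int_group_module (quotient_module regular_module J)) =
    ereal (group_ring_module.growth_rate (quotient_module regular_module J) {coset J 1})"
proof -
  interpret Q: group_ring_module "quotient_module regular_module J" by (rule group_ring_module_quotient[OF J])
  note gen = quotient_generator[OF J]
  show ?thesis
  proof (rule Q.torsion_eq_growth_rate[OF am])
    fix x assume "x \<in> carrier (quotient_module regular_module J)"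
    then obtain a where "x = a \<odot>\<^bsub>quotient_module regular_module J\<^esub> coset J 1" using gen(4) by blast
    then have "x \<in> orbit_span (quotient_module regular_module J) (Poly_Mapping.keys a) {coset J 1}"
      unfolding Q.orbit_span_singleton[OF gen(1)] by (auto simp: supported_def)
    then show "\<exists>T. finite T \<and> x \<in> orbit_span (quotient_module regular_module J) T {coset J 1}"
      by (intro exI[of _ "Poly_Mapping.keys a"]) simp
  qed (use gen in auto)
qed

text \<open>
  A copy of \<open>M\<close> with carrier in another type. It is used for quotient modules, whose
  carriers consist of sets, where modules with carriers in a given type are called for.
\<close>

definition transport :: "('r::ring_1, 'a) module \<Rightarrow> ('a \<Rightarrow> 'b) \<Rightarrow> ('r, 'b) module" where
  "transport M \<iota> =
    \<lparr>carrier = \<iota> ` carrier M, mult = undefined, one = undefined, zero = \<iota> \<zero>\<^bsub>M\<^esub>,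
     add = (\<lambda>x y. \<iota> (inv_into (carrier M) \<iota> x \<oplus>\<^bsub>M\<^esub> inv_into (carrier M) \<iota> y)),
     smult = (\<lambda>a x. \<iota> (a \<odot>\<^bsub>M\<^esub> inv_into (carrier M) \<iota> x))\<rparr>"

lemma left_module_transport:
  assumes "left_module M" and inj: "inj_on \<iota> (carrier M)"
  shows "left_module (transport M \<iota>)"
proof -
  interpret left_module M by fact
  have [simp]: "inv_into (carrier M) \<iota> (\<iota> x) = x" if "x \<in> carrier M" for x
    using inj that by (rule inv_into_f_f)
  have "abelian_group (transport M \<iota>)"
  proof (rule abelian_groupI)
    fix x assume "x \<in> carrier (transport M \<iota>)"
    then obtain y where "y \<in> carrier M" "x = \<iota> y" by (auto simp: transport_def)
    then show "\<exists>y\<in>carrier (transport M \<iota>). y \<oplus>\<^bsub>transport M \<iota>\<^esub> x = \<zero>\<^bsub>transport M \<iota>\<^esub>"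
      by (intro bexI[of _ "\<iota> (\<ominus>\<^bsub>M\<^esub> y)"]) (simp_all add: transport_def l_neg)
  qed (auto simp: transport_def a_ac)
  then show ?thesis
    by (intro left_module.intro left_module_axioms.intro)
      (auto simp: transport_def smult_closed smult_l_distr smult_r_distr smult_assoc smult_one)
qed

lemma orbit_span_transport:
  fixes M :: "('g::group_add \<Rightarrow>\<^sub>0 'k::{field,finite}, 'a) module"
  assumes M: "left_module M" and inj: "inj_on \<iota> (carrier M)" and E: "E \<subseteq> carrier M"
  shows "orbit_span (transport M \<iota>) T (\<iota> ` E) = \<iota> ` orbit_span M T E"
proof -
  interpret group_ring_module M by (rule group_ring_module.intro[OF M])
  have [simp]: "inv_into (carrier M) \<iota> (\<iota> x) = x" if "x \<in> carrier M" for x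
    using inj that by (rule inv_into_f_f)
  note closed = orbit_span_closed[OF E, of T, THEN subsetD] E[THEN subsetD]
  show ?thesis
  proof (intro equalityI subsetI)
    fix y assume "y \<in> orbit_span (transport M \<iota>) T (\<iota> ` E)"
    then show "y \<in> \<iota> ` orbit_span M T E"
    proof induction
      case zero
      then show ?case by (auto simp: transport_def intro: orbit_span.zero)
    next
      case (step y t x c)
      then obtain y' x' where "y = \<iota> y'" "y' \<in> orbit_span M T E" "x = \<iota> x'" "x' \<in> E" by blast
      then show ?case using step.hyps
        by (auto simp: transport_def closed smult_closed intro!: imageI orbit_span.step)
    qed
  next
    fix z assume "z \<in> \<iota> ` orbit_span M T E"
    then obtain y where y: "z = \<iota> y" "y \<in> orbit_span M T E" by blast
    have "\<iota> y \<in> orbit_span (transport M \<iota>) T (\<iota> ` E)"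
      using y(2)
    proof induction
      case zero
      then show ?case using orbit_span.zero[of "transport M \<iota>"] by (simp add: transport_def)
    next
      case (step y t x c)
      have "Poly_Mapping.single t c \<odot>\<^bsub>transport M \<iota>\<^esub> \<iota> x \<oplus>\<^bsub>transport M \<iota>\<^esub> \<iota> y
          \<in> orbit_span (transport M \<iota>) T (\<iota> ` E)"
        using step by (intro orbit_span.step) auto
      then show ?case using step by (simp add: transport_def closed smult_closed)
    qed
    then show "z \<in> orbit_span (transport M \<iota>) T (\<iota> ` E)" using y by simp
  qed
qed

lemma growth_rate_transport:
  fixes M :: "('g::group_add \<Rightarrow>\<^sub>0 'k::{field,finite}, 'a) module"
  assumes M: "left_module M" and inj: "inj_on \<iota> (carrier M)" and E: "E \<subseteq> carrier M"
  shows "group_ring_module.growth_rate (transport M \<iota>) (\<iota> ` E) = group_ring_module.growth_rate M E"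
proof -
  interpret group_ring_module M by (rule group_ring_module.intro[OF M])
  interpret N: group_ring_module "transport M \<iota>"
    by (rule group_ring_module.intro[OF left_module_transport[OF M inj]])
  have "inj_on \<iota> (orbit_span M T E)" for T
    using inj orbit_span_closed[OF E] by (rule inj_on_subset)
  then have "N.log_growth (\<iota> ` E) = log_growth E"
    by (simp add: fun_eq_iff N.log_growth_def log_growth_def orbit_span_transport[OF M inj E] card_image)
  then show ?thesis by (simp add: N.growth_rate_def growth_rate_def)
qed

section \<open>Translates of subspaces of the group ring\<close>

text \<open>
  Multiplication by \<open>single 0 c\<close> is scaling by \<open>c\<close>.
\<close>

definition coefficient_subspace :: "('g::monoid_add \<Rightarrow>\<^sub>0 'k::field) set \<Rightarrow> bool" where
  "coefficient_subspace W \<longleftrightarrow> 0 \<in> W \<and> (\<forall>v\<in>W. \<forall>w\<in>W. v + w \<in> W) \<and>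
     (\<forall>c. \<forall>w\<in>W. Poly_Mapping.single 0 c * w \<in> W)"

lemma lookup_single_0_mult: "Poly_Mapping.lookup (Poly_Mapping.single 0 c * w) x = c * Poly_Mapping.lookup w x"
  for w :: "'g::monoid_add \<Rightarrow>\<^sub>0 'k::field"
  by (simp add: mult_map_scale_conv_mult[symmetric] Poly_Mapping.map.rep_eq when_def)

lemma coefficient_subspace_diff:
  assumes "coefficient_subspace W" "v \<in> W" "w \<in> W"
  shows "v - w \<in> W"
proof -
  have "Poly_Mapping.single 0 (- 1) * w \<in> W" using assms by (simp add: coefficient_subspace_def)
  moreover have "Poly_Mapping.single 0 (- 1) * w = - w"
    by (rule poly_mapping_eqI) (simp add: lookup_single_0_mult)
  ultimately have "v + (- w) \<in> W" using assms by (metis coefficient_subspace_def)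
  then show ?thesis by simp
qed

lemma coefficient_subspace_kernel:
  assumes "coefficient_subspace W"
  shows "coefficient_subspace {w \<in> W. Poly_Mapping.lookup w x = 0}"
  using assms by (auto simp: coefficient_subspace_def lookup_add lookup_single_0_mult)

text \<open>
  A coordinate functional on a subspace is either zero or onto \<open>k\<close>.
\<close>

lemma ln_card_coefficient_subspace:
  fixes W :: "('g::monoid_add \<Rightarrow>\<^sub>0 'k::{field,finite}) set"
  assumes W: "coefficient_subspace W" "finite W"
  shows "ln (real (card W)) = ln (real (card {w \<in> W. Poly_Mapping.lookup w x = 0})) +
    (if \<exists>w\<in>W. Poly_Mapping.lookup w x \<noteq> 0 then ln (real CARD('k)) else 0)"
proof (cases "\<exists>w\<in>W. Poly_Mapping.lookup w x \<noteq> 0")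
  case True
  then obtain w where w: "w \<in> W" "Poly_Mapping.lookup w x \<noteq> 0" by blast
  let ?f = "\<lambda>w. Poly_Mapping.lookup w x" and ?W' = "{w \<in> W. Poly_Mapping.lookup w x = 0}"
  have "c \<in> ?f ` W" for c
  proof -
    have "Poly_Mapping.single 0 (c / ?f w) * w \<in> W" using W w by (simp add: coefficient_subspace_def)
    moreover have "c = ?f (Poly_Mapping.single 0 (c / ?f w) * w)" using w by (simp add: lookup_single_0_mult)
    ultimately show ?thesis by blast
  qed
  then have surj: "?f ` W = UNIV" by blast
  have "card W = card (?f ` W) * card ?W'"
  proof (rule card_eq_card_image_mult[OF W(2)])
    fix a assume a: "a \<in> W"
    have "bij_betw (\<lambda>b. b - a) {b \<in> W. ?f b = ?f a} ?W'"
      by (rule bij_betwI[where g = "\<lambda>b. b + a"])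
        (use a W in \<open>auto simp: lookup_minus lookup_add coefficient_subspace_diff coefficient_subspace_def\<close>)
    then show "card {b \<in> W. ?f b = ?f a} = card ?W'" by (rule bij_betw_same_card)
  qed
  moreover have "card ?W' > 0" using W by (auto simp: card_gt_0_iff coefficient_subspace_def intro!: exI[of _ 0])
  ultimately show ?thesis using True by (simp add: surj ln_mult)
next
  case False
  then have "{w \<in> W. Poly_Mapping.lookup w x = 0} = W" by auto
  then show ?thesis using False by simp
qed

text \<open>
  A dual of Shearer's inequality: if no coordinate is used by more than \<open>m\<close> of the
  subspaces \<open>W i\<close>, then their dimensions add up to at most \<open>m\<close> times that of any subspace
  containing them. Imposing the equation that the coordinate \<open>x\<close> vanishes lowers by one the
  dimensions of at most \<open>m\<close> of the \<open>W i\<close>, and that of \<open>U\<close> if there is any such \<open>i\<close>.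
\<close>

lemma sum_ln_card_le_ln_card:
  fixes U :: "('g::monoid_add \<Rightarrow>\<^sub>0 'k::{field,finite}) set"
  assumes "finite X" "finite I"
    and "\<And>i. i \<in> I \<Longrightarrow> coefficient_subspace (W i) \<and> W i \<subseteq> supported X \<and> W i \<subseteq> U"
    and "coefficient_subspace U" "finite U"
    and "\<And>x. x \<in> X \<Longrightarrow> card {i \<in> I. \<exists>w\<in>W i. Poly_Mapping.lookup w x \<noteq> 0} \<le> m"
  shows "(\<Sum>i\<in>I. ln (real (card (W i)))) \<le> real m * ln (real (card U))"
  using assms(1,3-6)
proof (induction X arbitrary: W U rule: finite_induct)
  case empty
  have "W i = {0}" if "i \<in> I" for i
    using empty.prems(1)[OF that] by (auto simp: supported_eq coefficient_subspace_def poly_mapping_eq_iff fun_eq_iff)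
  then have "(\<Sum>i\<in>I. ln (real (card (W i)))) = 0" by simp
  moreover have "card U > 0" using empty.prems(2,3) by (auto simp: coefficient_subspace_def card_gt_0_iff)
  ultimately show ?case by simp
next
  case (insert x X)
  let ?q = "ln (real CARD('k))"
  define W' where "W' = (\<lambda>i. {w \<in> W i. Poly_Mapping.lookup w x = 0})"
  define U' where "U' = {w \<in> U. Poly_Mapping.lookup w x = 0}"
  let ?I = "{i \<in> I. \<exists>w\<in>W i. Poly_Mapping.lookup w x \<noteq> 0}"
  have q: "?q > 0" using card_field_gt_1[where 'k = 'k] by simp
  have IH: "(\<Sum>i\<in>I. ln (real (card (W' i)))) \<le> real m * ln (real (card U'))"
  proof (rule insert.IH)
    show "coefficient_subspace (W' i) \<and> W' i \<subseteq> supported X \<and> W' i \<subseteq> U'" if "i \<in> I" for i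
      using insert.prems(1)[OF that]
      by (auto simp: W'_def U'_def supported_eq coefficient_subspace_kernel subset_iff)
    show "coefficient_subspace U'" unfolding U'_def by (rule coefficient_subspace_kernel[OF insert.prems(2)])
    show "finite U'" using insert.prems by (simp add: U'_def)
    fix y assume "y \<in> X"
    have "card {i \<in> I. \<exists>w\<in>W' i. Poly_Mapping.lookup w y \<noteq> 0} \<le> card {i \<in> I. \<exists>w\<in>W i. Poly_Mapping.lookup w y \<noteq> 0}"
      using assms(2) by (intro card_mono) (auto simp: W'_def)
    also have "\<dots> \<le> m" using insert.prems(4) \<open>y \<in> X\<close> by simp
    finally show "card {i \<in> I. \<exists>w\<in>W' i. Poly_Mapping.lookup w y \<noteq> 0} \<le> m" .
  qed
  have fin: "finite (W i)" if "i \<in> I" for i using insert.prems(1)[OF that] insert.prems(3) finite_subset by blast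
  have "(\<Sum>i\<in>I. ln (real (card (W i)))) =
      (\<Sum>i\<in>I. ln (real (card (W' i))) + (if \<exists>w\<in>W i. Poly_Mapping.lookup w x \<noteq> 0 then ?q else 0))"
    unfolding W'_def using insert.prems(1) fin by (intro sum.cong ln_card_coefficient_subspace) auto
  also have "\<dots> = (\<Sum>i\<in>I. ln (real (card (W' i)))) + real (card ?I) * ?q"
    using assms(2) by (simp add: sum.distrib sum.If_cases Int_def)
  also have "\<dots> \<le> real m * ln (real (card U')) +
      real m * (if \<exists>w\<in>U. Poly_Mapping.lookup w x \<noteq> 0 then ?q else 0)"
  proof (intro add_mono IH)
    show "real (card ?I) * ?q \<le> real m * (if \<exists>w\<in>U. Poly_Mapping.lookup w x \<noteq> 0 then ?q else 0)"
    proof (cases "?I = {}")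
      case True
      show ?thesis unfolding True using q by simp
    next
      case False
      then have "\<exists>w\<in>U. Poly_Mapping.lookup w x \<noteq> 0" using insert.prems(1) by blast
      moreover have "card ?I \<le> m" using insert.prems(4)[of x] by simp
      ultimately show ?thesis using q by simp
    qed
  qed
  also have "\<dots> = real m * ln (real (card U))"
    unfolding ln_card_coefficient_subspace[OF insert.prems(2,3), of x] U'_def by (simp add: distrib_left)
  finally show ?case .
qed

text \<open>
  Fix \<open>E\<close>, and let \<open>W\<close> be the space of elements of \<open>J\<close> with support in \<open>E\<^sup>-\<^sup>1\<close>; its
  codimension in all elements with support in \<open>E\<^sup>-\<^sup>1\<close> is the dimension of the span of
  \<open>E\<^sup>-\<^sup>1\<close> in the quotient. So the claim amounts to \<open>dim W \<le> card E * r\<close>, with \<open>r\<close> the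
  growth rate of \<open>f\<close> divided by \<open>ln (card k)\<close>. At most \<open>card E\<close> of the translates
  \<open>g\<^sup>-\<^sup>1 W\<close> with \<open>g \<in> F\<close> involve a given coordinate, hence they span a space of dimension
  at least \<open>card F * dim W / card E\<close>. This space lies in the span of \<open>(K F)\<^sup>-\<^sup>1 f\<close>, where
  \<open>K\<close> depends on \<open>E\<close> only. The claim follows as \<open>F\<close> becomes more and more invariant.
\<close>

lemma growth_rate_quotient_principal_ge:
  fixes f :: "'g::group_add \<Rightarrow>\<^sub>0 'k::{field,finite}"
  assumes am: "amenable TYPE('g)"
  defines "J \<equiv> principal_left_ideal f"
  shows "ln (real CARD('k)) - group_ring_module.growth_rate regular_module {f} \<le>
    group_ring_module.growth_rate (quotient_module regular_module J) {coset J 1}"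
proof -
  let ?Q = "quotient_module regular_module J"
  let ?R = "regular_module :: ('g \<Rightarrow>\<^sub>0 'k, _) module"
  have J: "left_ideal J" unfolding J_def by (rule left_ideal_principal)
  interpret Q: group_ring_module ?Q by (rule group_ring_module_quotient[OF J])
  interpret R: group_ring_module ?R by (rule group_ring_module_regular)
  note gen = quotient_generator[OF J]
  have f_in: "f \<in> carrier ?R" "{f} \<subseteq> carrier ?R" by (auto simp: regular_module_def)
  have span_f: "orbit_span ?R T {f} = (\<lambda>a. a * f) ` supported T" for T
    unfolding R.orbit_span_singleton[OF f_in(1)] by (simp add: regular_module_def)
  let ?q = "ln (real CARD('k))"
  have key: "(?q - R.growth_rate {f}) * real (card E) \<le> Q.log_growth {coset J 1} E"
    if E: "finite E" "E \<noteq> {}" for E :: "'g set"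
  proof -
    let ?T = "uminus ` E"
    define W where "W = supported ?T \<inter> J"
    have finW: "finite W" using E by (simp add: W_def)
    have subW: "coefficient_subspace W"
      unfolding coefficient_subspace_def W_def
      using left_ideal_zero[OF J] left_ideal_add[OF J] left_ideal_mult[OF J]
      by (auto intro: supported_add) (auto simp: supported_eq lookup_single_0_mult)
    have cW: "card W > 0" using subW finW by (auto simp: card_gt_0_iff coefficient_subspace_def)
    have "card (supported ?T :: ('g \<Rightarrow>\<^sub>0 'k) set) = card (orbit_span ?Q ?T {coset J 1}) *
        card {a \<in> supported ?T. a \<odot>\<^bsub>?Q\<^esub> coset J 1 = \<zero>\<^bsub>?Q\<^esub>}"
      unfolding Q.orbit_span_singleton[OF gen(1)]
      by (rule Q.card_eq_card_smult_image_mult[OF gen(1)]) (use E in \<open>auto intro: supported_add supported_diff\<close>)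
    also have "{a \<in> supported ?T. a \<odot>\<^bsub>?Q\<^esub> coset J 1 = \<zero>\<^bsub>?Q\<^esub>} = W"
      using gen(3) by (auto simp: W_def)
    finally have "CARD('k) ^ card E = card (orbit_span ?Q ?T {coset J 1}) * card W"
      using E by (simp add: card_supported Q.card_uminus_image)
    then have "real CARD('k) ^ card E = real (card (orbit_span ?Q ?T {coset J 1})) * real (card W)"
      by (metis of_nat_mult of_nat_power)
    moreover have "card (orbit_span ?Q ?T {coset J 1}) > 0"
      using gen(1) E by (intro Q.card_orbit_span_pos) auto
    ultimately have "real (card E) * ?q = Q.log_growth {coset J 1} E + ln (real (card W))"
      using cW by (simp add: Q.log_growth_def ln_mult flip: ln_realpow)
    moreover have "ln (real (card W)) \<le> real (card E) * R.growth_rate {f}"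
    proof -
      have "\<exists>a. w = a * f" if "w \<in> W" for w
        using that by (auto simp: W_def J_def principal_left_ideal_def)
      then obtain a where a: "\<And>w. w \<in> W \<Longrightarrow> w = a w * f" by metis
      define S where "S = (\<Union>w\<in>W. Poly_Mapping.keys (a w))"
      have S: "finite S" "W \<subseteq> orbit_span ?R S {f}"
        using finW a by (auto simp: S_def span_f supported_def image_iff)
      define K where "K = insert 0 (uminus ` S)"
      have K: "finite K" "0 \<in> K" "uminus ` S \<subseteq> K" using S by (auto simp: K_def)
      have le: "real (card F) * ln (real (card W)) \<le> real (card E) * R.log_growth {f} (dilate K F)"
        if F: "finite F" for F :: "'g set"
      proof -
        define U where "U = orbit_span ?R (uminus ` dilate K F) {f}"
        \<comment> \<open>The translates \<open>g\<^sup>-\<^sup>1 W\<close>; all of them lie in the span \<open>U\<close> of \<open>(K F)\<^sup>-\<^sup>1 f\<close>.\<close>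
        define V where "V = (\<lambda>g. (\<lambda>w. Poly_Mapping.single (- g) 1 * w) ` W)"
        have U: "finite U" unfolding U_def using F K f_in by (intro R.finite_orbit_span) auto
        have single_U: "Poly_Mapping.single t c * w \<in> orbit_span ?R ((+) t ` T) {f}"
          if "w \<in> orbit_span ?R T {f}" for t c w T
          using R.smult_orbit_span[OF f_in(2) that, of t c] by (simp add: regular_module_def)
        have subU: "coefficient_subspace U"
          unfolding coefficient_subspace_def
        proof (intro conjI ballI allI)
          show "0 \<in> U" unfolding U_def using orbit_span.zero[of ?R] by (simp add: regular_module_def)
          show "v + w \<in> U" if "v \<in> U" "w \<in> U" for v w
            using R.orbit_span_add[OF f_in(2)] that unfolding U_def by (simp add: regular_module_def)
          show "Poly_Mapping.single 0 c * w \<in> U" if "w \<in> U" for c w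
            using single_U[of w "uminus ` dilate K F" 0 c] that unfolding U_def by simp
        qed
        have card_V: "card (V g) = card W" for g
          unfolding V_def
        proof (intro card_image inj_onI)
          fix v w :: "'g \<Rightarrow>\<^sub>0 'k"
          assume "Poly_Mapping.single (- g) 1 * v = Poly_Mapping.single (- g) 1 * w"
          then have "Poly_Mapping.single g 1 * (Poly_Mapping.single (- g) 1 * v) =
              Poly_Mapping.single g 1 * (Poly_Mapping.single (- g) 1 * w)" by simp
          then show "v = w" by (simp add: mult.assoc[symmetric] mult_single)
        qed
        have supp_V: "\<exists>e\<in>E. y = - g - e" if v: "v \<in> V g" "Poly_Mapping.lookup v y \<noteq> 0" for g v y
        proof -
          obtain w where w: "w \<in> W" "v = Poly_Mapping.single (- g) 1 * w" using v by (auto simp: V_def)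
          have "y \<in> Poly_Mapping.keys v" using v by (simp add: in_keys_iff)
          then have "y \<in> {s + t | s t. s \<in> Poly_Mapping.keys (Poly_Mapping.single (- g) (1::'k)) \<and> t \<in> Poly_Mapping.keys w}"
            unfolding w(2) using keys_mult by blast
          then obtain t where "t \<in> Poly_Mapping.keys w" "y = - g + t" by auto
          moreover from this have "t \<in> ?T" using w(1) by (auto simp: W_def supported_def)
          ultimately show ?thesis by auto
        qed
        define X where "X = (\<Union>g\<in>F. (\<lambda>e. - g - e) ` E)"
        have "(\<Sum>g\<in>F. ln (real (card (V g)))) \<le> real (card E) * ln (real (card U))"
        proof (rule sum_ln_card_le_ln_card)
          show "finite X" using F E by (simp add: X_def)
          show "card {g \<in> F. \<exists>w\<in>V g. Poly_Mapping.lookup w y \<noteq> 0} \<le> card E" for y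
          proof -
            have "{g \<in> F. \<exists>w\<in>V g. Poly_Mapping.lookup w y \<noteq> 0} \<subseteq> (\<lambda>e. - e - y) ` E"
            proof clarify
              fix g v assume "v \<in> V g" "Poly_Mapping.lookup v y \<noteq> 0"
              then obtain e where e: "e \<in> E" "y = - g - e" using supp_V by blast
              then have "g = - e - y" by (simp add: diff_conv_add_uminus group_add_class.minus_add add.assoc[symmetric] del: add_uminus_conv_diff)
              then show "g \<in> (\<lambda>e. - e - y) ` E" using e(1) by blast
            qed
            then show ?thesis using E by (meson card_image_le card_mono finite_imageI le_trans)
          qed
          fix g assume g: "g \<in> F"
          have "coefficient_subspace (V g)"
            unfolding coefficient_subspace_def
          proof (intro conjI ballI allI)
            show "0 \<in> V g" using subW by (auto simp: V_def coefficient_subspace_def intro!: image_eqI[of _ _ 0])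
            show "v + w \<in> V g" if vw: "v \<in> V g" "w \<in> V g" for v w
            proof -
              obtain v' w' where "v = Poly_Mapping.single (- g) 1 * v'" "v' \<in> W" "w = Poly_Mapping.single (- g) 1 * w'" "w' \<in> W"
                using vw by (auto simp: V_def)
              then show ?thesis using subW unfolding V_def coefficient_subspace_def
                by (intro image_eqI[of _ _ "v' + w'"]) (auto simp: distrib_left)
            qed
            show "Poly_Mapping.single 0 c * w \<in> V g" if w: "w \<in> V g" for c w
            proof -
              obtain w' where w': "w = Poly_Mapping.single (- g) 1 * w'" "w' \<in> W"
                using w by (auto simp: V_def)
              have "Poly_Mapping.single 0 c * w = Poly_Mapping.single (- g) 1 * (Poly_Mapping.single 0 c * w')"
                by (simp add: w' mult.assoc[symmetric] mult_single)
              then show ?thesis using subW w'(2) unfolding V_def coefficient_subspace_def by blast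
            qed
          qed
          moreover have "V g \<subseteq> supported X"
            using supp_V g by (fastforce simp: supported_eq X_def)
          moreover have "V g \<subseteq> U"
          proof -
            have "V g \<subseteq> orbit_span ?R (uminus ` F) W"
            proof
              fix v assume "v \<in> V g"
              then obtain w where w: "w \<in> W" "v = Poly_Mapping.single (- g) 1 * w" by (auto simp: V_def)
              then show "v \<in> orbit_span ?R (uminus ` F) W"
                using R.orbit_span_single[of W "- g" "uminus ` F" w 1] g by (auto simp: regular_module_def)
            qed
            also have "\<dots> \<subseteq> U" unfolding U_def by (rule R.orbit_span_neg_dilate[OF f_in(2) S(2) K(3)])
            finally show ?thesis .
          qed
          ultimately show "coefficient_subspace (V g) \<and> V g \<subseteq> supported X \<and> V g \<subseteq> U" by blast
        qed (use F subU U in auto)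
        then show ?thesis by (simp add: card_V R.log_growth_def U_def)
      qed
      show ?thesis
      proof (rule tendsto_le[OF folner_filter_neq_bot[OF am]])
        show "((\<lambda>F. real (card E) * (R.log_growth {f} (dilate K F) / real (card F)))
            \<longlongrightarrow> real (card E) * R.growth_rate {f}) folner_filter"
          by (intro tendsto_mult_left R.tendsto_growth_rate_dilate f_in K) simp
        show "((\<lambda>F. ln (real (card W))) \<longlongrightarrow> ln (real (card W))) (folner_filter :: 'g set filter)"
          by (rule tendsto_const)
        from eventually_finite_nonempty
        show "\<forall>\<^sub>F F in folner_filter. ln (real (card W)) \<le> real (card E) * (R.log_growth {f} (dilate K F) / real (card F))"
        proof eventually_elim
          case (elim F)
          then have "real (card F) > 0" by (simp add: card_gt_0_iff)
          then show ?case using le[of F] elim by (simp add: field_simps)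
        qed
      qed
    qed
    ultimately show ?thesis by (simp add: algebra_simps)
  qed
  show ?thesis
  proof (rule tendsto_le[OF folner_filter_neq_bot[OF am]])
    show "((\<lambda>F. Q.log_growth {coset J 1} F / real (card F)) \<longlongrightarrow> Q.growth_rate {coset J 1}) folner_filter"
      using gen(1) by (intro Q.tendsto_growth_rate) auto
    show "((\<lambda>F. ?q - R.growth_rate {f}) \<longlongrightarrow> ?q - R.growth_rate {f}) (folner_filter :: 'g set filter)"
      by (rule tendsto_const)
    from eventually_finite_nonempty
    show "\<forall>\<^sub>F F in folner_filter. ?q - R.growth_rate {f} \<le> Q.log_growth {coset J 1} F / real (card F)"
    proof eventually_elim
      case (elim F)
      then have "real (card F) > 0" by (simp add: card_gt_0_iff)
      then show ?case using key[of F] elim by (simp add: field_simps)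
    qed
  qed
qed

section \<open>The implications\<close>

text \<open>
  If \<open>f\<close> annihilates \<open>h\<close>, then \<open>k\<Gamma> h\<close> grows more slowly than \<open>k\<Gamma>\<close>, and the quotient
  of \<open>k\<Gamma>\<close> by it must make up for the difference.
\<close>

lemma no_zero_divisors_if_torsion_zero:
  assumes am: "amenable TYPE('g::group_add)"
    and tors: "\<And>f :: 'g \<Rightarrow>\<^sub>0 'k::{field,finite}. f \<noteq> 0 \<Longrightarrow>
      torsion (int_group_module (quotient_module regular_module (principal_left_ideal f))) = 0"
    and fh: "(f :: 'g \<Rightarrow>\<^sub>0 'k) * h = 0"
  shows "f = 0 \<or> h = 0"
proof (rule ccontr)
  assume "\<not> (f = 0 \<or> h = 0)"
  then have ne: "f \<noteq> 0" "h \<noteq> 0" by auto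
  interpret R: group_ring_module "regular_module :: ('g \<Rightarrow>\<^sub>0 'k, _) module" by (rule group_ring_module_regular)
  have "R.growth_rate {h} < ln (real CARD('k))"
    by (rule R.growth_rate_singleton_less[of _ f]) (use ne fh in \<open>simp_all add: regular_module_def\<close>)
  moreover have "ereal (group_ring_module.growth_rate (quotient_module regular_module (principal_left_ideal h))
      {coset (principal_left_ideal h) 1}) = 0"
    using tors[OF ne(2)] torsion_quotient[OF am left_ideal_principal[of h]] by simp
  ultimately show False using growth_rate_quotient_principal_ge[OF am, of h] by simp
qed

text \<open>
  A supremum of natural multiples of \<open>ln (card k)\<close> is attained or infinite.
\<close>

lemma (in group_ring_module) torsion_integral:
  assumes am: "amenable TYPE('g)" and nzd: "\<And>a b :: 'g \<Rightarrow>\<^sub>0 'k. a * b = 0 \<Longrightarrow> a = 0 \<or> b = 0"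
  shows "torsion (int_group_module M) / ereal (ln (real CARD('k))) \<in>
    insert \<infinity> (range (\<lambda>n::int. ereal (of_int n)))"
proof -
  let ?q = "ln (real CARD('k))" and ?\<E> = "{E. finite E \<and> E \<subseteq> carrier M}"
  have q: "?q > 0" using card_field_gt_1[where 'k = 'k] by simp
  have "\<forall>E. \<exists>n::nat. E \<in> ?\<E> \<longrightarrow> growth_rate E = real n * ?q"
    using growth_rate_eq_nat_mult[OF am nzd] by blast
  then obtain n :: "'m set \<Rightarrow> nat" where n: "\<And>E. E \<in> ?\<E> \<Longrightarrow> growth_rate E = real (n E) * ?q" by metis
  have tors: "torsion (int_group_module M) = (SUP E\<in>?\<E>. ereal (growth_rate E))"
    by (rule torsion_eq_SUP_growth_rate[OF am])
  show ?thesis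
  proof (cases "\<exists>N. \<forall>E\<in>?\<E>. n E < N")
    case True
    then obtain N where N: "\<forall>E. E \<in> ?\<E> \<longrightarrow> n E < N" by blast
    have "{} \<in> ?\<E>" by simp
    from Lattices_Big.ex_has_greatest_nat[of "\<lambda>E. E \<in> ?\<E>", OF this N]
    obtain E0 where E0: "E0 \<in> ?\<E>" "\<forall>E. E \<in> ?\<E> \<longrightarrow> n E \<le> n E0" by (elim exE conjE)
    have "torsion (int_group_module M) = ereal (growth_rate E0)"
      unfolding tors
    proof (rule antisym)
      show "(SUP E\<in>?\<E>. ereal (growth_rate E)) \<le> ereal (growth_rate E0)"
        using E0 q by (intro SUP_least) (simp add: n)
      show "ereal (growth_rate E0) \<le> (SUP E\<in>?\<E>. ereal (growth_rate E))"
        by (rule SUP_upper[OF E0(1)])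
    qed
    then have "torsion (int_group_module M) / ereal ?q = ereal (of_int (int (n E0)))"
      using q n[OF E0(1)] by simp
    then show ?thesis by blast
  next
    case False
    have "torsion (int_group_module M) = \<infinity>"
      unfolding tors
    proof (rule SUP_PInfty)
      fix m :: nat
      obtain N :: nat where "real m < real N * ?q" using q ex_less_of_nat_mult by blast
      moreover obtain E where "E \<in> ?\<E>" "n E \<ge> N" using False by (meson not_le)
      moreover from this have "real N * ?q \<le> growth_rate E" using q by (simp add: n)
      ultimately show "\<exists>E\<in>?\<E>. ereal (real m) \<le> ereal (growth_rate E)"
        by (intro bexI[of _ E]) auto
    qed
    then show ?thesis using q by simp
  qed
qed

text \<open>
  A nonzero element of \<open>J\<close> annihilates the generator of the quotient, whose torsion
  therefore lies in \<open>[0, ln (card k))\<close>. Integrality is applied to a copy of the quotient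
  with carrier in \<open>'m\<close>.
\<close>

lemma torsion_quotient_eq_0_if_integral:
  fixes J :: "('g::{group_add,countable} \<Rightarrow>\<^sub>0 'k::{field,finite}) set"
  assumes am: "amenable TYPE('g)" and inf: "infinite (UNIV :: 'm set)"
    and int: "\<And>M :: ('g \<Rightarrow>\<^sub>0 'k, 'm) module. left_module M \<Longrightarrow> finitely_generated M \<Longrightarrow>
      torsion (int_group_module M) / ereal (ln (real CARD('k))) \<in> range (\<lambda>n::int. ereal (of_int n))"
    and J: "left_ideal J" "J \<noteq> {0}"
  shows "torsion (int_group_module (quotient_module regular_module J)) = 0"
proof -
  let ?Q = "quotient_module regular_module J" and ?q = "ln (real CARD('k))"
  have q: "?q > 0" using card_field_gt_1[where 'k = 'k] by simp
  interpret Q: group_ring_module ?Q by (rule group_ring_module_quotient[OF J(1)])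
  note gen = quotient_generator[OF J(1)]
  have Q1: "{coset J 1} \<subseteq> carrier ?Q" using gen(1) by simp
  have fgQ: "finitely_generated ?Q"
    unfolding finitely_generated_def
  proof (intro exI[of _ "{coset J 1}"] conjI ballI)
    fix x assume x: "x \<in> carrier ?Q"
    then obtain a where "x = a \<odot>\<^bsub>?Q\<^esub> coset J 1" using gen(4) by blast
    then show "\<exists>a. x = (\<Oplus>\<^bsub>?Q\<^esub>s\<in>{coset J 1}. a s \<odot>\<^bsub>?Q\<^esub> s)"
      using x by (intro exI[of _ "\<lambda>_. a"]) (simp add: Q.finsum_insert)
  qed (use Q1 in auto)
  then have cntQ: "countable (carrier ?Q)" by (rule Q.countable_if_finitely_generated) simp
  obtain \<phi> :: "nat \<Rightarrow> 'm" where \<phi>: "inj \<phi>" using infinite_countable_subset[OF inf] by blast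
  define \<iota> where "\<iota> = \<phi> \<circ> to_nat_on (carrier ?Q)"
  have inj: "inj_on \<iota> (carrier ?Q)"
    unfolding \<iota>_def using inj_on_to_nat_on[OF cntQ] \<phi> by (auto intro: comp_inj_on inj_on_subset)
  let ?N = "transport ?Q \<iota>"
  have lmQ: "left_module ?Q" by (rule left_module_quotient[OF J(1)])
  have lmN: "left_module ?N" by (rule left_module_transport[OF lmQ inj])
  interpret N: group_ring_module ?N by (rule group_ring_module.intro[OF lmN])
  have N1: "\<iota> (coset J 1) \<in> carrier ?N" using gen(1) by (simp add: transport_def)
  have genN: "\<exists>a. x = a \<odot>\<^bsub>?N\<^esub> \<iota> (coset J 1)" if x: "x \<in> carrier ?N" for x
  proof -
    obtain y where y: "y \<in> carrier ?Q" "x = \<iota> y" using x by (auto simp: transport_def)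
    then obtain a where "y = a \<odot>\<^bsub>?Q\<^esub> coset J 1" using gen(4) by blast
    then show ?thesis using y inv_into_f_f[OF inj gen(1)] by (auto simp: transport_def)
  qed
  have fgN: "finitely_generated ?N"
    unfolding finitely_generated_def
  proof (intro exI[of _ "{\<iota> (coset J 1)}"] conjI ballI)
    fix x assume x: "x \<in> carrier ?N"
    then obtain a where "x = a \<odot>\<^bsub>?N\<^esub> \<iota> (coset J 1)" using genN by blast
    then show "\<exists>a. x = (\<Oplus>\<^bsub>?N\<^esub>s\<in>{\<iota> (coset J 1)}. a s \<odot>\<^bsub>?N\<^esub> s)"
      using x by (intro exI[of _ "\<lambda>_. a"]) (simp add: N.finsum_insert)
  qed (use N1 in auto)
  have torsQ: "torsion (int_group_module ?Q) = ereal (Q.growth_rate {coset J 1})"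
    by (rule torsion_quotient[OF am J(1)])
  have "torsion (int_group_module ?N) = ereal (N.growth_rate {\<iota> (coset J 1)})"
  proof (rule N.torsion_eq_growth_rate[OF am])
    fix x assume "x \<in> carrier ?N"
    then obtain a where "x = a \<odot>\<^bsub>?N\<^esub> \<iota> (coset J 1)" using genN by blast
    then have "x \<in> orbit_span ?N (Poly_Mapping.keys a) {\<iota> (coset J 1)}"
      unfolding N.orbit_span_singleton[OF N1] by (auto simp: supported_def)
    then show "\<exists>T. finite T \<and> x \<in> orbit_span ?N T {\<iota> (coset J 1)}"
      by (intro exI[of _ "Poly_Mapping.keys a"]) simp
  qed (use N1 in auto)
  also have "N.growth_rate {\<iota> (coset J 1)} = Q.growth_rate {coset J 1}"
    using growth_rate_transport[OF lmQ inj Q1] by simp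
  finally have "ereal (Q.growth_rate {coset J 1}) / ereal ?q \<in> range (\<lambda>n::int. ereal (of_int n))"
    using int[OF lmN fgN] by simp
  then obtain n :: int where "ereal (Q.growth_rate {coset J 1}) / ereal ?q = ereal (of_int n)" by auto
  then have n: "Q.growth_rate {coset J 1} = of_int n * ?q" using q by (simp add: field_simps)
  obtain a where a: "a \<in> J" "a \<noteq> 0" using J left_ideal_zero[OF J(1)] by blast
  have "Q.growth_rate {coset J 1} < ?q"
    by (rule Q.growth_rate_singleton_less[OF gen(1) a(2)]) (use gen(3) a(1) in simp)
  moreover have "Q.growth_rate {coset J 1} \<ge> 0" using Q1 by (intro Q.growth_rate_nonneg) auto
  ultimately have "real_of_int n < 1" "real_of_int n \<ge> 0" using n q by (simp_all add: zero_le_mult_iff)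
  then have "n = 0" by linarith
  then show ?thesis using torsQ n by simp
qed

theorem lemma4p4:
  assumes "amenable TYPE('g::{group_add, countable})"
    and "infinite (UNIV :: 'm set)"
  shows
    "((\<forall>M :: ('g \<Rightarrow>\<^sub>0 'k::{field, finite}, 'm) module.
         left_module M \<and> countable (carrier M) \<longrightarrow>
         torsion (int_group_module M) / ereal (ln (real CARD('k)))
           \<in> insert \<infinity> (range (\<lambda>n::int. ereal (of_int n))))
      \<longleftrightarrow>
      (\<forall>M :: ('g \<Rightarrow>\<^sub>0 'k, 'm) module.
         left_module M \<and> finitely_generated M \<longrightarrow>
         torsion (int_group_module M) / ereal (ln (real CARD('k)))
           \<in> range (\<lambda>n::int. ereal (of_int n))))
     \<and>
     ((\<forall>M :: ('g \<Rightarrow>\<^sub>0 'k, 'm) module.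
         left_module M \<and> finitely_generated M \<longrightarrow>
         torsion (int_group_module M) / ereal (ln (real CARD('k)))
           \<in> range (\<lambda>n::int. ereal (of_int n)))
      \<longleftrightarrow>
      (\<forall>J :: ('g \<Rightarrow>\<^sub>0 'k) set. left_ideal J \<and> J \<noteq> {0} \<longrightarrow>
         torsion (int_group_module (quotient_module regular_module J)) = 0))
     \<and>
     ((\<forall>J :: ('g \<Rightarrow>\<^sub>0 'k) set. left_ideal J \<and> J \<noteq> {0} \<longrightarrow>
         torsion (int_group_module (quotient_module regular_module J)) = 0)
      \<longleftrightarrow>
      (\<forall>f :: 'g \<Rightarrow>\<^sub>0 'k. f \<noteq> 0 \<longrightarrow>
         torsion (int_group_module
           (quotient_module regular_module (principal_left_ideal f))) = 0))
     \<and>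
     ((\<forall>f :: 'g \<Rightarrow>\<^sub>0 'k. f \<noteq> 0 \<longrightarrow>
         torsion (int_group_module
           (quotient_module regular_module (principal_left_ideal f))) = 0)
      \<longleftrightarrow>
      (\<forall>f h :: 'g \<Rightarrow>\<^sub>0 'k. f * h = 0 \<longrightarrow> f = 0 \<or> h = 0))"
    (is "(?P1 \<longleftrightarrow> ?P2) \<and> (?P2 \<longleftrightarrow> ?P3) \<and> (?P3 \<longleftrightarrow> ?P4) \<and> (?P4 \<longleftrightarrow> ?P5)")
proof -
  note am = assms(1)
  have q: "ln (real CARD('k)) > 0" using card_field_gt_1[where 'k = 'k] by simp
  have 12: ?P2 if P1: ?P1
  proof (intro allI impI, elim conjE)
    fix M :: "('g \<Rightarrow>\<^sub>0 'k, 'm) module"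
    assume M: "left_module M" "finitely_generated M"
    interpret group_ring_module M by (rule group_ring_module.intro[OF M(1)])
    have "countable (carrier M)" by (rule countable_if_finitely_generated[OF M(2)]) simp
    with P1 M(1) have tors: "torsion (int_group_module M) / ereal (ln (real CARD('k)))
        \<in> insert \<infinity> (range (\<lambda>n::int. ereal (of_int n)))" by blast
    obtain S where "finite S" "S \<subseteq> carrier M" "\<And>x. x \<in> carrier M \<Longrightarrow> \<exists>T. finite T \<and> x \<in> orbit_span M T S"
      by (rule finitely_generated_orbit_span[OF M(2)]) blast
    then have "torsion (int_group_module M) = ereal (growth_rate S)" by (rule torsion_eq_growth_rate[OF am])
    then show "torsion (int_group_module M) / ereal (ln (real CARD('k))) \<in> range (\<lambda>n::int. ereal (of_int n))"
      using tors q by auto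
  qed
  have 23: ?P3 if P2: ?P2
    using torsion_quotient_eq_0_if_integral[OF am assms(2)] P2 by blast
  have 34: ?P4 if P3: ?P3
    using P3 left_ideal_principal principal_left_ideal_eq_0_iff by blast
  have 45: ?P5 if P4: ?P4
    using no_zero_divisors_if_torsion_zero[OF am] P4 by blast
  have 51: ?P1 if P5: ?P5
  proof (intro allI impI, elim conjE)
    fix M :: "('g \<Rightarrow>\<^sub>0 'k, 'm) module"
    assume M: "left_module M"
    interpret group_ring_module M by (rule group_ring_module.intro[OF M])
    show "torsion (int_group_module M) / ereal (ln (real CARD('k)))
        \<in> insert \<infinity> (range (\<lambda>n::int. ereal (of_int n)))"
      using torsion_integral[OF am] P5 by blast
  qed
  show ?thesis using 12 23 34 45 51 by argo
qed

end
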